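(* Let $\mathbb{D}$ be the open unit disk in $\mathbb{R}^2$ and $\mathbb{S}=\partial\mathbb{D}$ the unit circle. There exists $f\in L^1(\mathbb{S})$ such that the minimization problem $$\min\Big\{\int_{\mathbb{D}}|Dw| \;:\; w\in BV(\mathbb{D}),\ w|_{\mathbb{S}}=f\Big\}$$ has no solution; that is, there is no $w\in BV(\mathbb{D})$ with $w|_{\mathbb{S}}=f$ such that $\int_{\mathbb{D}}|Dw|\le\int_{\mathbb{D}}|Dv|$ for every $v\in BV(\mathbb{D})$ with $v|_{\mathbb{S}}=f$.
   Context: $BV(\mathbb{D})$ is the space of (real-valued) functions of bounded variation on $\mathbb{D}$; $\int_{\mathbb{D}}|Dw|$ is the total mass on $\mathbb{D}$ of the total variation measure $|Dw|$ of the distributional gradient of $w$; $w|_{\mathbb{S}}\in L^1(\mathbb{S})$ is the trace of $w$ on $\mathbb{S}$ in the sense of $BV$ functions, and $L^1(\mathbb{S})$ is taken with respect to arc length (one-dimensional Hausdorff measure). Equality of traces is $\mathcal{H}^1$-a.e. *)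

theory Defs
  imports "HOL-Analysis.Analysis"
begin

abbreviation disk :: "(real^2) set" where
  "disk \<equiv> ball 0 1"

abbreviation disk_borel :: "(real^2) measure" where
  "disk_borel \<equiv> restrict_space borel disk"

text \<open>Arc length (one-dimensional Hausdorff measure) on the unit circle: the image of
  Lebesgue measure under the injective unit-speed parametrisation of the circle. Elements of
  \<open>L\<^sup>1\<close> of the circle are represented by functions that are integrable for this measure; it lives
  on the circle only, so their values off the circle are irrelevant.\<close>

definition circle_measure :: "(real^2) measure" where
  "circle_measure =
     distr (restrict_space lborel {0..<2 * pi}) (restrict_space borel (sphere 0 1))
       (\<lambda>t. vector [cos t, sin t])"

definition C1 :: "('a::euclidean_space \<Rightarrow> 'b::euclidean_space) \<Rightarrow> bool" where
  "C1 \<phi> \<longleftrightarrow> (\<forall>x. \<phi> differentiable (at x)) \<and>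
     (\<forall>v. continuous_on UNIV (\<lambda>x. frechet_derivative \<phi> (at x) v))"

definition C1c :: "'a::euclidean_space set \<Rightarrow> ('a \<Rightarrow> 'b::euclidean_space) \<Rightarrow> bool" where
  "C1c U \<phi> \<longleftrightarrow> C1 \<phi> \<and> (\<exists>K. compact K \<and> K \<subseteq> U \<and> (\<forall>x. x \<notin> K \<longrightarrow> \<phi> x = 0))"

definition partial_deriv :: "2 \<Rightarrow> (real^2 \<Rightarrow> real) \<Rightarrow> real^2 \<Rightarrow> real" where
  "partial_deriv i \<phi> x = frechet_derivative \<phi> (at x) (axis i 1)"

definition divergence :: "(real^2 \<Rightarrow> real^2) \<Rightarrow> real^2 \<Rightarrow> real" where
  "divergence \<phi> x = (\<Sum>i\<in>UNIV. partial_deriv i (\<lambda>y. \<phi> y $ i) x)"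

text \<open>Finite \<open>\<real>\<^sup>2\<close>-valued Borel measures on the disk are rendered as countably additive set
  functions; only their values on Borel subsets of the disk are meaningful.\<close>

definition vector_measure :: "((real^2) set \<Rightarrow> real^2) \<Rightarrow> bool" where
  "vector_measure \<nu> \<longleftrightarrow>
     (\<forall>A :: nat \<Rightarrow> (real^2) set. range A \<subseteq> sets disk_borel \<longrightarrow> disjoint_family A \<longrightarrow>
        (\<lambda>n. \<nu> (A n)) sums \<nu> (\<Union>n. A n))"

definition variation :: "((real^2) set \<Rightarrow> real^2) \<Rightarrow> (real^2) set \<Rightarrow> ennreal" where
  "variation \<nu> E =
     (SUP A \<in> {A :: nat \<Rightarrow> (real^2) set. range A \<subseteq> sets disk_borel \<and> disjoint_family A \<and>
                 (\<Union>n. A n) = E}.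
        \<Sum>n. ennreal (norm (\<nu> (A n))))"

text \<open>Integration against a finite signed measure \<open>\<mu>\<close>: write \<open>\<mu>\<close> as a difference of finite
  positive measures, for instance by the Jordan decomposition. The value does not depend on the
  decomposition, since \<open>P - N = P' - N'\<close> means \<open>P + N' = P' + N\<close>.\<close>

definition has_signed_integral ::
    "((real^2) set \<Rightarrow> real) \<Rightarrow> (real^2 \<Rightarrow> real) \<Rightarrow> real \<Rightarrow> bool" where
  "has_signed_integral \<mu> g I \<longleftrightarrow>
     (\<exists>P N. finite_measure P \<and> finite_measure N \<and>
        sets P = sets disk_borel \<and> sets N = sets disk_borel \<and>
        (\<forall>E \<in> sets disk_borel. \<mu> E = measure P E - measure N E) \<and>
        integrable P g \<and> integrable N g \<and>
        I = integral\<^sup>L P g - integral\<^sup>L N g)"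

definition signed_integral :: "((real^2) set \<Rightarrow> real) \<Rightarrow> (real^2 \<Rightarrow> real) \<Rightarrow> real" where
  "signed_integral \<mu> g = (THE I. has_signed_integral \<mu> g I)"

definition vector_integral :: "((real^2) set \<Rightarrow> real^2) \<Rightarrow> (real^2 \<Rightarrow> real^2) \<Rightarrow> real" where
  "vector_integral \<nu> \<phi> = (\<Sum>i\<in>UNIV. signed_integral (\<lambda>E. \<nu> E $ i) (\<lambda>x. \<phi> x $ i))"

definition has_distr_gradient :: "(real^2 \<Rightarrow> real) \<Rightarrow> ((real^2) set \<Rightarrow> real^2) \<Rightarrow> bool" where
  "has_distr_gradient w \<nu> \<longleftrightarrow> vector_measure \<nu> \<and>
     (\<forall>\<phi> i. C1c disk \<phi> \<longrightarrow>
        (LINT x|lebesgue_on disk. w x * partial_deriv i \<phi> x)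
          = - signed_integral (\<lambda>E. \<nu> E $ i) \<phi>)"

definition BV :: "(real^2 \<Rightarrow> real) \<Rightarrow> bool" where
  "BV w \<longleftrightarrow> integrable (lebesgue_on disk) w \<and> (\<exists>\<nu>. has_distr_gradient w \<nu>)"

text \<open>The gradient measure is unique on the Borel subsets of the disk, so the choice below does
  not affect \<open>variation\<close> or \<open>vector_integral\<close>.\<close>

definition distr_gradient :: "(real^2 \<Rightarrow> real) \<Rightarrow> (real^2) set \<Rightarrow> real^2" where
  "distr_gradient w = (SOME \<nu>. has_distr_gradient w \<nu>)"

definition total_variation :: "(real^2 \<Rightarrow> real) \<Rightarrow> ennreal" where
  "total_variation w = variation (distr_gradient w) disk"

text \<open>The trace of a BV function, as in Evans and Gariepy: the integrable function on the circle,
  unique up to null sets, for which the Gauss--Green formula holds against all \<open>C\<^sup>1\<close> vector fields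
  on the plane. The outer unit normal of the disk at a point \<open>x\<close> of the circle is \<open>x\<close> itself.\<close>

definition has_trace :: "(real^2 \<Rightarrow> real) \<Rightarrow> (real^2 \<Rightarrow> real) \<Rightarrow> bool" where
  "has_trace w f \<longleftrightarrow> integrable circle_measure f \<and>
     (\<forall>\<phi> :: real^2 \<Rightarrow> real^2. C1 \<phi> \<longrightarrow>
        (LINT x|lebesgue_on disk. w x * divergence \<phi> x)
          = - vector_integral (distr_gradient w) \<phi>
            + (LINT x|circle_measure. (\<phi> x \<bullet> x) * f x))"

end

theory Submission
  imports Defs
begin

text \<open>The datum is the indicator of a closed set \<open>C\<close> of positive length on a short arc, chosen so
  that every subarc of length \<open>d\<close> loses at least \<open>2 d\<^sup>2\<close> of its length to the complement of \<open>C\<close>.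

  Let \<open>g\<close> measure the part of \<open>C\<close> before a given point of the arc. The loss compensates both the
  difference between arc and chord and a further quadratic term, so \<open>g\<close> satisfies
  \<open>g y - g x \<le> \<omega> (norm (y - x))\<close> for the concave modulus \<open>\<omega> r = r / (1 + r)\<close>, and a McShane extension of
  \<open>g\<close> has gradient of length at most 1, uniformly less than 1 on compact subsets of the disk. The
  rotated gradient is divergence free with normal trace 1 on \<open>C\<close>. Testing a competitor \<open>w\<close> against
  smooth approximations of this field gives \<open>length C \<le> |Dw|(disk)\<close>, with equality only if
  \<open>Dw = 0\<close>, which is impossible.

  On the other hand the infimum is at most the length of \<open>C\<close>: as in Gagliardo's construction, \<open>C\<close> is
  written as a series of \<open>C\<^sup>1\<close> functions on the circle, each extended in an arbitrarily thin boundary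
  layer at a cost close to its \<open>L\<^sup>1\<close> norm.\<close>

section \<open>Signed measures as set functions\<close>

text \<open>A datum containing an arc would fail: a jump along the chord is cheaper than one along
  the arc, so the infimum drops below the length of the datum. Removing a length of order
  \<open>d^2\<close> from every subarc outweighs the difference between arc and chord, which is only
  cubic, and leaves a surplus that pays for the concavity of \<open>bend\<close>.

  The trace is defined by testing with \<open>C1\<close> fields, whereas the rotated gradient of a
  McShane extension is in general discontinuous. So the calibration is a sequence of smooth fields.
  Their normal traces on the arc tend to the indicator of \<open>C\<close> only weakly, which is
  enough because the datum is a fixed indicator. The bound on their length inside a smaller disk is
  the same for the whole sequence; hence any mass of \<open>Dw\<close> there costs a fixed amount
  that survives the limit, and strictness is not lost.

  \<open>total_variation\<close> and \<open>has_trace\<close> refer to one arbitrary choice of the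
  gradient measure. The lower bound works with that choice directly; the upper bound relies on
  uniqueness to identify it with an explicit density.\<close>

definition sigma_additive :: "'a measure \<Rightarrow> ('a set \<Rightarrow> real) \<Rightarrow> bool" where
  "sigma_additive M \<mu> \<longleftrightarrow>
     (\<forall>A :: nat \<Rightarrow> 'a set. range A \<subseteq> sets M \<longrightarrow> disjoint_family A \<longrightarrow> (\<lambda>n. \<mu> (A n)) sums \<mu> (\<Union>n. A n))"

lemma sigma_additive_sums:
  assumes "sigma_additive M \<mu>" "\<And>n. A n \<in> sets M" "disjoint_family A"
  shows "(\<lambda>n. \<mu> (A n)) sums \<mu> (\<Union>n. A n)"
  using assms unfolding sigma_additive_def by blast

lemma sigma_additive_empty:
  assumes "sigma_additive M \<mu>"
  shows "\<mu> {} = 0"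
proof -
  have "(\<lambda>n::nat. \<mu> {}) sums \<mu> (\<Union>n::nat. {})"
    by (rule sigma_additive_sums[OF assms]) (auto simp: disjoint_family_on_def)
  then have "summable (\<lambda>n::nat. \<mu> {})" by (rule sums_summable)
  then show ?thesis by (simp add: summable_const_iff)
qed

lemma sigma_additive_Un:
  assumes "sigma_additive M \<mu>" "A \<in> sets M" "B \<in> sets M" "A \<inter> B = {}"
  shows "\<mu> (A \<union> B) = \<mu> A + \<mu> B"
proof -
  let ?F = "\<lambda>n::nat. if n = 0 then A else if n = 1 then B else {}"
  have "(\<lambda>n. \<mu> (?F n)) sums \<mu> (\<Union>n. ?F n)"
    by (rule sigma_additive_sums[OF assms(1)]) (use assms in \<open>auto simp: disjoint_family_on_def\<close>)
  moreover have "(\<Union>n. ?F n) = A \<union> B"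
    by (auto split: if_splits)
  moreover have "(\<lambda>n. \<mu> (?F n)) sums (\<Sum>n\<in>{0,1}. \<mu> (?F n))"
    by (rule sums_finite) (auto simp: sigma_additive_empty[OF assms(1)])
  ultimately show ?thesis
    using sums_unique2 by fastforce
qed

lemma sigma_additive_Diff:
  assumes "sigma_additive M \<mu>" "A \<in> sets M" "B \<in> sets M" "B \<subseteq> A"
  shows "\<mu> (A - B) = \<mu> A - \<mu> B"
proof -
  have "\<mu> ((A - B) \<union> B) = \<mu> (A - B) + \<mu> B"
    by (rule sigma_additive_Un) (use assms in auto)
  moreover have "(A - B) \<union> B = A" using assms by auto
  ultimately show ?thesis by simp
qed

text \<open>Otherwise one could repeatedly split off a piece of measure at least 1 in absolute value from
  a set whose subsets have unbounded measure.\<close>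

lemma sigma_additive_bounded:
  assumes sa: "sigma_additive M \<mu>"
  shows "\<exists>B. \<forall>E\<in>sets M. \<bar>\<mu> E\<bar> \<le> B"
proof (rule ccontr)
  assume nb: "\<not> ?thesis"
  define U where "U E \<longleftrightarrow> E \<in> sets M \<and> (\<forall>B. \<exists>F\<in>sets M. F \<subseteq> E \<and> \<bar>\<mu> F\<bar> > B)" for E
  have U0: "U (space M)"
    unfolding U_def using nb sets.sets_into_space by (metis linorder_not_le sets.top)
  have step: "\<exists>E'. U E' \<and> E' \<subseteq> E \<and> \<bar>\<mu> (E - E')\<bar> \<ge> 1" if UE: "U E" for E
  proof -
    \<comment> \<open>The margin \<open>\<bar>\<mu> E\<bar> + 1\<close> makes both \<open>F\<close>
      and \<open>E - F\<close> have measure at least 1 in absolute value, so either of them can be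
      split off while the one with unbounded subsets is kept.\<close>
    obtain F where F: "F \<in> sets M" "F \<subseteq> E" "\<bar>\<mu> F\<bar> > \<bar>\<mu> E\<bar> + 1"
      using UE unfolding U_def by blast
    have E: "E \<in> sets M" using UE U_def by auto
    have d: "\<mu> (E - F) = \<mu> E - \<mu> F" by (rule sigma_additive_Diff[OF sa E F(1,2)])
    show ?thesis
    proof (cases "U F")
      case True
      have "\<bar>\<mu> (E - F)\<bar> \<ge> 1" using d F(3) by linarith
      then show ?thesis using True F by blast
    next
      case False
      then obtain B where B: "\<And>G. G \<in> sets M \<Longrightarrow> G \<subseteq> F \<Longrightarrow> \<bar>\<mu> G\<bar> \<le> B"
        unfolding U_def using F(1) by (meson linorder_not_less)
      have "U (E - F)"
        unfolding U_def
      proof (intro conjI allI)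
        show "E - F \<in> sets M" using E F by auto
        fix C
        obtain G where G: "G \<in> sets M" "G \<subseteq> E" "\<bar>\<mu> G\<bar> > B + C"
          using UE unfolding U_def by blast
        have "\<mu> G = \<mu> (G \<inter> F \<union> (G - F))" by (simp add: Int_Diff_Un)
        also have "\<dots> = \<mu> (G \<inter> F) + \<mu> (G - F)"
          by (rule sigma_additive_Un[OF sa]) (use G F in auto)
        finally have "\<bar>\<mu> (G - F)\<bar> > C"
          using B[of "G \<inter> F"] G F by auto
        then show "\<exists>H\<in>sets M. H \<subseteq> E - F \<and> \<bar>\<mu> H\<bar> > C"
          using G F by (intro bexI[of _ "G - F"]) auto
      qed
      moreover have "E - (E - F) = F" using F by auto
      ultimately show ?thesis using F(3) by (intro exI[of _ "E - F"]) auto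
    qed
  qed
  have "\<exists>E. \<forall>n::nat. U (E n) \<and> (E (Suc n) \<subseteq> E n \<and> \<bar>\<mu> (E n - E (Suc n))\<bar> \<ge> 1)"
    using dependent_nat_choice[of "\<lambda>_. U" "\<lambda>_ E E'. E' \<subseteq> E \<and> \<bar>\<mu> (E - E')\<bar> \<ge> 1"] U0 step
    by blast
  then obtain E where E: "\<And>n::nat. U (E n)" "\<And>n. E (Suc n) \<subseteq> E n"
      "\<And>n. \<bar>\<mu> (E n - E (Suc n))\<bar> \<ge> 1"
    by blast
  have dec: "decseq E" using E(2) by (rule decseq_SucI)
  have "disjoint_family (\<lambda>n. E n - E (Suc n))"
  proof -
    have "(E m - E (Suc m)) \<inter> (E n - E (Suc n)) = {}" if "m < n" for m n
      using decseqD[OF dec, of "Suc m" n] that by auto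
    then show ?thesis unfolding disjoint_family_on_def
      by (metis Int_commute linorder_neqE_nat)
  qed
  then have "(\<lambda>n. \<mu> (E n - E (Suc n))) sums \<mu> (\<Union>n. E n - E (Suc n))"
    by (intro sigma_additive_sums[OF sa]) (use E(1) U_def in auto)
  then have "(\<lambda>n. \<mu> (E n - E (Suc n))) \<longlonglongrightarrow> 0"
    by (intro summable_LIMSEQ_zero sums_summable)
  then have "\<forall>\<^sub>F n in sequentially. \<bar>\<mu> (E n - E (Suc n))\<bar> < 1"
    by (auto dest: tendstoD[of _ 0 sequentially 1] simp: dist_real_def)
  then show False using E(3) by (auto simp: eventually_sequentially linorder_not_le[symmetric])
qed

lemma finite_measure_of_sigma_additive:
  assumes sa: "sigma_additive M p" and nn: "\<And>E. E \<in> sets M \<Longrightarrow> p E \<ge> 0"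
  shows "\<exists>Q. finite_measure Q \<and> sets Q = sets M \<and> (\<forall>E\<in>sets M. measure Q E = p E)"
proof -
  define Q where "Q = measure_of (space M) (sets M) (\<lambda>E. ennreal (p E))"
  have em: "emeasure Q E = ennreal (p E)" if "E \<in> sets M" for E
    unfolding Q_def
  proof (rule emeasure_measure_of_sigma[OF sets.sigma_algebra_axioms _ _ that])
    show "positive (sets M) (\<lambda>E. ennreal (p E))"
      by (simp add: positive_def sigma_additive_empty[OF sa])
    show "countably_additive (sets M) (\<lambda>E. ennreal (p E))"
    proof (rule countably_additiveI)
      fix A :: "nat \<Rightarrow> 'a set"
      assume A: "range A \<subseteq> sets M" "disjoint_family A"
      have s: "(\<lambda>n. p (A n)) sums p (\<Union>n. A n)"
        using sigma_additive_sums[OF sa] A by blast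
      have "(\<Sum>i. ennreal (p (A i))) = ennreal (\<Sum>i. p (A i))"
        by (rule suminf_ennreal2) (use nn A s in \<open>auto simp: sums_iff\<close>)
      then show "(\<Sum>i. ennreal (p (A i))) = ennreal (p (\<Union> (range A)))"
        using s by (simp add: sums_iff)
    qed
  qed
  have sQ: "sets Q = sets M" and spQ: "space Q = space M" by (auto simp: Q_def)
  have "finite_measure Q"
    by (rule finite_measureI) (simp add: spQ em)
  moreover have "\<forall>E\<in>sets M. measure Q E = p E"
    by (auto simp: measure_def em nn)
  ultimately show ?thesis using sQ by blast
qed

text \<open>The positive part \<open>p\<close> is the supremum of \<open>\<mu>\<close> over subsets,
  finite by \<open>sigma_additive_bounded\<close>; no Hahn set is constructed. Superadditivity of
  \<open>p\<close> gives one inequality of countable additivity, and cutting a subset along the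
  pieces gives the other. The negative part is \<open>p - \<mu>\<close>.\<close>

lemma jordan_decomposition:
  assumes sa: "sigma_additive M \<mu>"
  obtains P N where "finite_measure P" "finite_measure N" "sets P = sets M" "sets N = sets M"
    "\<And>E. E \<in> sets M \<Longrightarrow> \<mu> E = measure P E - measure N E"
proof -
  obtain B where B: "\<And>E. E \<in> sets M \<Longrightarrow> \<bar>\<mu> E\<bar> \<le> B"
    using sigma_additive_bounded[OF sa] by blast
  define p where "p E = (SUP F\<in>{F\<in>sets M. F \<subseteq> E}. \<mu> F)" for E
  have ne: "{F\<in>sets M. F \<subseteq> E} \<noteq> {}" for E by auto
  have bdd: "bdd_above (\<mu> ` {F\<in>sets M. F \<subseteq> E})" for E
    by (rule bdd_aboveI[of _ B]) (use B in \<open>force simp: abs_le_iff\<close>)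
  have up: "\<mu> F \<le> p E" if "F \<in> sets M" "F \<subseteq> E" for E F
    unfolding p_def by (rule cSUP_upper[OF _ bdd]) (use that in auto)
  have least: "p E \<le> c" if "\<And>F. F \<in> sets M \<Longrightarrow> F \<subseteq> E \<Longrightarrow> \<mu> F \<le> c" for E c
    unfolding p_def by (rule cSUP_least[OF ne]) (use that in auto)
  have p0: "p E \<ge> 0" for E
    using up[of "{}" E] sigma_additive_empty[OF sa] by auto
  have mono: "p E \<le> p E'" if "E \<subseteq> E'" for E E'
    by (rule least) (use up that in blast)
  have super: "p A + p A' \<le> p (A \<union> A')" if "A \<inter> A' = {}" for A A'
  proof -
    have "p A \<le> p (A \<union> A') - p A'"
    proof (rule least)
      fix F assume F: "F \<in> sets M" "F \<subseteq> A"
      have "p A' \<le> p (A \<union> A') - \<mu> F"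
      proof (rule least)
        fix G assume G: "G \<in> sets M" "G \<subseteq> A'"
        have "\<mu> F + \<mu> G = \<mu> (F \<union> G)"
          by (rule sigma_additive_Un[OF sa, symmetric]) (use F G that in auto)
        also have "\<dots> \<le> p (A \<union> A')" by (rule up) (use F G in auto)
        finally show "\<mu> G \<le> p (A \<union> A') - \<mu> F" by simp
      qed
      then show "\<mu> F \<le> p (A \<union> A') - p A'" by simp
    qed
    then show ?thesis by simp
  qed
  have pa: "sigma_additive M p"
    unfolding sigma_additive_def
  proof (intro allI impI)
    fix A :: "nat \<Rightarrow> 'a set"
    assume A: "range A \<subseteq> sets M" "disjoint_family A"
    have "(\<Sum>i<n. p (A i)) \<le> p (\<Union>i<n. A i)" for n
    proof (induction n)
      case 0
      then show ?case using p0 by simp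
    next
      case (Suc n)
      have "(\<Union>i<n. A i) \<inter> A n = {}"
        using disjoint_family_onD[OF A(2), of _ n] by (force simp: disjoint_iff)
      then have "p (\<Union>i<n. A i) + p (A n) \<le> p ((\<Union>i<n. A i) \<union> A n)"
        by (rule super)
      moreover have "(\<Union>i<n. A i) \<union> A n = (\<Union>i<Suc n. A i)"
        by (simp add: lessThan_Suc Un_commute)
      ultimately show ?case using Suc by simp
    qed
    then have part: "(\<Sum>i<n. p (A i)) \<le> p (\<Union>i. A i)" for n
      by (rule order_trans[OF _ mono]) auto
    have summ: "summable (\<lambda>i. p (A i))"
      by (rule summableI_nonneg_bounded[OF p0 part])
    have "(\<Sum>i. p (A i)) = p (\<Union>i. A i)"
    proof (rule antisym)
      show "(\<Sum>i. p (A i)) \<le> p (\<Union>i. A i)"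
        by (rule suminf_le_const[OF summ part])
      show "p (\<Union>i. A i) \<le> (\<Sum>i. p (A i))"
      proof (rule least)
        fix F assume F: "F \<in> sets M" "F \<subseteq> (\<Union>i. A i)"
        have "(\<lambda>i. \<mu> (F \<inter> A i)) sums \<mu> (\<Union>i. F \<inter> A i)"
          by (rule sigma_additive_sums[OF sa])
            (use F A disjoint_family_on_bisimulation[OF A(2), of "\<lambda>n. F \<inter> A n"] in \<open>blast+\<close>)
        moreover have "(\<Union>i. F \<inter> A i) = F" using F by auto
        ultimately have s: "(\<lambda>i. \<mu> (F \<inter> A i)) sums \<mu> F" by simp
        show "\<mu> F \<le> (\<Sum>i. p (A i))"
          by (rule sums_le[OF _ s summable_sums[OF summ]]) (use F A in \<open>auto intro!: up\<close>)
      qed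
    qed
    then show "(\<lambda>n. p (A n)) sums p (\<Union>n. A n)"
      using summ by (simp add: sums_iff)
  qed
  have na: "sigma_additive M (\<lambda>E. p E - \<mu> E)"
    unfolding sigma_additive_def
    by (intro allI impI sums_diff sigma_additive_sums[OF pa] sigma_additive_sums[OF sa]) auto
  obtain P where P: "finite_measure P" "sets P = sets M" "\<forall>E\<in>sets M. measure P E = p E"
    using finite_measure_of_sigma_additive[OF pa] p0 by auto
  obtain N where N: "finite_measure N" "sets N = sets M" "\<forall>E\<in>sets M. measure N E = p E - \<mu> E"
    using finite_measure_of_sigma_additive[OF na] up by auto
  show ?thesis
    by (rule that[OF P(1) N(1) P(2) N(2)]) (use P N in auto)
qed

text \<open>This is how \<open>P - N = P' - N'\<close> survives integration: written as an equality
  of sums, it stays meaningful in \<open>ennreal\<close>. Both sides are additive in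
  \<open>g\<close> and continuous along increasing sequences, so induction over measurable functions
  reduces the claim to indicators.\<close>

lemma nn_integral_add_eq_add:
  assumes s: "sets B = sets A" "sets C = sets A" "sets D = sets A"
    and eq: "\<And>E. E \<in> sets A \<Longrightarrow> emeasure A E + emeasure B E = emeasure C E + emeasure D E"
    and g: "g \<in> borel_measurable A"
  shows "(\<integral>\<^sup>+x. g x \<partial>A) + (\<integral>\<^sup>+x. g x \<partial>B) = (\<integral>\<^sup>+x. g x \<partial>C) + (\<integral>\<^sup>+x. g x \<partial>D)"
  using g
proof (induction rule: borel_measurable_induct)
  have sp: "space B = space A" "space C = space A" "space D = space A"
    by (simp_all add: sets_eq_imp_space_eq[OF s(1)] sets_eq_imp_space_eq[OF s(2)] sets_eq_imp_space_eq[OF s(3)])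
  note m = measurable_cong_sets[OF s(1) refl] measurable_cong_sets[OF s(2) refl]
    measurable_cong_sets[OF s(3) refl]
  {
    case (cong f g)
    have "integral\<^sup>N A f = integral\<^sup>N A g" "integral\<^sup>N B f = integral\<^sup>N B g"
      "integral\<^sup>N C f = integral\<^sup>N C g" "integral\<^sup>N D f = integral\<^sup>N D g"
      by (auto intro!: nn_integral_cong simp: sp cong)
    then show ?case using cong by simp
  next
    case (set E)
    then show ?case using eq by (simp add: s)
  next
    case (mult u c)
    then show ?case by (simp add: nn_integral_cmult m distrib_left[symmetric])
  next
    case (add u v)
    then show ?case by (simp add: nn_integral_add m add.assoc add.left_commute)
  next
    case (seq U)
    have inc: "incseq (\<lambda>i. integral\<^sup>N X (U i))" for X
      using \<open>incseq U\<close> by (auto simp: incseq_def le_fun_def intro!: nn_integral_mono)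
    have sup: "integral\<^sup>N X (Sup (range U)) = (SUP i. integral\<^sup>N X (U i))"
      if "sets X = sets A" for X
    proof -
      have "integral\<^sup>N X (\<lambda>x. SUP i. U i x) = (SUP i. integral\<^sup>N X (U i))"
        by (rule nn_integral_monotone_convergence_SUP[OF \<open>incseq U\<close>])
          (use seq(1) measurable_cong_sets[OF that refl] in auto)
      then show ?thesis by (simp add: image_comp SUP_apply[abs_def] comp_def)
    qed
    show ?case
      unfolding sup[OF refl] sup[OF s(1)] sup[OF s(2)] sup[OF s(3)]
      using seq by (simp add: ennreal_SUP_add[OF inc inc, symmetric])
  }
qed

lemma integral_add_eq_add:
  fixes g :: "'a \<Rightarrow> real"
  assumes s: "sets B = sets A" "sets C = sets A" "sets D = sets A"
    and eq: "\<And>E. E \<in> sets A \<Longrightarrow> emeasure A E + emeasure B E = emeasure C E + emeasure D E"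
    and i: "integrable A g" "integrable B g" "integrable C g" "integrable D g"
  shows "integral\<^sup>L A g + integral\<^sup>L B g = integral\<^sup>L C g + integral\<^sup>L D g"
proof -
  have *: "enn2real (\<integral>\<^sup>+x. f x \<partial>A) + enn2real (\<integral>\<^sup>+x. f x \<partial>B)
      = enn2real (\<integral>\<^sup>+x. f x \<partial>C) + enn2real (\<integral>\<^sup>+x. f x \<partial>D)"
    if f: "f = (\<lambda>x. ennreal (g x)) \<or> f = (\<lambda>x. ennreal (- g x))" for f
  proof -
    have fin: "(\<integral>\<^sup>+x. f x \<partial>A) < \<infinity>" "(\<integral>\<^sup>+x. f x \<partial>B) < \<infinity>"
      "(\<integral>\<^sup>+x. f x \<partial>C) < \<infinity>" "(\<integral>\<^sup>+x. f x \<partial>D) < \<infinity>"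
      using i f by (auto simp: real_integrable_def top.not_eq_extremum)
    have m: "f \<in> borel_measurable A" using i(1) f by auto
    have "(\<integral>\<^sup>+x. f x \<partial>A) + (\<integral>\<^sup>+x. f x \<partial>B) = (\<integral>\<^sup>+x. f x \<partial>C) + (\<integral>\<^sup>+x. f x \<partial>D)"
      by (rule nn_integral_add_eq_add[OF s eq m])
    then show ?thesis using fin by (metis enn2real_plus infinity_ennreal_def)
  qed
  show ?thesis
    using *[OF disjI1[OF refl]] *[OF disjI2[OF refl]]
    by (simp add: real_lebesgue_integral_def[OF i(1)] real_lebesgue_integral_def[OF i(2)]
        real_lebesgue_integral_def[OF i(3)] real_lebesgue_integral_def[OF i(4)])
qed

lemma has_signed_integral_unique:
  assumes "has_signed_integral \<mu> g I" "has_signed_integral \<mu> g J"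
  shows "I = J"
proof -
  obtain P N where PN: "finite_measure P" "finite_measure N"
      "sets P = sets disk_borel" "sets N = sets disk_borel"
      "\<And>E. E \<in> sets disk_borel \<Longrightarrow> \<mu> E = measure P E - measure N E"
      "integrable P g" "integrable N g" "I = integral\<^sup>L P g - integral\<^sup>L N g"
    using assms(1) unfolding has_signed_integral_def by blast
  obtain P' N' where PN': "finite_measure P'" "finite_measure N'"
      "sets P' = sets disk_borel" "sets N' = sets disk_borel"
      "\<And>E. E \<in> sets disk_borel \<Longrightarrow> \<mu> E = measure P' E - measure N' E"
      "integrable P' g" "integrable N' g" "J = integral\<^sup>L P' g - integral\<^sup>L N' g"
    using assms(2) unfolding has_signed_integral_def by blast
  have "integral\<^sup>L P g + integral\<^sup>L N' g = integral\<^sup>L P' g + integral\<^sup>L N g"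
  proof (rule integral_add_eq_add)
    fix E assume "E \<in> sets P"
    then have "measure P E + measure N' E = measure P' E + measure N E"
      using PN(5)[of E] PN'(5)[of E] PN(3) by auto
    then show "emeasure P E + emeasure N' E = emeasure P' E + emeasure N E"
      using PN PN' by (simp add: finite_measure.emeasure_eq_measure ennreal_plus[symmetric]
          del: ennreal_plus)
  qed (use PN PN' in auto)
  then show ?thesis using PN PN' by simp
qed

lemma signed_integral_eq:
  assumes "has_signed_integral \<mu> g I"
  shows "signed_integral \<mu> g = I"
  unfolding signed_integral_def
  by (rule the_equality) (use assms has_signed_integral_unique in auto)

lemma signed_integral_cong:
  assumes "\<And>E. E \<in> sets disk_borel \<Longrightarrow> \<mu> E = \<mu>' E"
  shows "signed_integral \<mu> g = signed_integral \<mu>' g"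
proof -
  have "has_signed_integral \<mu> g = has_signed_integral \<mu>' g"
    by (intro ext) (auto simp: has_signed_integral_def assms)
  then show ?thesis by (simp add: signed_integral_def)
qed

lemma vector_measure_component:
  assumes "vector_measure \<nu>"
  shows "sigma_additive disk_borel (\<lambda>E. \<nu> E $ i)"
  using assms unfolding vector_measure_def sigma_additive_def
  unfolding vector_measure_def sigma_additive_def
  using bounded_linear.sums[OF bounded_linear_vec_nth] by blast

lemma variation_cong:
  assumes "\<And>E. E \<in> sets disk_borel \<Longrightarrow> \<nu> E = \<nu>' E"
  shows "variation \<nu> D = variation \<nu>' D"
  unfolding variation_def
  by (intro SUP_cong refl suminf_cong arg_cong[where f = "\<lambda>v. ennreal (norm v)"]) (use assms in auto)

section \<open>Riemann sums and the dual description of the variation\<close>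

lemma integrable_bounded_finite_measure:
  fixes g :: "'a \<Rightarrow> real"
  assumes "finite_measure P" "g \<in> borel_measurable P" "\<And>x. x \<in> space P \<Longrightarrow> \<bar>g x\<bar> \<le> B"
  shows "integrable P g"
  by (rule finite_measure.integrable_const_bound[OF assms(1) _ assms(2), of B])
    (use assms in auto)

text \<open>A finite partition is encoded by a labelling \<open>Z\<close> of the points, with value
  \<open>c n\<close> on the cell labelled \<open>n\<close>. Natural number labels turn the cells
  into a sequence of sets, the shape that \<open>variation\<close> asks for.\<close>

lemma integral_step_function:
  fixes g :: "'a \<Rightarrow> real" and c :: "nat \<Rightarrow> real" and Z :: "'a \<Rightarrow> nat"
  assumes P: "finite_measure P" and g: "g \<in> borel_measurable P"
    and fin: "finite (Z ` space P)" and Z: "\<And>n. {x\<in>space P. Z x = n} \<in> sets P"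
    and close: "\<And>x. x \<in> space P \<Longrightarrow> \<bar>g x - c (Z x)\<bar> \<le> \<eta>"
  shows "\<bar>integral\<^sup>L P g - (\<Sum>n\<in>Z ` space P. c n * measure P {x\<in>space P. Z x = n})\<bar>
    \<le> \<eta> * measure P (space P)"
proof -
  interpret finite_measure P by fact
  let ?s = "\<lambda>x. \<Sum>n\<in>Z ` space P. c n * indicator {x\<in>space P. Z x = n} x"
  have s: "?s x = c (Z x)" if "x \<in> space P" for x
  proof -
    have "?s x = (\<Sum>n\<in>Z ` space P. if n = Z x then c n else 0)"
      by (rule sum.cong) (use that in \<open>auto simp: indicator_def\<close>)
    also have "\<dots> = c (Z x)" using that fin by simp
    finally show ?thesis .
  qed
  have int_s: "integrable P ?s"
    by (intro Bochner_Integration.integrable_sum integrable_mult_right integrable_real_indicator Z)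
      (simp add: less_top[symmetric])
  have "(\<integral>x. ?s x \<partial>P) = (\<Sum>n\<in>Z ` space P. c n * measure P {x\<in>space P. Z x = n})"
    by (subst Bochner_Integration.integral_sum)
      (auto intro!: integrable_mult_right integrable_real_indicator Z sum.cong arg_cong[where f="measure P"] simp: less_top[symmetric])
  moreover have ig: "integrable P g"
  proof -
    have "integrable P (\<lambda>x. g x - ?s x)"
      by (rule integrable_bounded_finite_measure[OF P, of _ \<eta>])
        (use g int_s close s in auto)
    then have "integrable P (\<lambda>x. (g x - ?s x) + ?s x)"
      by (intro Bochner_Integration.integrable_add int_s)
    then show ?thesis by simp
  qed
  moreover have "\<bar>\<integral>x. g x - ?s x \<partial>P\<bar> \<le> (\<integral>x. \<bar>g x - ?s x\<bar> \<partial>P)"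
    by (rule integral_abs_bound)
  moreover have "(\<integral>x. \<bar>g x - ?s x\<bar> \<partial>P) \<le> (\<integral>x. \<eta> \<partial>P)"
    by (rule integral_mono) (use ig int_s close s in auto)
  ultimately show ?thesis using int_s by (simp add: mult.commute)
qed

lemma space_eq_disk: "sets P = sets disk_borel \<Longrightarrow> space P = disk"
  by (drule sets_eq_imp_space_eq) (simp add: space_restrict_space)

lemma continuous_on_disk_borel:
  fixes g :: "real^2 \<Rightarrow> real"
  assumes "sets P = sets disk_borel" "continuous_on UNIV g"
  shows "g \<in> borel_measurable P"
  unfolding measurable_cong_sets[OF assms(1) refl]
  by (rule measurable_restrict_space1) (use assms in \<open>simp add: borel_measurable_continuous_onI\<close>)

lemma bounded_on_disk:
  fixes g :: "real^2 \<Rightarrow> real"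
  assumes "continuous_on UNIV g"
  obtains B where "\<And>x. x \<in> disk \<Longrightarrow> \<bar>g x\<bar> \<le> B"
proof -
  have "compact (g ` cball 0 1)"
    by (intro compact_continuous_image compact_cball continuous_on_subset[OF assms]) auto
  then obtain B where "\<forall>y\<in>g ` cball 0 1. norm y \<le> B"
    using compact_imp_bounded bounded_iff by metis
  then show ?thesis by (intro that[of B]) auto
qed

lemma has_signed_integral_continuous:
  assumes P: "finite_measure P" "finite_measure N" "sets P = sets disk_borel" "sets N = sets disk_borel"
    "\<And>E. E \<in> sets disk_borel \<Longrightarrow> \<mu> E = measure P E - measure N E"
    and g: "continuous_on UNIV g"
  shows "has_signed_integral \<mu> g (integral\<^sup>L P g - integral\<^sup>L N g)"
proof -
  obtain B where B: "\<And>x. x \<in> disk \<Longrightarrow> \<bar>g x\<bar> \<le> B" using bounded_on_disk[OF g] by blast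
  have "integrable P g" "integrable N g"
    by (auto intro!: integrable_bounded_finite_measure[of _ _ B] P B continuous_on_disk_borel g
        simp: space_eq_disk[OF P(3)] space_eq_disk[OF P(4)])
  then show ?thesis
    unfolding has_signed_integral_def using P by blast
qed

text \<open>\<open>M\<close> stands for the total mass of \<open>\<mu>\<close>. What matters is the
  order of quantifiers: \<open>M\<close> does not depend on the partition, so the error vanishes
  with \<open>\<eta>\<close>.\<close>

definition step_error_bound :: "((real^2) set \<Rightarrow> real) \<Rightarrow> real \<Rightarrow> bool" where
  "step_error_bound \<mu> M \<longleftrightarrow> (\<forall>g c (Z :: real^2 \<Rightarrow> nat) \<eta>. continuous_on UNIV g \<longrightarrow> finite (Z ` disk) \<longrightarrow>
    (\<forall>n. {x\<in>disk. Z x = n} \<in> sets disk_borel) \<longrightarrow> (\<forall>x\<in>disk. \<bar>g x - c (Z x)\<bar> \<le> \<eta>) \<longrightarrow>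
    \<bar>signed_integral \<mu> g - (\<Sum>n\<in>Z ` disk. c n * \<mu> {x\<in>disk. Z x = n})\<bar> \<le> \<eta> * M)"

lemma step_error_bound_exists:
  assumes sa: "sigma_additive disk_borel \<mu>"
  shows "\<exists>M. step_error_bound \<mu> M"
proof -
  obtain P N where P: "finite_measure P" "finite_measure N" "sets P = sets disk_borel" "sets N = sets disk_borel"
    "\<And>E. E \<in> sets disk_borel \<Longrightarrow> \<mu> E = measure P E - measure N E"
    using jordan_decomposition[OF sa] by blast
  note sp = space_eq_disk[OF P(3)] space_eq_disk[OF P(4)]
  show ?thesis
    unfolding step_error_bound_def
  proof (intro exI[of _ "measure P disk + measure N disk"] allI impI)
    fix g :: "real^2 \<Rightarrow> real" and c :: "nat \<Rightarrow> real" and Z :: "real^2 \<Rightarrow> nat" and \<eta> :: real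
    assume g: "continuous_on UNIV g" and fin: "finite (Z ` disk)"
      and "\<forall>n. {x\<in>disk. Z x = n} \<in> sets disk_borel" "\<forall>x\<in>disk. \<bar>g x - c (Z x)\<bar> \<le> \<eta>"
    then have Z: "\<And>n. {x\<in>disk. Z x = n} \<in> sets disk_borel"
      and close: "\<And>x. x \<in> disk \<Longrightarrow> \<bar>g x - c (Z x)\<bar> \<le> \<eta>" by blast+
    have 1: "\<bar>integral\<^sup>L P g - (\<Sum>n\<in>Z ` disk. c n * measure P {x\<in>disk. Z x = n})\<bar> \<le> \<eta> * measure P disk"
      using integral_step_function[OF P(1) continuous_on_disk_borel[OF P(3) g], of Z c \<eta>] fin Z close
      by (simp add: sp P(3))
    have 2: "\<bar>integral\<^sup>L N g - (\<Sum>n\<in>Z ` disk. c n * measure N {x\<in>disk. Z x = n})\<bar> \<le> \<eta> * measure N disk"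
      using integral_step_function[OF P(2) continuous_on_disk_borel[OF P(4) g], of Z c \<eta>] fin Z close
      by (simp add: sp P(4))
    have "(\<Sum>n\<in>Z ` disk. c n * \<mu> {x\<in>disk. Z x = n})
        = (\<Sum>n\<in>Z ` disk. c n * measure P {x\<in>disk. Z x = n}) - (\<Sum>n\<in>Z ` disk. c n * measure N {x\<in>disk. Z x = n})"
      by (simp add: P(5)[OF Z] right_diff_distrib sum_subtractf del: mem_ball mem_ball_0)
    moreover have "signed_integral \<mu> g = integral\<^sup>L P g - integral\<^sup>L N g"
      by (intro signed_integral_eq has_signed_integral_continuous P g)
    ultimately show "\<bar>signed_integral \<mu> g - (\<Sum>n\<in>Z ` disk. c n * \<mu> {x\<in>disk. Z x = n})\<bar>
        \<le> \<eta> * (measure P disk + measure N disk)"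
      using 1 2 unfolding distrib_left by linarith
  qed
qed

lemma vector_measure_norm_sum_le_variation:
  assumes "vector_measure \<nu>" and fin: "finite (Z ` disk)"
    and Z: "\<And>n::nat. {x\<in>disk. Z x = n} \<in> sets disk_borel"
  shows "ennreal (\<Sum>n\<in>Z ` disk. norm (\<nu> {x\<in>disk. Z x = n})) \<le> variation \<nu> disk"
proof -
  let ?A = "\<lambda>n. {x\<in>disk. Z x = n}"
  have e: "\<nu> {} = 0"
    using sigma_additive_empty[OF vector_measure_component[OF assms(1)]] by (auto simp: vec_eq_iff)
  have "(\<Sum>n. ennreal (norm (\<nu> (?A n)))) = (\<Sum>n\<in>Z ` disk. ennreal (norm (\<nu> (?A n))))"
  proof (rule suminf_finite[OF fin])
    fix n assume "n \<notin> Z ` disk"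
    then have "?A n = {}" by auto
    then show "ennreal (norm (\<nu> (?A n))) = 0" by (simp only: e norm_zero ennreal_0)
  qed
  also have "\<dots> = ennreal (\<Sum>n\<in>Z ` disk. norm (\<nu> (?A n)))" by (simp add: sum_ennreal)
  finally have "ennreal (\<Sum>n\<in>Z ` disk. norm (\<nu> (?A n))) = (\<Sum>n. ennreal (norm (\<nu> (?A n))))" ..
  also have "\<dots> \<le> variation \<nu> disk"
    unfolding variation_def
    by (rule SUP_upper) (use Z in \<open>auto simp: disjoint_family_on_def\<close>)
  finally show ?thesis .
qed

text \<open>A field that is shorter than \<open>1 - \<delta>\<close> on a set charged by \<open>\<nu>\<close> cannot attain the supremum
  in the dual description of the variation.\<close>

lemma vector_integral_le_variation:
  fixes \<phi> :: "real^2 \<Rightarrow> real^2"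
  assumes vm: "vector_measure \<nu>" and cont: "continuous_on UNIV \<phi>"
    and E: "E \<in> sets disk_borel" and \<delta>: "0 \<le> \<delta>"
    and le1: "\<And>x. x \<in> disk \<Longrightarrow> norm (\<phi> x) \<le> 1"
    and leE: "\<And>x. x \<in> E \<Longrightarrow> norm (\<phi> x) \<le> 1 - \<delta>"
  shows "ennreal (vector_integral \<nu> \<phi> + \<delta> * norm (\<nu> E)) \<le> variation \<nu> disk"
proof -
  have ED: "E \<subseteq> disk" using sets.sets_into_space[OF E] by (simp add: space_restrict_space)
  have e: "\<nu> {} = 0"
    using sigma_additive_empty[OF vector_measure_component[OF vm]] by (auto simp: vec_eq_iff)
  have contc: "continuous_on UNIV (\<lambda>x. \<phi> x $ i)" for i
    by (intro continuous_intros cont)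
  have "\<exists>M. \<forall>i. step_error_bound (\<lambda>E. \<nu> E $ i) (M i)"
    by (intro choice allI step_error_bound_exists vector_measure_component vm)
  then obtain M where M: "\<And>i. step_error_bound (\<lambda>E. \<nu> E $ i) (M i)" by blast
  have key: "ennreal (vector_integral \<nu> \<phi> + \<delta> * norm (\<nu> E) - \<eta> * (\<Sum>i\<in>UNIV. M i)) \<le> variation \<nu> disk"
    if \<eta>: "\<eta> > 0" for \<eta>
  proof -
    \<comment> \<open>Cells record both components of \<open>\<phi>\<close> rounded down to
      multiples of \<open>\<eta>\<close>, together with membership in \<open>E\<close>. Thus each
      component oscillates by at most \<open>\<eta>\<close> on a cell, and every cell is contained
      in \<open>E\<close> or disjoint from it.\<close>
    define Z where "Z x = to_nat (\<lfloor>\<phi> x $ 1 / \<eta>\<rfloor>, \<lfloor>\<phi> x $ 2 / \<eta>\<rfloor>, x \<in> E)" for x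
    let ?A = "\<lambda>n. {x\<in>disk. Z x = n}"
    let ?R = "Z ` disk"
    have fin: "finite ?R"
    proof -
      have fl: "\<lfloor>t / \<eta>\<rfloor> \<in> {\<lfloor>- (1 / \<eta>)\<rfloor>..\<lfloor>1 / \<eta>\<rfloor>}" if "\<bar>t\<bar> \<le> 1" for t :: real
        using that \<eta> by (auto intro!: floor_mono simp: field_simps)
      have "\<bar>\<phi> x $ i\<bar> \<le> 1" if "x \<in> disk" for x i
        using component_le_norm_cart[of "\<phi> x" i] le1[OF that] by linarith
      then have "?R \<subseteq> to_nat ` ({\<lfloor>- (1 / \<eta>)\<rfloor>..\<lfloor>1 / \<eta>\<rfloor>} \<times> {\<lfloor>- (1 / \<eta>)\<rfloor>..\<lfloor>1 / \<eta>\<rfloor>} \<times> (UNIV :: bool set))"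
        unfolding Z_def using fl by (intro image_subsetI imageI SigmaI) auto
      then show ?thesis by (rule finite_subset) auto
    qed
    have meas: "?A n \<in> sets disk_borel" for n
    proof -
      have [measurable]: "(\<lambda>x. \<phi> x $ i) \<in> borel_measurable disk_borel" for i
        by (rule continuous_on_disk_borel[OF refl contc])
      have [measurable]: "(\<lambda>x. x \<in> E) \<in> measurable disk_borel (count_space UNIV)"
        using E by (simp add: pred_sets2)
      have "Z \<in> measurable disk_borel (count_space UNIV)"
        unfolding Z_def by measurable
      then have "Z -` {n} \<inter> space disk_borel \<in> sets disk_borel" by (rule measurable_sets) simp
      also have "Z -` {n} \<inter> space disk_borel = ?A n" by (auto simp: space_restrict_space)
      finally show ?thesis .
    qed
    \<comment> \<open>A value actually attained on the cell, so that \<open>c n\<close> inherits the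
      norm bounds of \<open>\<phi>\<close>, including the better one on cells inside
      \<open>E\<close>.\<close>
    define c where "c n = \<phi> (SOME x. x \<in> disk \<and> Z x = n)" for n
    have pick: "\<exists>y. y \<in> disk \<and> Z y = Z x \<and> c (Z x) = \<phi> y" if "x \<in> disk" for x
      using someI[of "\<lambda>y. y \<in> disk \<and> Z y = Z x" x] that unfolding c_def by blast
    have close: "\<bar>\<phi> x $ i - c (Z x) $ i\<bar> \<le> \<eta>" if x: "x \<in> disk" for x i
    proof -
      obtain y where y: "Z y = Z x" "c (Z x) = \<phi> y" using pick[OF x] by blast
      have "\<lfloor>\<phi> x $ i / \<eta>\<rfloor> = \<lfloor>\<phi> y $ i / \<eta>\<rfloor>"
        using y(1) exhaust_2[of i] unfolding Z_def by auto
      then have "\<bar>\<phi> x $ i / \<eta> - \<phi> y $ i / \<eta>\<bar> < 1" by linarith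
      then have "\<bar>(\<phi> x $ i - \<phi> y $ i) / \<eta>\<bar> < 1" by (simp add: diff_divide_distrib)
      then show ?thesis using \<eta> y by (simp add: field_simps)
    qed
    have c1: "norm (c n) \<le> 1 - (if ?A n \<subseteq> E then \<delta> else 0)" if n: "n \<in> ?R" for n
    proof -
      obtain x where x: "x \<in> disk" "n = Z x" using n by blast
      obtain y where y: "y \<in> disk" "Z y = Z x" "c (Z x) = \<phi> y" using pick[OF x(1)] by blast
      then show ?thesis using le1[OF y(1)] leE[of y] x by auto
    qed
    have Ecov: "norm (\<nu> E) \<le> (\<Sum>n\<in>?R. if ?A n \<subseteq> E then norm (\<nu> (?A n)) else 0)"
    proof -
      have "(\<lambda>n. \<nu> (E \<inter> ?A n)) sums \<nu> (\<Union>n. E \<inter> ?A n)"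
        using vm unfolding vector_measure_def
        by (rule allE[of _ "\<lambda>n. E \<inter> ?A n"]) (use E meas in \<open>auto simp: disjoint_family_on_def\<close>)
      moreover have "(\<Union>n. E \<inter> ?A n) = E" using ED by auto
      moreover have "(\<lambda>n. \<nu> (E \<inter> ?A n)) sums (\<Sum>n\<in>?R. \<nu> (E \<inter> ?A n))"
      proof (rule sums_finite[OF fin])
        fix n assume "n \<notin> ?R"
        then have "E \<inter> ?A n = {}" by auto
        then show "\<nu> (E \<inter> ?A n) = 0" by (simp only: e)
      qed
      ultimately have "\<nu> E = (\<Sum>n\<in>?R. \<nu> (E \<inter> ?A n))" by (auto simp only: intro: sums_unique2)
      moreover have "norm (\<nu> (E \<inter> ?A n)) \<le> (if ?A n \<subseteq> E then norm (\<nu> (?A n)) else 0)" for n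
      proof (cases "?A n \<subseteq> E")
        case True
        then have "E \<inter> ?A n = ?A n" by blast
        then show ?thesis by (simp only: True if_True)
      next
        case False
        then have "E \<inter> ?A n = {}" unfolding Z_def by auto
        then have "\<nu> (E \<inter> ?A n) = 0" by (simp only: e)
        then show ?thesis by simp
      qed
      ultimately show ?thesis by (simp only:) (rule sum_norm_le)
    qed
    have "vector_integral \<nu> \<phi> - \<eta> * (\<Sum>i\<in>UNIV. M i)
        = (\<Sum>i\<in>UNIV. signed_integral (\<lambda>E. \<nu> E $ i) (\<lambda>x. \<phi> x $ i) - \<eta> * M i)"
      by (simp add: vector_integral_def sum_subtractf sum_distrib_left)
    also have "\<dots> \<le> (\<Sum>i\<in>UNIV. \<Sum>n\<in>?R. c n $ i * \<nu> (?A n) $ i)"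
    proof (rule sum_mono)
      fix i
      show "signed_integral (\<lambda>E. \<nu> E $ i) (\<lambda>x. \<phi> x $ i) - \<eta> * M i \<le> (\<Sum>n\<in>?R. c n $ i * \<nu> (?A n) $ i)"
        using M[of i, unfolded step_error_bound_def, THEN spec, THEN spec[of _ "\<lambda>n. c n $ i"], THEN spec[of _ Z],
            THEN spec[of _ \<eta>], rule_format, OF contc[of i] fin meas close] by linarith
    qed
    also have "\<dots> = (\<Sum>n\<in>?R. c n \<bullet> \<nu> (?A n))"
      by (subst sum.swap) (simp add: inner_vec_def)
    also have "\<dots> \<le> (\<Sum>n\<in>?R. norm (\<nu> (?A n)) - \<delta> * (if ?A n \<subseteq> E then norm (\<nu> (?A n)) else 0))"
    proof (rule sum_mono)
      fix n assume n: "n \<in> ?R"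
      have "c n \<bullet> \<nu> (?A n) \<le> norm (c n) * norm (\<nu> (?A n))" by (rule norm_cauchy_schwarz)
      also have "\<dots> \<le> (1 - (if ?A n \<subseteq> E then \<delta> else 0)) * norm (\<nu> (?A n))"
        by (rule mult_right_mono[OF c1[OF n]]) simp
      finally show "c n \<bullet> \<nu> (?A n) \<le> norm (\<nu> (?A n)) - \<delta> * (if ?A n \<subseteq> E then norm (\<nu> (?A n)) else 0)"
        by (cases "?A n \<subseteq> E") (simp_all add: left_diff_distrib del: mem_ball mem_ball_0)
    qed
    also have "\<dots> = (\<Sum>n\<in>?R. norm (\<nu> (?A n))) - \<delta> * (\<Sum>n\<in>?R. if ?A n \<subseteq> E then norm (\<nu> (?A n)) else 0)"
      by (simp add: sum_subtractf sum_distrib_left)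
    also have "\<dots> \<le> (\<Sum>n\<in>?R. norm (\<nu> (?A n))) - \<delta> * norm (\<nu> E)"
      using mult_left_mono[OF Ecov \<delta>] by simp
    finally have "vector_integral \<nu> \<phi> + \<delta> * norm (\<nu> E) - \<eta> * (\<Sum>i\<in>UNIV. M i) \<le> (\<Sum>n\<in>?R. norm (\<nu> (?A n)))"
      by simp
    then show ?thesis
      using vector_measure_norm_sum_le_variation[OF vm fin meas] order_trans ennreal_leI by blast
  qed
  let ?I = "vector_integral \<nu> \<phi> + \<delta> * norm (\<nu> E)" and ?M = "\<Sum>i\<in>UNIV. M i"
  have "(\<lambda>n. ?I - inverse (real (Suc n)) * ?M) \<longlonglongrightarrow> ?I - 0 * ?M"
    by (intro tendsto_intros LIMSEQ_inverse_real_of_nat)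
  then have "(\<lambda>n. ennreal (?I - inverse (real (Suc n)) * ?M)) \<longlonglongrightarrow> ennreal ?I"
    by (intro tendsto_ennrealI) simp
  then show ?thesis
    by (rule LIMSEQ_le_const2) (use key in auto)
qed

section \<open>Gradients and \<open>C\<^sup>1\<close> fields\<close>

text \<open>\<open>C1\<close> speaks about \<open>frechet_derivative\<close>; carrying the gradient
  as an explicit vector field lets sum, product and chain rules compute it.\<close>

definition has_grad :: "(real^2 \<Rightarrow> real) \<Rightarrow> (real^2 \<Rightarrow> real^2) \<Rightarrow> bool" where
  "has_grad u G \<longleftrightarrow> (\<forall>x. (u has_derivative (\<lambda>h. G x \<bullet> h)) (at x)) \<and> continuous_on UNIV G"

lemma has_grad_derivative: "has_grad u G \<Longrightarrow> (u has_derivative (\<lambda>h. G x \<bullet> h)) (at x)"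
  by (simp add: has_grad_def)

lemma has_grad_frechet_derivative:
  "has_grad u G \<Longrightarrow> frechet_derivative u (at x) = (\<lambda>h. G x \<bullet> h)"
  using frechet_derivative_at has_grad_derivative by metis

lemma has_grad_partial_deriv: "has_grad u G \<Longrightarrow> partial_deriv i u x = G x $ i"
  by (simp add: partial_deriv_def has_grad_frechet_derivative cart_eq_inner_axis)

lemma has_grad_continuous: "has_grad u G \<Longrightarrow> continuous_on S u"
  by (meson continuous_at_imp_continuous_on has_derivative_continuous has_grad_derivative)

lemma has_grad_continuous_grad: "has_grad u G \<Longrightarrow> continuous_on S G"
  unfolding has_grad_def using continuous_on_subset by blast

lemma has_grad_C1: "has_grad u G \<Longrightarrow> C1 u"
  unfolding C1_def
  by (auto simp: has_grad_frechet_derivative differentiable_def intro!: continuous_intros has_grad_continuous_grad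
      dest: has_grad_derivative)

lemma C1_has_grad:
  assumes "C1 u"
  obtains G where "has_grad u G"
proof
  let ?D = "\<lambda>x. frechet_derivative u (at x)"
  let ?G = "\<lambda>x. \<Sum>b\<in>Basis. ?D x b *\<^sub>R b"
  have d: "(u has_derivative ?D x) (at x)" for x
    using assms by (simp add: C1_def frechet_derivative_works[symmetric])
  have "?D x h = ?G x \<bullet> h" for x h
  proof -
    have lin: "linear (?D x)" using d has_derivative_linear by blast
    have "?D x h = ?D x (\<Sum>b\<in>Basis. (h \<bullet> b) *\<^sub>R b)" by (simp add: euclidean_representation)
    also have "\<dots> = (\<Sum>b\<in>Basis. (h \<bullet> b) * ?D x b)"
      by (simp add: linear_sum[OF lin] linear_cmul[OF lin])
    also have "\<dots> = ?G x \<bullet> h"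
      by (simp add: inner_sum_left mult.commute inner_commute[of h])
    finally show ?thesis .
  qed
  then have "?D x = (\<lambda>h. ?G x \<bullet> h)" for x by blast
  then have "(u has_derivative (\<lambda>h. ?G x \<bullet> h)) (at x)" for x
    using d[of x] by metis
  moreover have "continuous_on UNIV ?G"
    using assms by (intro continuous_intros) (simp add: C1_def)
  ultimately show "has_grad u ?G" unfolding has_grad_def by blast
qed

lemma has_grad_const: "has_grad (\<lambda>x. c) (\<lambda>x. 0)"
  by (auto simp: has_grad_def)

lemma has_grad_add:
  assumes "has_grad u G" "has_grad v H"
  shows "has_grad (\<lambda>x. u x + v x) (\<lambda>x. G x + H x)"
  using has_derivative_add[OF has_grad_derivative[OF assms(1)] has_grad_derivative[OF assms(2)]]
    assms by (auto simp: has_grad_def inner_add_left intro!: continuous_intros)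

lemma has_grad_mult:
  assumes "has_grad u G" "has_grad v H"
  shows "has_grad (\<lambda>x. u x * v x) (\<lambda>x. u x *\<^sub>R H x + v x *\<^sub>R G x)"
  unfolding has_grad_def
proof (intro conjI allI)
  fix x
  show "((\<lambda>x. u x * v x) has_derivative (\<lambda>h. (u x *\<^sub>R H x + v x *\<^sub>R G x) \<bullet> h)) (at x)"
    using has_derivative_mult[OF has_grad_derivative[OF assms(1)] has_grad_derivative[OF assms(2)], of x]
    by (simp add: inner_add_left mult.commute)
qed (intro continuous_intros has_grad_continuous[OF assms(1)] has_grad_continuous[OF assms(2)]
    has_grad_continuous_grad[OF assms(1)] has_grad_continuous_grad[OF assms(2)])

lemma has_grad_cmult:
  assumes "has_grad u G"
  shows "has_grad (\<lambda>x. c * u x) (\<lambda>x. c *\<^sub>R G x)"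
  using has_grad_mult[OF has_grad_const assms, of c] by simp

lemma has_grad_diff:
  assumes "has_grad u G" "has_grad v H"
  shows "has_grad (\<lambda>x. u x - v x) (\<lambda>x. G x - H x)"
  using has_grad_add[OF assms(1) has_grad_cmult[OF assms(2), of "-1"]] by simp

text \<open>Derivatives of \<open>h\<close> are demanded only at values of \<open>u\<close>. This
  admits outer functions such as \<open>ln\<close>, \<open>sqrt\<close> and inverses, which are
  smooth only on part of the line.\<close>

lemma has_grad_compose:
  assumes u: "has_grad u G"
    and h: "\<And>x. (h has_real_derivative h' (u x)) (at (u x))"
    and c: "continuous_on (range u) h'"
  shows "has_grad (\<lambda>x. h (u x)) (\<lambda>x. h' (u x) *\<^sub>R G x)"
  unfolding has_grad_def
proof (intro conjI allI)
  fix x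
  have "((\<lambda>x. h (u x)) has_derivative (\<lambda>k. (G x \<bullet> k) * h' (u x))) (at x)"
    using has_derivative_compose[OF has_grad_derivative[OF u, of x], of h "\<lambda>k. k * h' (u x)"]
      h[of x] by (simp add: has_field_derivative_def mult_commute_abs)
  then show "((\<lambda>x. h (u x)) has_derivative (\<lambda>k. h' (u x) *\<^sub>R G x \<bullet> k)) (at x)"
    by (simp add: mult.commute)
  show "continuous_on UNIV (\<lambda>x. h' (u x) *\<^sub>R G x)"
    using continuous_on_compose2[OF c has_grad_continuous[OF u, of UNIV]]
    by (intro continuous_intros has_grad_continuous_grad[OF u]) auto
qed

lemma has_grad_component: "has_grad (\<lambda>x. x $ i) (\<lambda>x. axis i 1)"
proof -
  have "(\<lambda>x::real^2. x $ i) = (\<lambda>h. axis i 1 \<bullet> h)" by (simp add: fun_eq_iff inner_axis')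
  then have "((\<lambda>x. x $ i) has_derivative (\<lambda>h. axis i 1 \<bullet> h)) (at x)" for x :: "real^2"
    using bounded_linear_imp_has_derivative[OF bounded_linear_vec_nth, of i "at x"] by metis
  then show ?thesis by (simp add: has_grad_def)
qed

text \<open>Powers of \<open>x \<bullet> x\<close> are smooth at the origin, unlike those of
  \<open>norm x\<close>. For \<open>n = 0\<close> the truncated exponent \<open>n - 1\<close> is
  harmless because the factor \<open>real n\<close> vanishes.\<close>

lemma has_grad_inner_power:
  "has_grad (\<lambda>x. (x \<bullet> x) ^ n) (\<lambda>x. (2 * real n * (x \<bullet> x) ^ (n - 1)) *\<^sub>R x)"
proof -
  have "((\<lambda>x::real^2. x \<bullet> x) has_derivative (\<lambda>h. (2 *\<^sub>R x) \<bullet> h)) (at x)" for x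
    by (auto intro!: derivative_eq_intros simp: inner_commute)
  then have 1: "has_grad (\<lambda>x. x \<bullet> x) (\<lambda>x. 2 *\<^sub>R x)"
    by (auto simp: has_grad_def intro!: continuous_intros)
  have "has_grad (\<lambda>x. (x \<bullet> x) ^ n) (\<lambda>x. (real n * (x \<bullet> x) ^ (n - 1)) *\<^sub>R (2 *\<^sub>R x))"
    by (rule has_grad_compose[OF 1, of "\<lambda>t. t ^ n" "\<lambda>t. real n * t ^ (n - 1)"])
      (auto intro!: derivative_eq_intros continuous_intros)
  then show ?thesis by (simp add: mult_ac)
qed

text \<open>Makes the approximants supplied by the Stone-Weierstrass theorem available as smooth
  functions.\<close>

lemma real_polynomial_function_has_grad:
  assumes "real_polynomial_function (p :: real^2 \<Rightarrow> real)"
  obtains G where "has_grad p G"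
proof -
  have "\<exists>G. has_grad p G"
    using assms
  proof induction
    case (linear f)
    have "C1 f"
      using linear by (auto simp: C1_def linear_imp_differentiable bounded_linear.linear
          frechet_derivative_at[OF bounded_linear_imp_has_derivative, symmetric])
    then show ?case using C1_has_grad by blast
  next
    case (const c)
    then show ?case using has_grad_const by blast
  next
    case (add f g)
    then show ?case using has_grad_add by blast
  next
    case (mult f g)
    then show ?case using has_grad_mult by blast
  qed
  then show ?thesis using that by blast
qed

lemma C1_component:
  assumes "C1 (\<phi> :: real^2 \<Rightarrow> real^2)"
  obtains G where "has_grad (\<lambda>x. \<phi> x $ i) G"
proof -
  have d: "(\<phi> has_derivative frechet_derivative \<phi> (at x)) (at x)" for x
    using assms by (simp add: C1_def frechet_derivative_works[symmetric])
  have d': "((\<lambda>x. \<phi> x $ i) has_derivative (\<lambda>h. frechet_derivative \<phi> (at x) h $ i)) (at x)" for x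
    by (rule bounded_linear.has_derivative[OF bounded_linear_vec_nth d])
  have "C1 (\<lambda>x. \<phi> x $ i)"
    unfolding C1_def
  proof (intro conjI allI)
    show "(\<lambda>x. \<phi> x $ i) differentiable at x" for x using d' by (auto simp: differentiable_def)
    fix v
    have "continuous_on UNIV (\<lambda>x. frechet_derivative \<phi> (at x) v $ i)"
      using assms by (intro continuous_intros) (simp add: C1_def)
    then show "continuous_on UNIV (\<lambda>x. frechet_derivative (\<lambda>x. \<phi> x $ i) (at x) v)"
      by (simp add: frechet_derivative_at[OF d', symmetric])
  qed
  then show ?thesis using C1_has_grad that by blast
qed

lemma C1_vector:
  fixes \<phi> :: "real^2 \<Rightarrow> real^2"
  assumes "\<And>i. has_grad (\<lambda>x. \<phi> x $ i) (G i)"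
  shows "C1 \<phi>"
proof -
  have d: "(\<phi> has_derivative (\<lambda>h. \<chi> i. G i x \<bullet> h)) (at x)" for x
  proof (subst has_derivative_componentwise_within, intro ballI)
    fix b :: "real^2" assume "b \<in> Basis"
    then obtain i where b: "b = axis i 1" by (auto simp: Basis_vec_def)
    show "((\<lambda>x. \<phi> x \<bullet> b) has_derivative (\<lambda>h. (\<chi> i. G i x \<bullet> h) \<bullet> b)) (at x)"
      using has_grad_derivative[OF assms, of i x] by (simp add: b inner_axis)
  qed
  show ?thesis
    unfolding C1_def
  proof (intro conjI allI)
    show "\<phi> differentiable at x" for x using d by (auto simp: differentiable_def)
    show "continuous_on UNIV (\<lambda>x. frechet_derivative \<phi> (at x) v)" for v
      unfolding frechet_derivative_at[OF d, symmetric]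
      by (intro continuous_intros has_grad_continuous_grad[OF assms])
  qed
qed

lemma divergence_eq:
  assumes "\<And>i. has_grad (\<lambda>x. \<phi> x $ i) (G i)"
  shows "divergence \<phi> x = (\<Sum>i\<in>UNIV. G i x $ i)"
  by (simp add: divergence_def has_grad_partial_deriv[OF assms])

lemma C1_continuous_vec:
  fixes \<phi> :: "real^2 \<Rightarrow> real^2"
  assumes "C1 \<phi>"
  shows "continuous_on S \<phi>"
  using assms unfolding C1_def
  by (meson continuous_at_imp_continuous_on differentiable_imp_continuous_within)

section \<open>Green's formula on the disk\<close>

lemma vector2_eq: "(vector [a, b] :: real^2) = a *\<^sub>R axis 1 1 + b *\<^sub>R axis 2 1"
  by (simp add: vec_eq_iff forall_2 axis_def)

lemma continuous_on_vector2 [continuous_intros]: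
  assumes "continuous_on S f" "continuous_on S g"
  shows "continuous_on S (\<lambda>x. vector [f x, g x] :: real^2)"
  unfolding vector2_eq by (intro continuous_intros assms)

lemma borel_measurable_vector2 [measurable]:
  assumes [measurable]: "f \<in> borel_measurable M" "g \<in> borel_measurable M"
  shows "(\<lambda>x. vector [f x, g x] :: real^2) \<in> borel_measurable M"
  unfolding vector2_eq by measurable

lemma norm_vector2: "norm (vector [a, b] :: real^2) = sqrt (a\<^sup>2 + b\<^sup>2)"
  by (simp add: norm_vec_def L2_set_def UNIV_2)

abbreviation circ :: "real \<Rightarrow> real^2" where
  "circ t \<equiv> vector [cos t, sin t]"

lemma circ_in_sphere: "norm (circ t) = 1"
  by (simp add: norm_vector2)

lemma circ_measurable:
  "circ \<in> measurable (restrict_space lborel {0..<2 * pi}) (restrict_space borel (sphere 0 1))"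
  by (intro measurable_restrict_space2 measurable_restrict_space1) (auto simp: circ_in_sphere)

lemma integral_circle_measure:
  fixes f :: "real^2 \<Rightarrow> real"
  assumes "f \<in> borel_measurable borel"
  shows "(LINT x|circle_measure. f x) = (LINT t:{0..<2 * pi}|lborel. f (circ t))"
    and "integrable circle_measure f \<longleftrightarrow> set_integrable lborel {0..<2 * pi} (\<lambda>t. f (circ t))"
proof -
  have f: "f \<in> borel_measurable (restrict_space borel (sphere 0 1))"
    using assms by (rule measurable_restrict_space1)
  show "(LINT x|circle_measure. f x) = (LINT t:{0..<2 * pi}|lborel. f (circ t))"
    unfolding circle_measure_def integral_distr[OF circ_measurable f] set_lebesgue_integral_def
    by (subst integral_restrict_space) auto
  show "integrable circle_measure f \<longleftrightarrow> set_integrable lborel {0..<2 * pi} (\<lambda>t. f (circ t))"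
    unfolding circle_measure_def integrable_distr_eq[OF circ_measurable f] set_integrable_def
    by (subst integrable_restrict_space) auto
qed

lemma integral_lebesgue_on_disk:
  fixes f :: "real^2 \<Rightarrow> real"
  assumes "f \<in> borel_measurable borel"
  shows "(LINT x|lebesgue_on disk. f x) = (LINT x:disk|lborel. f x)"
    and "integrable (lebesgue_on disk) f \<longleftrightarrow> set_integrable lborel disk f"
proof -
  have m: "(\<lambda>x. indicator disk x *\<^sub>R f x) \<in> borel_measurable lborel"
  proof -
    have "disk \<in> sets borel" by (rule borel_open[OF open_ball])
    then show ?thesis using assms by (intro borel_measurable_scaleR borel_measurable_indicator) auto
  qed
  show "(LINT x|lebesgue_on disk. f x) = (LINT x:disk|lborel. f x)"
    unfolding set_lebesgue_integral_def
    by (subst integral_restrict_space) (use m in \<open>auto simp: integral_completion\<close>)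
  show "integrable (lebesgue_on disk) f \<longleftrightarrow> set_integrable lborel disk f"
    unfolding set_integrable_def
    by (subst integrable_restrict_space) (use m in \<open>auto simp: integrable_completion\<close>)
qed

lemma set_integrable_disk_continuous:
  fixes f :: "real^2 \<Rightarrow> 'b::euclidean_space"
  assumes "continuous_on UNIV f"
  shows "set_integrable lborel disk f"
  by (rule set_integrable_subset[OF borel_integrable_compact[of "cball 0 1", folded set_integrable_def]])
    (use assms continuous_on_subset in auto)

text \<open>Gives access to Fubini in coordinates. Lebesgue measure is determined by its values on
  boxes, and a box pulls back to a product of intervals.\<close>

lemma lborel_real2: "distr (lborel \<Otimes>\<^sub>M lborel) borel (\<lambda>(x, y). vector [x, y]) = (lborel :: (real^2) measure)"
proof (rule lborel_eqI[symmetric])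
  have B: "(Basis :: (real^2) set) = {axis 1 1, axis 2 1}"
    by (auto simp: Basis_vec_def UNIV_2)
  have ne: "axis 1 1 \<noteq> (axis 2 1 :: real^2)" by (simp add: axis_eq_axis)
  fix l u :: "real^2" assume le: "\<And>b. b \<in> Basis \<Longrightarrow> l \<bullet> b \<le> u \<bullet> b"
  have le': "l $ i \<le> u $ i" for i using le[of "axis i 1"] by (simp add: inner_axis)
  have "(\<lambda>(x, y). vector [x, y]) -` box l u \<inter> space (lborel \<Otimes>\<^sub>M lborel) = {l$1<..<u$1} \<times> {l$2<..<u$2}"
    by (auto simp: mem_box_cart forall_2 space_pair_measure)
  then have "emeasure (distr (lborel \<Otimes>\<^sub>M lborel) borel (\<lambda>(x, y). vector [x, y])) (box l u)
      = emeasure (lborel \<Otimes>\<^sub>M lborel) ({l$1<..<u$1} \<times> {l$2<..<u$2})"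
    by (subst emeasure_distr) (auto simp: split_def)
  also have "\<dots> = ennreal (u$1 - l$1) * ennreal (u$2 - l$2)"
    by (subst lborel.emeasure_pair_measure_Times) (auto simp: le')
  also have "\<dots> = (\<Prod>b\<in>Basis. (u - l) \<bullet> b)"
    using ne le' by (simp add: B inner_axis ennreal_mult)
  finally show "emeasure (distr (lborel \<Otimes>\<^sub>M lborel) borel (\<lambda>(x, y). vector [x, y])) (box l u)
      = (\<Prod>b\<in>Basis. (u - l) \<bullet> b)" .
qed simp

lemma integral_disk_iterated:
  fixes f :: "real^2 \<Rightarrow> real"
  assumes "continuous_on UNIV f"
  shows "(LINT z:disk|lborel. f z) = (\<integral>y. (\<integral>x. indicator disk (vector [x, y]) * f (vector [x, y]) \<partial>lborel) \<partial>lborel)"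
    and "(LINT z:disk|lborel. f z) = (\<integral>x. (\<integral>y. indicator disk (vector [x, y]) * f (vector [x, y]) \<partial>lborel) \<partial>lborel)"
proof -
  have [measurable]: "f \<in> borel_measurable borel" using assms by (rule borel_measurable_continuous_onI)
  have [measurable]: "disk \<in> sets borel" by (rule borel_open[OF open_ball])
  let ?T = "\<lambda>(x::real, y::real). vector [x, y] :: real^2"
  let ?f = "\<lambda>z. indicator disk z * f z"
  have T: "?T \<in> measurable (lborel \<Otimes>\<^sub>M lborel) borel"
    by (simp add: split_def)
  have "integrable (distr (lborel \<Otimes>\<^sub>M lborel) borel ?T) ?f"
    unfolding lborel_real2 using set_integrable_disk_continuous[OF assms] by (simp add: set_integrable_def)
  then have i: "integrable (lborel \<Otimes>\<^sub>M lborel) (\<lambda>p. ?f (?T p))"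
    by (subst (asm) integrable_distr_eq[OF T]) auto
  have "(LINT z:disk|lborel. f z) = integral\<^sup>L (distr (lborel \<Otimes>\<^sub>M lborel) borel ?T) ?f"
    unfolding lborel_real2 by (simp add: set_lebesgue_integral_def)
  also have "\<dots> = (\<integral>p. ?f (?T p) \<partial>(lborel \<Otimes>\<^sub>M lborel))"
    by (rule integral_distr[OF T]) measurable
  finally have e: "(LINT z:disk|lborel. f z) = (\<integral>p. ?f (?T p) \<partial>(lborel \<Otimes>\<^sub>M lborel))" .
  show "(LINT z:disk|lborel. f z) = (\<integral>y. (\<integral>x. ?f (vector [x, y]) \<partial>lborel) \<partial>lborel)"
    unfolding e using lborel_pair.integral_snd[of "\<lambda>x y. ?f (vector [x, y])"] i by (simp add: split_def)
  show "(LINT z:disk|lborel. f z) = (\<integral>x. (\<integral>y. ?f (vector [x, y]) \<partial>lborel) \<partial>lborel)"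
    unfolding e using lborel_pair.integral_fst[of "\<lambda>x y. ?f (vector [x, y])"] i by (simp add: split_def)
qed

lemma integral_indicator_FTC:
  fixes F :: "real \<Rightarrow> real"
  assumes "a \<le> b" "\<And>x. (F has_real_derivative f x) (at x)" "continuous_on UNIV f"
  shows "(\<integral>x. indicator {a<..<b} x * f x \<partial>lborel) = F b - F a"
proof -
  have [measurable]: "f \<in> borel_measurable borel" by (rule borel_measurable_continuous_onI[OF assms(3)])
  have "(\<integral>x. indicator {a<..<b} x * f x \<partial>lborel) = (\<integral>x. indicator {a..b} x *\<^sub>R f x \<partial>lborel)"
    using AE_lborel_singleton[of a] AE_lborel_singleton[of b]
    by (intro integral_cong_AE) (auto split: split_indicator)
  also have "\<dots> = F b - F a"
    by (rule integral_FTC_Icc[OF assms(1)])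
      (use assms continuous_on_subset[OF assms(3)] in \<open>auto simp: has_real_derivative_iff_has_vector_derivative[symmetric] intro: DERIV_subset\<close>)
  finally show ?thesis .
qed

lemma integral_indicator_Ioo:
  fixes f :: "real \<Rightarrow> real"
  assumes "continuous_on {a..b} f"
  shows "(\<integral>x. indicator {a<..<b} x * f x \<partial>lborel) = integral {a..b} f"
proof -
  have i: "set_integrable lborel {a..b} f"
    using assms by (rule borel_integrable_atLeastAtMost')
  have m: "set_borel_measurable borel {a..b} f"
    using i by (simp add: set_integrable_def set_borel_measurable_def borel_measurable_integrable)
  have "(\<integral>x. indicator {a<..<b} x * f x \<partial>lborel) = (\<integral>x. indicator {a<..<b} x * (indicator {a..b} x * f x) \<partial>lborel)"
    by (intro Bochner_Integration.integral_cong) (auto split: split_indicator)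
  also have "\<dots> = (\<integral>x. indicator {a..b} x * f x \<partial>lborel)"
    using AE_lborel_singleton[of a] AE_lborel_singleton[of b] m
    by (intro integral_cong_AE) (auto simp: set_borel_measurable_def split: split_indicator)
  also have "\<dots> = integral {a..b} f"
    using set_borel_integral_eq_integral(2)[OF i] by (simp add: set_lebesgue_integral_def)
  finally show ?thesis .
qed

lemma vector2_derivative:
  assumes u: "has_grad u G"
  shows "((\<lambda>x. u (vector [x, y])) has_real_derivative G (vector [x, y]) $ 1) (at x)"
    and "((\<lambda>y. u (vector [x, y])) has_real_derivative G (vector [x, y]) $ 2) (at y)"
proof -
  have "((\<lambda>x. vector [x, y] :: real^2) has_derivative (\<lambda>h. h *\<^sub>R axis 1 1)) (at x)"
    unfolding vector2_eq by (auto intro!: derivative_eq_intros)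
  from has_derivative_compose[OF this has_grad_derivative[OF u]]
  show "((\<lambda>x. u (vector [x, y])) has_real_derivative G (vector [x, y]) $ 1) (at x)"
    by (simp add: has_field_derivative_def inner_axis mult_commute_abs)
  have "((\<lambda>y. vector [x, y] :: real^2) has_derivative (\<lambda>h. h *\<^sub>R axis 2 1)) (at y)"
    unfolding vector2_eq by (auto intro!: derivative_eq_intros)
  from has_derivative_compose[OF this has_grad_derivative[OF u]]
  show "((\<lambda>y. u (vector [x, y])) has_real_derivative G (vector [x, y]) $ 2) (at y)"
    by (simp add: has_field_derivative_def inner_axis mult_commute_abs)
qed

lemma indicator_disk_vector2:
  "indicator disk (vector [x, y] :: real^2) =
    (if y \<in> {-1<..<1} then indicator {- sqrt (1 - y\<^sup>2)<..<sqrt (1 - y\<^sup>2)} x else (0::real))"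
  "indicator disk (vector [x, y] :: real^2) =
    (if x \<in> {-1<..<1} then indicator {- sqrt (1 - x\<^sup>2)<..<sqrt (1 - x\<^sup>2)} y else (0::real))"
proof -
  have key: "a\<^sup>2 + b\<^sup>2 < 1 \<longleftrightarrow> - 1 < b \<and> b < 1 \<and> - sqrt (1 - b\<^sup>2) < a \<and> a < sqrt (1 - b\<^sup>2)" for a b :: real
  proof -
    have "\<bar>a\<bar> < sqrt (1 - b\<^sup>2) \<longleftrightarrow> a\<^sup>2 + b\<^sup>2 < 1"
      by (metis less_diff_eq real_sqrt_abs real_sqrt_less_iff)
    moreover have "\<bar>b\<bar> < 1" if "a\<^sup>2 + b\<^sup>2 < 1"
      unfolding abs_square_less_1[symmetric] using that zero_le_power2[of a] by linarith
    ultimately show ?thesis by (auto simp: abs_less_iff)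
  qed
  show "indicator disk (vector [x, y] :: real^2) =
    (if y \<in> {-1<..<1} then indicator {- sqrt (1 - y\<^sup>2)<..<sqrt (1 - y\<^sup>2)} x else (0::real))"
    by (auto simp: indicator_def norm_vector2 key)
  show "indicator disk (vector [x, y] :: real^2) =
    (if x \<in> {-1<..<1} then indicator {- sqrt (1 - x\<^sup>2)<..<sqrt (1 - x\<^sup>2)} y else (0::real))"
    by (auto simp: indicator_def norm_vector2 add.commute[of "x\<^sup>2"] key)
qed

text \<open>Every slice of the disk parallel to an axis is an open interval, on which the
  fundamental theorem of calculus leaves only the values of \<open>u\<close> at the two end points
  on the circle.\<close>

lemma integral_disk_partial:
  assumes u: "has_grad u G"
  shows "(LINT z:disk|lborel. G z $ 1) =
      integral {-1..1} (\<lambda>y. u (vector [sqrt (1 - y\<^sup>2), y])) - integral {-1..1} (\<lambda>y. u (vector [- sqrt (1 - y\<^sup>2), y]))"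
    and "(LINT z:disk|lborel. G z $ 2) =
      integral {-1..1} (\<lambda>x. u (vector [x, sqrt (1 - x\<^sup>2)])) - integral {-1..1} (\<lambda>x. u (vector [x, - sqrt (1 - x\<^sup>2)]))"
proof -
  have c: "continuous_on UNIV (\<lambda>z. G z $ i)" for i
    by (intro continuous_intros has_grad_continuous_grad[OF u])
  have cv: "continuous_on S (\<lambda>x. G (vector [f x, g x]) $ i)"
    if "continuous_on S f" "continuous_on S g" for S :: "real set" and f g i
    by (rule continuous_on_compose2[OF c]) (auto intro!: continuous_intros that)
  have cu: "continuous_on S (\<lambda>x. u (vector [f x, g x]))"
    if "continuous_on S f" "continuous_on S g" for S :: "real set" and f g
    by (rule continuous_on_compose2[OF has_grad_continuous[OF u, of UNIV]]) (auto intro!: continuous_intros that)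
  have sq: "y\<^sup>2 \<le> 1" if "y \<in> {-1<..<1}" for y :: real using that by (auto simp: abs_square_le_1)
  have "(LINT z:disk|lborel. G z $ 1) = (\<integral>y. indicator {-1<..<1} y *
      (u (vector [sqrt (1 - y\<^sup>2), y]) - u (vector [- sqrt (1 - y\<^sup>2), y])) \<partial>lborel)"
    unfolding integral_disk_iterated(1)[OF c]
  proof (intro Bochner_Integration.integral_cong refl)
    fix y :: real
    show "(\<integral>x. indicator disk (vector [x, y]) * G (vector [x, y]) $ 1 \<partial>lborel)
      = indicator {-1<..<1} y * (u (vector [sqrt (1 - y\<^sup>2), y]) - u (vector [- sqrt (1 - y\<^sup>2), y]))"
      using integral_indicator_FTC[of "- sqrt (1 - y\<^sup>2)" "sqrt (1 - y\<^sup>2)" "\<lambda>x. u (vector [x, y])" "\<lambda>x. G (vector [x, y]) $ 1"]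
        sq[of y] vector2_derivative(1)[OF u] cv[of UNIV "\<lambda>x. x" "\<lambda>x. y" 1]
      by (auto simp: indicator_disk_vector2(1) split: split_indicator)
  qed
  also have "\<dots> = integral {-1..1} (\<lambda>y. u (vector [sqrt (1 - y\<^sup>2), y]) - u (vector [- sqrt (1 - y\<^sup>2), y]))"
    by (rule integral_indicator_Ioo) (intro continuous_intros cu)
  also have "\<dots> = integral {-1..1} (\<lambda>y. u (vector [sqrt (1 - y\<^sup>2), y])) - integral {-1..1} (\<lambda>y. u (vector [- sqrt (1 - y\<^sup>2), y]))"
    by (intro Henstock_Kurzweil_Integration.integral_diff integrable_continuous_real cu continuous_intros)
  finally show "(LINT z:disk|lborel. G z $ 1) =
      integral {-1..1} (\<lambda>y. u (vector [sqrt (1 - y\<^sup>2), y])) - integral {-1..1} (\<lambda>y. u (vector [- sqrt (1 - y\<^sup>2), y]))" .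
  have "(LINT z:disk|lborel. G z $ 2) = (\<integral>x. indicator {-1<..<1} x *
      (u (vector [x, sqrt (1 - x\<^sup>2)]) - u (vector [x, - sqrt (1 - x\<^sup>2)])) \<partial>lborel)"
    unfolding integral_disk_iterated(2)[OF c]
  proof (intro Bochner_Integration.integral_cong refl)
    fix x :: real
    show "(\<integral>y. indicator disk (vector [x, y]) * G (vector [x, y]) $ 2 \<partial>lborel)
      = indicator {-1<..<1} x * (u (vector [x, sqrt (1 - x\<^sup>2)]) - u (vector [x, - sqrt (1 - x\<^sup>2)]))"
      using integral_indicator_FTC[of "- sqrt (1 - x\<^sup>2)" "sqrt (1 - x\<^sup>2)" "\<lambda>y. u (vector [x, y])" "\<lambda>y. G (vector [x, y]) $ 2"]
        sq[of x] vector2_derivative(2)[OF u] cv[of UNIV "\<lambda>y. x" "\<lambda>y. y" 2]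
      by (auto simp: indicator_disk_vector2(2) split: split_indicator)
  qed
  also have "\<dots> = integral {-1..1} (\<lambda>x. u (vector [x, sqrt (1 - x\<^sup>2)]) - u (vector [x, - sqrt (1 - x\<^sup>2)]))"
    by (rule integral_indicator_Ioo) (intro continuous_intros cu)
  also have "\<dots> = integral {-1..1} (\<lambda>x. u (vector [x, sqrt (1 - x\<^sup>2)])) - integral {-1..1} (\<lambda>x. u (vector [x, - sqrt (1 - x\<^sup>2)]))"
    by (intro Henstock_Kurzweil_Integration.integral_diff integrable_continuous_real cu continuous_intros)
  finally show "(LINT z:disk|lborel. G z $ 2) =
      integral {-1..1} (\<lambda>x. u (vector [x, sqrt (1 - x\<^sup>2)])) - integral {-1..1} (\<lambda>x. u (vector [x, - sqrt (1 - x\<^sup>2)]))" .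
qed

text \<open>The two graphs over a diameter become arcs under the substitutions
  \<open>y = sin t\<close> and \<open>x = cos t\<close>. As \<open>sqrt (1 - (sin t)^2)\<close> is
  \<open>\<bar>cos t\<bar>\<close>, the parameter interval is cut where the cosine (for the other
  component, the sine) changes sign; the reversed direction of travel on the second graph yields its
  minus sign.\<close>

lemma green_disk:
  assumes u: "has_grad u G"
  shows "(LINT z:disk|lborel. G z $ i) = (LINT x|circle_measure. x $ i * u x)"
proof -
  have cu: "continuous_on S (\<lambda>x. u (vector [f x, g x]))"
    if "continuous_on S f" "continuous_on S g" for S :: "real set" and f g
    by (rule continuous_on_compose2[OF has_grad_continuous[OF u, of UNIV]]) (auto intro!: continuous_intros that)
  \<comment> \<open>The difference of integrals is an oriented integral: at least one of the two
    intervals is empty or a single point.\<close>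
  have sub_sin: "((\<lambda>t. cos t *\<^sub>R f (sin t)) has_integral (integral {sin a..sin b} f - integral {sin b..sin a} f)) {a..b}"
    if "a \<le> b" "continuous_on {-1..1} f" for a b and f :: "real \<Rightarrow> real"
    by (rule has_integral_substitution_general[of "{}" _ _ _ "-1" 1, OF _ that(1) _ that(2)])
      (auto intro!: derivative_eq_intros continuous_intros)
  have sub_cos: "((\<lambda>t. - sin t *\<^sub>R f (cos t)) has_integral (integral {cos a..cos b} f - integral {cos b..cos a} f)) {a..b}"
    if "a \<le> b" "continuous_on {-1..1} f" for a b and f :: "real \<Rightarrow> real"
    by (rule has_integral_substitution_general[of "{}" _ _ _ "-1" 1, OF _ that(1) _ that(2)])
      (auto intro!: derivative_eq_intros continuous_intros)
  have sin3: "sin (3 * pi / 2) = - 1" using sin_3over2_pi by (simp add: field_simps)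
  have 1: "((\<lambda>t. cos t * u (circ t)) has_integral (LINT z:disk|lborel. G z $ 1)) {0..2 * pi}"
  proof -
    let ?f = "\<lambda>y. u (vector [sqrt (1 - y\<^sup>2), y])" and ?g = "\<lambda>y. u (vector [- sqrt (1 - y\<^sup>2), y])"
    have cf: "continuous_on {-1..1} ?f" and cg: "continuous_on {-1..1} ?g"
      by (intro cu continuous_intros)+
    have s: "sqrt (1 - (sin t)\<^sup>2) = \<bar>cos t\<bar>" for t :: real
      by (simp add: cos_squared_eq[symmetric])
    have "((\<lambda>t. cos t *\<^sub>R ?f (sin t)) has_integral (integral {sin 0..sin (pi/2)} ?f - integral {sin (pi/2)..sin 0} ?f)) {0..pi/2}"
      by (rule sub_sin[OF _ cf]) simp
    then have a: "((\<lambda>t. cos t * u (circ t)) has_integral integral {0..1} ?f) {0..pi/2}"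
      by (rule has_integral_eq[rotated, THEN has_integral_eq_rhs]) (auto simp: s cos_ge_zero)
    have "((\<lambda>t. cos t *\<^sub>R ?g (sin t)) has_integral (integral {sin (pi/2)..sin (3*pi/2)} ?g - integral {sin (3*pi/2)..sin (pi/2)} ?g)) {pi/2..3*pi/2}"
      by (rule sub_sin[OF _ cg]) simp
    moreover have cn: "cos t \<le> 0" if "t \<in> {pi/2..3*pi/2}" for t
      using cos_ge_zero[of "t - pi"] that by simp
    ultimately have b: "((\<lambda>t. cos t * u (circ t)) has_integral - integral {-1..1} ?g) {pi/2..3*pi/2}"
      by (elim has_integral_eq[rotated, THEN has_integral_eq_rhs]) (auto simp: s sin3)
    have "((\<lambda>t. cos t *\<^sub>R ?f (sin t)) has_integral (integral {sin (3*pi/2)..sin (2*pi)} ?f - integral {sin (2*pi)..sin (3*pi/2)} ?f)) {3*pi/2..2*pi}"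
      by (rule sub_sin[OF _ cf]) simp
    moreover have cp: "cos t \<ge> 0" if "t \<in> {3*pi/2..2*pi}" for t
      using cos_ge_zero[of "t - 2*pi"] that by (simp add: cos_diff)
    ultimately have c: "((\<lambda>t. cos t * u (circ t)) has_integral integral {-1..0} ?f) {3*pi/2..2*pi}"
      by (elim has_integral_eq[rotated, THEN has_integral_eq_rhs]) (auto simp: s sin3)
    have "((\<lambda>t. cos t * u (circ t)) has_integral
        (integral {0..1} ?f + - integral {-1..1} ?g + integral {-1..0} ?f)) {0..2*pi}"
      by (rule has_integral_combine[OF _ _ has_integral_combine[OF _ _ a b] c]) auto
    moreover have "integral {-1..0} ?f + integral {0..1} ?f = integral {-1..1} ?f"
      by (rule Henstock_Kurzweil_Integration.integral_combine) (auto intro: integrable_continuous_real cf)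
    ultimately show ?thesis
      unfolding integral_disk_partial(1)[OF u] by (simp add: algebra_simps)
  qed
  have 2: "((\<lambda>t. sin t * u (circ t)) has_integral (LINT z:disk|lborel. G z $ 2)) {0..2 * pi}"
  proof -
    let ?f = "\<lambda>x. u (vector [x, sqrt (1 - x\<^sup>2)])" and ?g = "\<lambda>x. u (vector [x, - sqrt (1 - x\<^sup>2)])"
    have cf: "continuous_on {-1..1} ?f" and cg: "continuous_on {-1..1} ?g"
      by (intro cu continuous_intros)+
    have s: "sqrt (1 - (cos t)\<^sup>2) = \<bar>sin t\<bar>" for t :: real
      by (simp add: sin_squared_eq[symmetric])
    have "((\<lambda>t. - sin t *\<^sub>R ?f (cos t)) has_integral (integral {cos 0..cos pi} ?f - integral {cos pi..cos 0} ?f)) {0..pi}"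
      by (rule sub_cos[OF _ cf]) simp
    from has_integral_neg[OF this]
    have a: "((\<lambda>t. sin t * u (circ t)) has_integral integral {-1..1} ?f) {0..pi}"
      by (rule has_integral_eq[rotated, THEN has_integral_eq_rhs]) (auto simp: s sin_ge_zero)
    have "((\<lambda>t. - sin t *\<^sub>R ?g (cos t)) has_integral (integral {cos pi..cos (2*pi)} ?g - integral {cos (2*pi)..cos pi} ?g)) {pi..2*pi}"
      by (rule sub_cos[OF _ cg]) simp
    from has_integral_neg[OF this]
    moreover have sn: "sin t \<le> 0" if "t \<in> {pi..2*pi}" for t
      using sin_ge_zero[of "t - pi"] that by simp
    ultimately have b: "((\<lambda>t. sin t * u (circ t)) has_integral - integral {-1..1} ?g) {pi..2*pi}"
      by (elim has_integral_eq[rotated, THEN has_integral_eq_rhs]) (auto simp: s)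
    have "((\<lambda>t. sin t * u (circ t)) has_integral (integral {-1..1} ?f + - integral {-1..1} ?g)) {0..2*pi}"
      by (rule has_integral_combine[OF _ _ a b]) auto
    then show ?thesis
      unfolding integral_disk_partial(2)[OF u] by simp
  qed
  have 3: "((\<lambda>t. circ t $ i * u (circ t)) has_integral (LINT z:disk|lborel. G z $ i)) {0..2 * pi}"
    using 1 2 exhaust_2[of i] by auto
  have c3: "continuous_on S (\<lambda>t. circ t $ i * u (circ t))" for S
    by (intro continuous_intros cu)
  have "(LINT x|circle_measure. x $ i * u x) = (LINT t:{0..<2 * pi}|lborel. circ t $ i * u (circ t))"
    by (rule integral_circle_measure) (intro borel_measurable_continuous_onI continuous_intros has_grad_continuous[OF u])
  also have "\<dots> = (\<integral>t. indicator {0<..<2 * pi} t * (circ t $ i * u (circ t)) \<partial>lborel)"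
    unfolding set_lebesgue_integral_def
    using AE_lborel_singleton[of 0] borel_measurable_continuous_onI[OF c3[of UNIV]]
    by (intro integral_cong_AE) (auto split: split_indicator)
  also have "\<dots> = integral {0..2 * pi} (\<lambda>t. circ t $ i * u (circ t))"
    by (rule integral_indicator_Ioo[OF c3])
  also have "\<dots> = (LINT z:disk|lborel. G z $ i)" using 3 by (rule integral_unique)
  finally show ?thesis ..
qed

section \<open>The boundary datum\<close>

text \<open>Around each dyadic point of level \<open>m\<close> an interval of length of order \<open>4\<^sup>-\<^sup>m\<close> is removed. Every
  interval of length \<open>d\<close> then loses a length of order \<open>d\<^sup>2\<close>, while the total loss, of order
  \<open>\<Sum> 2\<^sup>m 4\<^sup>-\<^sup>m\<close>, stays small.\<close>

lemma fat_closed_set: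
  obtains K :: "real set" where "compact K" "K \<subseteq> {0..1/256}" "measure lborel K > 0"
    "\<And>s t. 0 \<le> s \<Longrightarrow> s \<le> t \<Longrightarrow> t \<le> 1/256 \<Longrightarrow> measure lborel (K \<inter> {s..t}) \<le> (t - s) - 2 * (t - s)\<^sup>2"
proof -
  \<comment> \<open>With these radii level \<open>m\<close> removes a length of at most
    \<open>(1/2)^m / 1024\<close>. The sum over all levels is at most 1/512, half of the interval,
    so \<open>K\<close> keeps positive measure.\<close>
  define r :: "nat \<Rightarrow> real" where "r m = (1/4) ^ m / 4096" for m
  define p :: "nat \<Rightarrow> nat \<Rightarrow> real" where "p m j = real j / (256 * 2 ^ m)" for m j
  define V where "V m = (\<Union>j\<le>2^m. {p m j - r m<..<p m j + r m})" for m
  define K where "K = {0..1/256} - (\<Union>m. V m)"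
  have r0: "r m > 0" for m by (simp add: r_def)
  have "open (\<Union>m. V m)" unfolding V_def by (intro open_UN ballI open_greaterThanLessThan)
  then have comp: "compact K" unfolding K_def by (intro compact_diff) auto
  then have K[measurable]: "K \<in> sets borel" by (simp add: borel_compact)
  have V[measurable]: "V m \<in> sets borel" for m unfolding V_def by auto
  have emV: "emeasure lborel (V m) \<le> ennreal ((1/2) ^ m / 1024)" for m
  proof -
    have "emeasure lborel (V m) \<le> (\<Sum>j\<le>2^m. emeasure lborel {p m j - r m<..<p m j + r m})"
      unfolding V_def by (rule emeasure_subadditive_finite) auto
    also have "\<dots> = (\<Sum>j\<le>(2::nat)^m. ennreal (2 * r m))"
      using r0[of m] by (intro sum.cong refl) (subst emeasure_lborel_Ioo, auto)
    also have "\<dots> = ennreal ((2 ^ m + 1) * (2 * r m))"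
      using r0[of m] by (simp add: ennreal_mult' ennreal_of_nat_eq_real_of_nat add.commute)
    also have "\<dots> \<le> ennreal ((1/2) ^ m / 1024)"
    proof (rule ennreal_leI)
      have "(2 ^ m + 1) * (2 * r m) \<le> (2 * 2 ^ m) * (2 * r m)"
        using r0[of m] by (intro mult_right_mono) auto
      also have "\<dots> = (2 ^ m * (1/4) ^ m) / 1024" by (simp add: r_def)
      also have "2 ^ m * (1/4) ^ m = (1/2 :: real) ^ m"
        by (simp add: power_mult_distrib[symmetric])
      finally show "(2 ^ m + 1) * (2 * r m) \<le> (1/2) ^ m / 1024" .
    qed
    finally show ?thesis .
  qed
  have "emeasure lborel (\<Union>m. V m) \<le> (\<Sum>m. emeasure lborel (V m))"
    by (rule emeasure_subadditive_countably) (use V in auto)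
  also have "\<dots> \<le> (\<Sum>m. ennreal ((1/2) ^ m / 1024))"
    by (intro suminf_le emV) auto
  also have "\<dots> = ennreal (\<Sum>m. (1/2) ^ m / 1024)"
    by (intro suminf_ennreal2) (auto intro: summable_divide)
  also have "(\<Sum>m. (1/2) ^ m / 1024) = (1/512 :: real)"
    by (subst suminf_divide) (auto simp: suminf_geometric)
  finally have emU: "emeasure lborel (\<Union>m. V m) \<le> ennreal (1/512)" .
  have "measure lborel K > 0"
  proof -
    have "ennreal (1/256) = emeasure lborel {0..1/256::real}" by simp
    also have "\<dots> \<le> emeasure lborel (K \<union> (\<Union>m. V m))"
      by (intro emeasure_mono) (auto simp: K_def)
    also have "\<dots> \<le> emeasure lborel K + emeasure lborel (\<Union>m. V m)"
      by (rule emeasure_subadditive) (use K V in auto)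
    also have "\<dots> \<le> emeasure lborel K + ennreal (1/512)" by (intro add_left_mono emU)
    also have "emeasure lborel K = ennreal (measure lborel K)"
      using emeasure_compact_finite[OF comp] by (simp add: emeasure_eq_ennreal_measure top.not_eq_extremum)
    finally have "ennreal (1/256) \<le> ennreal (measure lborel K + 1/512)" by simp
    then have "1/256 \<le> measure lborel K + 1/512" by (subst (asm) ennreal_le_iff) auto
    then show ?thesis by simp
  qed
  moreover have "measure lborel (K \<inter> {s..t}) \<le> (t - s) - 2 * (t - s)\<^sup>2"
    if st: "0 \<le> s" "s \<le> t" "t \<le> 1/256" for s t
  proof (cases "s = t")
    case True
    have "measure lborel (K \<inter> {s..t}) \<le> measure lborel {s..t}"
      by (intro measure_mono_fmeasurable fmeasurable_compact) auto
    then show ?thesis using True by simp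
  next
    case False
    define d where "d = t - s"
    have d: "0 < d" "d \<le> 1/256" using st False by (auto simp: d_def)
    obtain n where n: "(1/2 :: real) ^ n < 128 * d" using real_arch_pow_inv[of "128 * d" "1/2"] d by auto
    \<comment> \<open>Minimality of \<open>m\<close> gives \<open>64 * d < (1/2)^m\<close>, hence
      \<open>d^2 \<le> r m\<close>, because 4096 is the square of 64; it applies since
      \<open>d \<le> 1/256\<close> excludes \<open>m = 0\<close>. The defining inequality makes the
      grid spacing \<open>(1/2)^m / 256\<close> at most \<open>d / 2\<close>. So the grid point
      nearest to the midpoint \<open>e\<close> is within \<open>d / 4\<close> of it, and its removed
      interval of length \<open>2 * r m\<close> fits into \<open>{s..t}\<close>.\<close>
    define m where "m = (LEAST n. (1/2 :: real) ^ n \<le> 128 * d)"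
    have m: "(1/2 :: real) ^ m \<le> 128 * d"
      unfolding m_def by (rule LeastI[of _ n]) (use n in simp)
    have "m \<noteq> 0" using m d by (cases "m = 0") auto
    then obtain k where k: "m = Suc k" by (cases m) auto
    have "\<not> (1/2 :: real) ^ k \<le> 128 * d"
      using not_less_Least[of k "\<lambda>n. (1/2 :: real) ^ n \<le> 128 * d"] k unfolding m_def by simp
    then have m': "64 * d < (1/2 :: real) ^ m" by (simp add: k)
    have "(64 * d)\<^sup>2 \<le> ((1/2) ^ m)\<^sup>2" using m' d by (intro power_mono) auto
    also have "\<dots> = (1/4 :: real) ^ m" by (simp add: power2_eq_square power_mult_distrib[symmetric])
    finally have rd: "d\<^sup>2 \<le> r m" by (simp add: r_def power2_eq_square)
    define e where "e = (s + t) / 2"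
    have e: "0 \<le> e" "e \<le> 1/256" using st by (auto simp: e_def)
    define j where "j = nat (round (256 * 2 ^ m * e))"
    have jr: "real j = of_int (round (256 * 2 ^ m * e))"
      unfolding j_def using e round_mono[of 0 "256 * 2 ^ m * e"] by simp
    have "round (256 * 2 ^ m * e) \<le> round (real (2 ^ m))"
      using e by (intro round_mono) simp
    then have "round (256 * 2 ^ m * e) \<le> 2 ^ m" by (metis round_of_nat of_nat_power of_nat_numeral)
    then have j: "j \<le> 2 ^ m" unfolding j_def by (simp add: nat_le_iff)
    have "\<bar>real j - 256 * 2 ^ m * e\<bar> \<le> 1 / 2" unfolding jr by (rule of_int_round_abs_le)
    then have "\<bar>real j - 256 * 2 ^ m * e\<bar> / (256 * 2 ^ m) \<le> (1/2) / (256 * 2 ^ m)"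
      by (rule divide_right_mono) simp
    also have "\<bar>real j - 256 * 2 ^ m * e\<bar> / (256 * 2 ^ m) = \<bar>p m j - e\<bar>"
      by (simp add: p_def abs_div_pos diff_divide_distrib)
    also have "(1/2) / (256 * 2 ^ m) = (1/2) ^ m / (512::real)" by (simp add: power_divide)
    finally have pe: "\<bar>p m j - e\<bar> \<le> d / 4" using m by linarith
    have "r m \<le> (1/2) ^ m / 4096"
      unfolding r_def by (intro divide_right_mono power_mono) auto
    then have rd': "r m \<le> d / 4" using m d by linarith
    let ?B = "{p m j - r m<..<p m j + r m}"
    have B: "?B \<subseteq> {s..t}" 
    proof -
      have "p m j - e \<le> d / 4" "- (p m j - e) \<le> d / 4"
        using abs_le_D1[OF pe] abs_le_D2[OF pe] by blast+
      then have "s \<le> p m j - r m \<and> p m j + r m \<le> t"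
        using rd' by (simp add: d_def e_def field_simps)
      then show ?thesis by auto
    qed
    have "?B \<subseteq> V m" unfolding V_def using j by blast
    then have "K \<inter> {s..t} \<subseteq> {s..t} - ?B" unfolding K_def by blast
    then have "measure lborel (K \<inter> {s..t}) \<le> measure lborel ({s..t} - ?B)"
      by (intro measure_mono_fmeasurable fmeasurable_Diff fmeasurable_compact) auto
    also have "\<dots> = measure lborel {s..t} - measure lborel ?B"
      using B st by (intro measure_Diff) auto
    also have "\<dots> = d - 2 * r m" using st r0[of m] by (simp add: d_def)
    finally show ?thesis using rd by (simp add: d_def)
  qed
  ultimately show ?thesis by (intro that[OF comp]) (auto simp: K_def)
qed

section \<open>Calibrating fields\<close>

text \<open>A twice continuously differentiable function, with equality of the mixed second
  derivatives carried along by every rule instead of being derived from Schwarz's theorem. That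
  symmetry is exactly the vanishing divergence of the rotated gradient.\<close>

definition C2_grad :: "(real^2 \<Rightarrow> real) \<Rightarrow> (real^2 \<Rightarrow> real^2) \<Rightarrow> bool" where
  "C2_grad u G \<longleftrightarrow> has_grad u G \<and>
     (\<exists>H. (\<forall>i. has_grad (\<lambda>x. G x $ i) (H i)) \<and> (\<forall>x. H 1 x $ 2 = H 2 x $ 1))"

lemma C2_grad_has_grad: "C2_grad u G \<Longrightarrow> has_grad u G"
  by (simp add: C2_grad_def)

lemma C2_grad_const: "C2_grad (\<lambda>x. c) (\<lambda>x. 0)"
  unfolding C2_grad_def
  by (intro conjI exI[of _ "\<lambda>i x. 0"]) (auto simp: has_grad_const)

lemma C2_grad_add:
  assumes "C2_grad u G" "C2_grad v H"
  shows "C2_grad (\<lambda>x. u x + v x) (\<lambda>x. G x + H x)"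
proof -
  obtain A where A: "\<And>i. has_grad (\<lambda>x. G x $ i) (A i)" "\<And>x. A 1 x $ 2 = A 2 x $ 1"
    using assms(1) unfolding C2_grad_def by blast
  obtain B where B: "\<And>i. has_grad (\<lambda>x. H x $ i) (B i)" "\<And>x. B 1 x $ 2 = B 2 x $ 1"
    using assms(2) unfolding C2_grad_def by blast
  show ?thesis
    unfolding C2_grad_def
    by (intro conjI has_grad_add C2_grad_has_grad[OF assms(1)] C2_grad_has_grad[OF assms(2)]
        exI[of _ "\<lambda>i x. A i x + B i x"])
      (use has_grad_add[OF A(1) B(1)] A(2) B(2) in auto)
qed

lemma C2_grad_sum:
  assumes "\<And>i. i \<in> I \<Longrightarrow> C2_grad (u i) (G i)"
  shows "C2_grad (\<lambda>x. \<Sum>i\<in>I. u i x) (\<lambda>x. \<Sum>i\<in>I. G i x)"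
  using assms
proof (induction I rule: infinite_finite_induct)
  case (insert i I)
  then show ?case using C2_grad_add[of "u i" "G i"] by simp
qed (auto intro: C2_grad_const)

text \<open>The new Hessian is \<open>h'\<close> times the old one plus \<open>h''\<close> times the
  product matrix of the gradient with itself; both terms are symmetric.\<close>

lemma C2_grad_compose:
  assumes u: "C2_grad u G"
    and h: "\<And>x. (h has_real_derivative h' (u x)) (at (u x))"
    and h': "\<And>x. (h' has_real_derivative h'' (u x)) (at (u x))"
    and c: "continuous_on (range u) h''"
  shows "C2_grad (\<lambda>x. h (u x)) (\<lambda>x. h' (u x) *\<^sub>R G x)"
proof -
  have u': "has_grad u G" by (rule C2_grad_has_grad[OF u])
  obtain A where A: "\<And>i. has_grad (\<lambda>x. G x $ i) (A i)" "\<And>x. A 1 x $ 2 = A 2 x $ 1"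
    using u unfolding C2_grad_def by blast
  have c': "continuous_on (range u) h'"
    using h' by (intro DERIV_continuous_on[of _ _ h'']) (auto intro: DERIV_subset)
  have "has_grad (\<lambda>x. h' (u x) * G x $ i) (\<lambda>x. h' (u x) *\<^sub>R A i x + G x $ i *\<^sub>R (h'' (u x) *\<^sub>R G x))" for i
    by (rule has_grad_mult[OF has_grad_compose[OF u' h' c] A(1)])
  then show ?thesis
    unfolding C2_grad_def
    by (intro conjI has_grad_compose[OF u' h c']
        exI[of _ "\<lambda>i x. h' (u x) *\<^sub>R A i x + G x $ i *\<^sub>R (h'' (u x) *\<^sub>R G x)"])
      (auto simp: A(2) mult_ac)
qed

lemma C2_grad_inner_diff: "C2_grad (\<lambda>x. (x - y) \<bullet> (x - y)) (\<lambda>x. 2 *\<^sub>R (x - y))"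
  unfolding C2_grad_def
proof (intro conjI exI[of _ "\<lambda>i x. 2 *\<^sub>R axis i 1"] allI)
  have "((\<lambda>x. (x - y) \<bullet> (x - y)) has_derivative (\<lambda>h. (2 *\<^sub>R (x - y)) \<bullet> h)) (at x)" for x
    by (auto intro!: derivative_eq_intros simp: inner_commute)
  then show "has_grad (\<lambda>x. (x - y) \<bullet> (x - y)) (\<lambda>x. 2 *\<^sub>R (x - y))"
    by (auto simp: has_grad_def intro!: continuous_intros)
  show "has_grad (\<lambda>x. (2 *\<^sub>R (x - y)) $ i) (\<lambda>x. 2 *\<^sub>R axis i 1)" for i
    using has_grad_add[OF has_grad_cmult[OF has_grad_component[of i], of 2] has_grad_const[of "- 2 * y $ i"]]
    by (simp add: algebra_simps)
qed (simp add: axis_def)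

text \<open>A quarter turn exchanges tangent and normal. The normal component on the circle is
  therefore the derivative of \<open>u\<close> along the circle, and the flux through an arc is a
  difference of two values of \<open>u\<close>.\<close>

lemma C2_grad_rotated:
  assumes "C2_grad u G"
  defines "\<phi> \<equiv> \<lambda>x. vector [G x $ 2, - G x $ 1]"
  shows "C1 \<phi>" "divergence \<phi> x = 0" "norm (\<phi> x) = norm (G x)"
    "((\<lambda>t. u (circ t)) has_real_derivative \<phi> (circ t) \<bullet> circ t) (at t)"
proof -
  obtain A where A: "\<And>i. has_grad (\<lambda>x. G x $ i) (A i)" "\<And>x. A 1 x $ 2 = A 2 x $ 1"
    using assms(1) unfolding C2_grad_def by blast
  have \<phi>: "has_grad (\<lambda>x. \<phi> x $ i) (if i = 1 then A 2 else (\<lambda>x. - A 1 x))" for i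
    using exhaust_2[of i] A(1)[of 2] has_grad_cmult[OF A(1)[of 1], of "-1"]
    by (auto simp: \<phi>_def)
  show "C1 \<phi>" by (rule C1_vector[OF \<phi>])
  show "divergence \<phi> x = 0"
    using A(2)[of x] by (simp add: divergence_eq[OF \<phi>] UNIV_2)
  show "norm (\<phi> x) = norm (G x)"
    by (simp add: \<phi>_def norm_vec_def L2_set_def UNIV_2 add.commute)
  have "((\<lambda>t. circ t) has_derivative (\<lambda>h. (h * - sin t) *\<^sub>R axis 1 1 + (h * cos t) *\<^sub>R axis 2 1)) (at t)"
    unfolding vector2_eq by (auto intro!: derivative_eq_intros)
  from has_derivative_compose[OF this has_grad_derivative[OF C2_grad_has_grad[OF assms(1)]]]
  show "((\<lambda>t. u (circ t)) has_real_derivative \<phi> (circ t) \<bullet> circ t) (at t)"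
    unfolding has_field_derivative_def
    by (rule has_derivative_eq_rhs) (auto simp: fun_eq_iff \<phi>_def inner_vec_def UNIV_2 axis_def algebra_simps)
qed

text \<open>The function is \<open>- ln (\<Sum>i\<in>I. exp (- k * h i x)) / k\<close>. Its gradient
  is a convex combination of the gradients \<open>G i x\<close>, with weights proportional to the
  exponentials, so a common bound on their lengths is inherited. The value lies below the minimum by
  at most \<open>ln (card I) / k\<close>.\<close>

lemma soft_minimum:
  fixes h :: "'i \<Rightarrow> real^2 \<Rightarrow> real" and k :: real
  assumes I: "finite I" "I \<noteq> {}" and k: "k > 0" and h: "\<And>i. i \<in> I \<Longrightarrow> C2_grad (h i) (G i)"
  obtains u H where "C2_grad u H"
    "\<And>x B. (\<And>i. i \<in> I \<Longrightarrow> norm (G i x) \<le> B) \<Longrightarrow> norm (H x) \<le> B"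
    "\<And>x i. i \<in> I \<Longrightarrow> u x \<le> h i x"
    "\<And>x c. (\<And>i. i \<in> I \<Longrightarrow> c \<le> h i x) \<Longrightarrow> c - ln (card I) / k \<le> u x"
proof -
  define Z where "Z x = (\<Sum>i\<in>I. exp (- k * h i x))" for x
  define u where "u x = - (1 / k) * ln (Z x)" for x
  define H where "H x = (- (1 / k) * inverse (Z x)) *\<^sub>R (\<Sum>i\<in>I. (- k * exp (- k * h i x)) *\<^sub>R G i x)" for x
  have Z0: "Z x > 0" for x unfolding Z_def using I by (intro sum_pos) auto
  have "C2_grad Z (\<lambda>x. \<Sum>i\<in>I. (- k * exp (- k * h i x)) *\<^sub>R G i x)"
    unfolding Z_def
    by (intro C2_grad_sum C2_grad_compose[OF h, of _ "\<lambda>t. exp (- k * t)" "\<lambda>t. - k * exp (- k * t)" "\<lambda>t. k\<^sup>2 * exp (- k * t)"])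
      (auto intro!: derivative_eq_intros continuous_intros simp: power2_eq_square)
  then have "C2_grad u H"
    unfolding u_def H_def
    by (rule C2_grad_compose[of _ _ "\<lambda>t. - (1 / k) * ln t" "\<lambda>t. - (1 / k) * inverse t" "\<lambda>t. (1 / k) * inverse (t\<^sup>2)"])
      (use Z0 k in \<open>auto intro!: derivative_eq_intros continuous_intros simp: power2_eq_square field_simps less_imp_neq[symmetric]\<close>)
  moreover have "norm (H x) \<le> B" if B: "\<And>i. i \<in> I \<Longrightarrow> norm (G i x) \<le> B" for x B
  proof -
    have "H x = inverse (Z x) *\<^sub>R (\<Sum>i\<in>I. exp (- k * h i x) *\<^sub>R G i x)"
      unfolding H_def using k by (simp add: scaleR_sum_right)
    then have "norm (H x) = inverse (Z x) * norm (\<Sum>i\<in>I. exp (- k * h i x) *\<^sub>R G i x)"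
      using Z0[of x] by simp
    also have "\<dots> \<le> inverse (Z x) * (\<Sum>i\<in>I. exp (- k * h i x) * B)"
      using Z0[of x] B by (intro mult_left_mono sum_norm_le) auto
    also have "\<dots> = B" using Z0[of x] by (simp add: Z_def sum_distrib_right[symmetric])
    finally show ?thesis .
  qed
  moreover have "u x \<le> h i x" if i: "i \<in> I" for x i
  proof -
    have "exp (- k * h i x) \<le> Z x"
      unfolding Z_def using i I by (intro member_le_sum) auto
    then have "- k * h i x \<le> ln (Z x)" using Z0[of x] by (simp add: ln_ge_iff)
    then show ?thesis using k by (simp add: u_def field_simps)
  qed
  moreover have "c - ln (card I) / k \<le> u x" if c: "\<And>i. i \<in> I \<Longrightarrow> c \<le> h i x" for x c
  proof -
    have "Z x \<le> (\<Sum>i\<in>I. exp (- k * c))"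
      unfolding Z_def using c k by (intro sum_mono) auto
    then have "Z x \<le> card I * exp (- k * c)" by simp
    then have "ln (Z x) \<le> ln (card I * exp (- k * c))" using Z0[of x] by (intro ln_mono) auto
    also have "\<dots> = ln (card I) - k * c"
      using I by (subst ln_mult) (auto simp: card_gt_0_iff)
    finally have "(c * k - ln (card I)) / k \<le> - ln (Z x) / k"
      using k by (intro divide_right_mono) (auto simp: mult.commute)
    then show ?thesis using k by (simp add: u_def diff_divide_distrib)
  qed
  ultimately show ?thesis using that by blast
qed

section \<open>A concave modulus and the smoothed distance\<close>

definition bend :: "real \<Rightarrow> real" where
  "bend t = t / (1 + t)"

lemma bend_mono: "0 \<le> s \<Longrightarrow> s \<le> t \<Longrightarrow> bend s \<le> bend t"
  by (simp add: bend_def field_simps)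

lemma bend_le: "0 \<le> t \<Longrightarrow> bend t \<le> t"
  by (simp add: bend_def field_simps)

text \<open>Adding \<open>\<delta>^2\<close> under the root removes the singularity of the distance
  at \<open>y\<close>. The smoothed distance is at least \<open>norm (x - y)\<close> and has
  gradient of length at most 1, while \<open>bend\<close> has derivative
  \<open>1 / (1 + t)^2\<close>; hence a bound free of \<open>\<delta>\<close>.\<close>

lemma C2_grad_bend_distance:
  assumes "\<delta> > 0"
  obtains G where "C2_grad (\<lambda>x. c + bend (sqrt ((norm (x - y))\<^sup>2 + \<delta>\<^sup>2))) G"
    "\<And>x. norm (G x) \<le> 1 / (1 + norm (x - y))\<^sup>2"
proof -
  let ?q = "\<lambda>x. (x - y) \<bullet> (x - y)"
  define s where "s x = sqrt (?q x + \<delta>\<^sup>2)" for x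
  have q0: "?q x + \<delta>\<^sup>2 > 0" for x using assms by (simp add: add_nonneg_pos)
  have s0: "s x > 0" for x using q0 by (simp add: s_def)
  have d: "((\<lambda>t. sqrt (t + \<delta>\<^sup>2)) has_real_derivative inverse (2 * sqrt (t + \<delta>\<^sup>2))) (at t)"
    if "t + \<delta>\<^sup>2 > 0" for t
    using that by (auto intro!: derivative_eq_intros simp: inverse_eq_divide)
  have d': "((\<lambda>t. inverse (2 * sqrt (t + \<delta>\<^sup>2))) has_real_derivative
      - (inverse (2 * sqrt (t + \<delta>\<^sup>2)) * (2 * inverse (2 * sqrt (t + \<delta>\<^sup>2))) * inverse (2 * sqrt (t + \<delta>\<^sup>2)))) (at t)"
    if "t + \<delta>\<^sup>2 > 0" for t
    using that by (intro DERIV_inverse' DERIV_cmult d) auto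
  have s: "C2_grad s (\<lambda>x. inverse (2 * sqrt (?q x + \<delta>\<^sup>2)) *\<^sub>R (2 *\<^sub>R (x - y)))"
    unfolding s_def
    by (rule C2_grad_compose[OF C2_grad_inner_diff, where h = "\<lambda>t. sqrt (t + \<delta>\<^sup>2)",
          OF d[OF q0] d'[OF q0]])
      (use q0 in \<open>auto intro!: continuous_intros simp: less_imp_neq[symmetric]\<close>)
  let ?G = "\<lambda>x. inverse ((1 + s x)\<^sup>2) *\<^sub>R (inverse (2 * s x) *\<^sub>R (2 *\<^sub>R (x - y)))"
  have s1: "1 + s x \<noteq> 0" for x using s0[of x] by linarith
  have b: "(bend has_real_derivative inverse ((1 + t)\<^sup>2)) (at t)" if "1 + t \<noteq> 0" for t
    unfolding bend_def using that
    by (auto intro!: derivative_eq_intros simp: inverse_eq_divide power2_eq_square)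
  have b': "((\<lambda>t. inverse ((1 + t)\<^sup>2)) has_real_derivative
      - (inverse ((1 + t)\<^sup>2) * (2 * (1 + t)) * inverse ((1 + t)\<^sup>2))) (at t)" if "1 + t \<noteq> 0" for t :: real
    using that by (intro DERIV_inverse') (auto intro!: derivative_eq_intros)
  have "C2_grad (\<lambda>x. bend (s x)) ?G"
    using s0 by (intro C2_grad_compose[OF s[folded s_def], where h = bend, OF b[OF s1] b'[OF s1]])
      (use s1 in \<open>auto intro!: continuous_intros\<close>)
  then have "C2_grad (\<lambda>x. c + bend (s x)) ?G"
    using C2_grad_add[OF C2_grad_const] by fastforce
  moreover have "norm (?G x) \<le> 1 / (1 + norm (x - y))\<^sup>2" for x
  proof -
    have ns: "norm (x - y) \<le> s x"
      unfolding s_def by (rule real_le_rsqrt) (simp add: dot_square_norm)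
    have "\<bar>inverse ((1 + s x)\<^sup>2)\<bar> = inverse ((1 + s x)\<^sup>2)" by simp
    moreover have "\<bar>inverse (2 * w)\<bar> * (\<bar>2\<bar> * c) = c / w" if "w > 0" for w c :: real
      using that by (simp add: field_simps)
    ultimately have "norm (?G x) = inverse ((1 + s x)\<^sup>2) * (norm (x - y) / s x)"
      by (simp only: norm_scaleR s0)
    also have "\<dots> \<le> inverse ((1 + s x)\<^sup>2) * 1"
      using ns s0[of x] by (intro mult_left_mono) auto
    also have "\<dots> \<le> 1 / (1 + norm (x - y))\<^sup>2"
    proof -
      have "0 < (1 + norm (x - y))\<^sup>2" by (intro zero_less_power add_pos_nonneg) auto
      then show ?thesis
        unfolding inverse_eq_divide mult_1_right using ns by (intro frac_le power_mono) auto
    qed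
    finally show ?thesis .
  qed
  moreover have "s = (\<lambda>x. sqrt ((norm (x - y))\<^sup>2 + \<delta>\<^sup>2))"
    by (simp add: s_def fun_eq_iff dot_square_norm)
  ultimately show ?thesis using that by blast
qed

lemma norm_circ_diff: "norm (circ s - circ t) = 2 * \<bar>sin ((s - t) / 2)\<bar>"
proof -
  have "(norm (circ s - circ t))\<^sup>2 = (cos s - cos t)\<^sup>2 + (sin s - sin t)\<^sup>2"
    by (simp only: power2_norm_eq_inner) (simp add: inner_vec_def UNIV_2 power2_eq_square)
  also have "\<dots> = 2 - 2 * cos (s - t)"
    using sin_cos_squared_add[of s] sin_cos_squared_add[of t]
    by (simp add: cos_diff power2_diff algebra_simps)
  also have "\<dots> = (2 * \<bar>sin ((s - t) / 2)\<bar>)\<^sup>2"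
  proof -
    have "2 * ((s - t) / 2) = s - t" by simp
    then have "cos (s - t) = 1 - 2 * (sin ((s - t) / 2))\<^sup>2"
      using cos_double_sin[of "(s - t) / 2"] by metis
    then show ?thesis by (simp only: power_mult_distrib power2_abs) simp
  qed
  finally show ?thesis by (rule power2_eq_imp_eq) auto
qed

lemma norm_circ_diff_le: "norm (circ s - circ t) \<le> \<bar>s - t\<bar>"
  using abs_sin_x_le_abs_x[of "(s - t) / 2"] by (simp add: norm_circ_diff)

text \<open>The allowance \<open>2 * d^2\<close>, with \<open>d = t - s\<close>, is spent in two
  equal parts: the chord is at least \<open>d - d^2\<close>, and since
  \<open>r - bend r \<le> r^2\<close>, passing to \<open>bend\<close> loses at most another
  \<open>d^2\<close>. This matches the loss built into the fat closed set.\<close>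

lemma bend_norm_circ_diff:
  assumes "0 \<le> t - s" "t - s \<le> 1"
  shows "(t - s) - 2 * (t - s)\<^sup>2 \<le> bend (norm (circ t - circ s))"
proof -
  define d where "d = t - s"
  have d: "0 \<le> d" "d \<le> 1" using assms by (auto simp: d_def)
  have "\<bar>sin (d / 2) - (\<Sum>m<3. sin_coeff m * (d / 2) ^ m)\<bar> \<le> inverse (fact 3) * \<bar>d / 2\<bar> ^ 3"
    by (rule Maclaurin_sin_bound)
  moreover have "(\<Sum>m<3. sin_coeff m * (d / 2) ^ m) = d / 2"
    by (simp add: sin_coeff_def numeral_3_eq_3)
  moreover have "inverse (fact 3) * \<bar>d / 2\<bar> ^ 3 = d ^ 3 / 48"
    using d by (simp add: fact_numeral power_divide)
  moreover have "d ^ 3 \<le> d\<^sup>2" using power_decreasing[of 2 3 d] d by simp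
  ultimately have "sin (d / 2) \<ge> d / 2 - d\<^sup>2 / 48" by linarith
  then have "norm (circ t - circ s) \<ge> d - d\<^sup>2 / 24"
    unfolding norm_circ_diff d_def[symmetric] by linarith
  then have le: "d - d\<^sup>2 \<le> norm (circ t - circ s)" using zero_le_power2[of d] by linarith
  have 0: "0 \<le> d - d\<^sup>2" using d by (simp add: power2_eq_square mult_left_le)
  have "(d - 2 * d\<^sup>2) * (1 + (d - d\<^sup>2)) \<le> d - d\<^sup>2"
  proof -
    have "(d - d\<^sup>2) - (d - 2 * d\<^sup>2) * (1 + (d - d\<^sup>2)) = d ^ 3 * (1 + 2 * (1 - d))"
      by (simp add: algebra_simps power2_eq_square power3_eq_cube)
    also have "\<dots> \<ge> 0" using d by (intro mult_nonneg_nonneg) auto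
    finally show ?thesis by simp
  qed
  then have "d - 2 * d\<^sup>2 \<le> bend (d - d\<^sup>2)"
    using 0 by (simp add: bend_def pos_le_divide_eq)
  also have "\<dots> \<le> bend (norm (circ t - circ s))" by (rule bend_mono[OF 0 le])
  finally show ?thesis by (simp add: d_def)
qed

text \<open>A smoothed McShane extension. Since \<open>bend\<close> has slope less than 1 away from 0, the gradient
  is shorter than 1 away from the arc that carries the data.\<close>

lemma smooth_extension_from_arc:
  fixes g :: "real \<Rightarrow> real"
  assumes mono: "\<And>s t. 0 \<le> s \<Longrightarrow> s \<le> t \<Longrightarrow> t \<le> \<tau> \<Longrightarrow> g s \<le> g t"
    and lip: "\<And>s t. 0 \<le> s \<Longrightarrow> s \<le> t \<Longrightarrow> t \<le> \<tau> \<Longrightarrow> g t - g s \<le> bend (norm (circ t - circ s))"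
    and \<tau>: "0 < \<tau>" "\<tau> \<le> 1" and n: "n > 0"
  obtains u H where "C2_grad u H" "\<And>x. norm (H x) \<le> 1"
    "\<And>x. norm x \<le> 1 \<Longrightarrow> norm (H x) \<le> 1 / (2 - norm x)\<^sup>2"
    "\<And>t. 0 \<le> t \<Longrightarrow> t \<le> \<tau> \<Longrightarrow> \<bar>u (circ t) - g t\<bar> \<le> 2 / real n + ln (real (Suc n)) / real n"
proof -
  \<comment> \<open>The error budget: smoothing the distance costs \<open>1 / n\<close>, replacing
    \<open>t\<close> by the preceding grid point costs at most \<open>1 / n\<close>, and the soft
    minimum over \<open>n + 1\<close> functions with parameter \<open>n\<close> costs
    \<open>ln (n + 1) / n\<close>.\<close>
  define \<delta> where "\<delta> = 1 / real n"
  have \<delta>: "\<delta> > 0" using n by (simp add: \<delta>_def)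
  define a where "a i = \<tau> * real i / real n" for i
  have a: "0 \<le> a i" "a i \<le> \<tau>" if "i \<in> {..n}" for i
    using that \<tau> n by (auto simp: a_def field_simps)
  define h where "h i x = g (a i) + bend (sqrt ((norm (x - circ (a i)))\<^sup>2 + \<delta>\<^sup>2))" for i x
  have "\<forall>i. \<exists>G. C2_grad (h i) G \<and> (\<forall>x. norm (G x) \<le> 1 / (1 + norm (x - circ (a i)))\<^sup>2)"
    unfolding h_def using C2_grad_bend_distance[OF \<delta>] by metis
  then obtain G where G: "\<And>i. C2_grad (h i) (G i)"
      "\<And>i x. norm (G i x) \<le> 1 / (1 + norm (x - circ (a i)))\<^sup>2"
    by metis
  obtain u H where u: "C2_grad u H"
    "\<And>x B. (\<And>i. i \<in> {..n} \<Longrightarrow> norm (G i x) \<le> B) \<Longrightarrow> norm (H x) \<le> B"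
    "\<And>x i. i \<in> {..n} \<Longrightarrow> u x \<le> h i x"
    "\<And>x c. (\<And>i. i \<in> {..n} \<Longrightarrow> c \<le> h i x) \<Longrightarrow> c - ln (card {..n}) / real n \<le> u x"
    using soft_minimum[of "{..n}" "real n" h G] n G(1) by auto
  have 1: "norm (H x) \<le> 1" for x
  proof (rule u(2))
    fix i
    have "1 / (1 + norm (x - circ (a i)))\<^sup>2 \<le> 1"
      using one_le_power[of "1 + norm (x - circ (a i))" 2] by (simp add: divide_le_eq_1)
    then show "norm (G i x) \<le> 1" using G(2) order_trans by blast
  qed
  have 2: "norm (H x) \<le> 1 / (2 - norm x)\<^sup>2" if x: "norm x \<le> 1" for x
  proof (rule u(2))
    fix i
    \<comment> \<open>All centres lie on the circle, so a point of the disk keeps at least the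
      distance \<open>1 - norm x\<close> from each of them, uniformly in \<open>n\<close>.\<close>
    have "1 - norm x \<le> norm (x - circ (a i))"
      using norm_triangle_ineq2[of "circ (a i)" x] by (simp add: circ_in_sphere norm_minus_commute)
    then have "1 / (1 + norm (x - circ (a i)))\<^sup>2 \<le> 1 / (2 - norm x)\<^sup>2"
      using x by (intro frac_le power_mono) auto
    then show "norm (G i x) \<le> 1 / (2 - norm x)\<^sup>2" using G(2) order_trans by blast
  qed
  have 3: "\<bar>u (circ t) - g t\<bar> \<le> 2 / real n + ln (real (Suc n)) / real n" if t: "0 \<le> t" "t \<le> \<tau>" for t
  proof -
    define i where "i = nat \<lfloor>t * n / \<tau>\<rfloor>"
    have fl: "real i = of_int \<lfloor>t * n / \<tau>\<rfloor>" unfolding i_def using t \<tau> by simp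
    have "t * n \<le> \<tau> * n" using t by (intro mult_right_mono) auto
    then have tn: "t * n / \<tau> \<le> n" using \<tau> by (simp add: pos_divide_le_eq mult.commute)
    have i: "real i \<le> t * n / \<tau>" "t * n / \<tau> < real i + 1" unfolding fl by linarith+
    have iN: "i \<in> {..n}" using i(1) tn by simp
    have ai: "a i \<le> t" "t - a i \<le> 1 / n"
    proof -
      show "a i \<le> t" using i(1) \<tau> n by (simp add: a_def field_simps)
      have "t * n \<le> \<tau> * real i + \<tau>" using i(2) \<tau> by (simp add: pos_divide_less_eq algebra_simps)
      then have "t * n / n \<le> (\<tau> * real i + \<tau>) / n" by (rule divide_right_mono) simp
      then have "t - a i \<le> \<tau> / n" using n by (simp add: a_def add_divide_distrib)
      also have "\<dots> \<le> 1 / n" using \<tau> by (simp add: divide_right_mono)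
      finally show "t - a i \<le> 1 / n" .
    qed
    have "u (circ t) \<le> h i (circ t)" by (rule u(3)[OF iN])
    also have "\<dots> \<le> g t + sqrt ((norm (circ t - circ (a i)))\<^sup>2 + \<delta>\<^sup>2)"
      unfolding h_def using mono[OF a(1)[OF iN] ai(1) t(2)] by (intro add_mono bend_le) auto
    also have "sqrt ((norm (circ t - circ (a i)))\<^sup>2 + \<delta>\<^sup>2) \<le> norm (circ t - circ (a i)) + \<delta>"
      using \<delta> by (intro sqrt_sum_squares_le_sum) auto
    also have "norm (circ t - circ (a i)) \<le> 1 / n"
      using norm_circ_diff_le[of t "a i"] ai by linarith
    finally have up: "u (circ t) \<le> g t + 2 / n" by (simp add: \<delta>_def)
    have "g t \<le> h j (circ t)" if j: "j \<in> {..n}" for j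
    proof -
      have "g t - g (a j) \<le> bend (norm (circ t - circ (a j)))"
      proof (cases "a j \<le> t")
        case True
        then show ?thesis using lip a[OF j] t by blast
      next
        \<comment> \<open>For a centre beyond \<open>t\<close> monotonicity of \<open>g\<close>
          makes the left side nonpositive, so the modulus condition is wanted in one direction
          only.\<close>
        case False
        then have "g t - g (a j) \<le> 0" using mono[of t "a j"] a[OF j] t by simp
        also have "0 \<le> bend (norm (circ t - circ (a j)))" by (simp add: bend_def)
        finally show ?thesis .
      qed
      also have "\<dots> \<le> bend (sqrt ((norm (circ t - circ (a j)))\<^sup>2 + \<delta>\<^sup>2))"
        by (intro bend_mono real_le_rsqrt) auto
      finally show ?thesis by (simp add: h_def)
    qed
    from u(4)[OF this] have "g t - ln (real (Suc n)) / n \<le> u (circ t)" by simp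
    moreover have "0 \<le> ln (real (Suc n)) / n" by (auto intro!: divide_nonneg_nonneg)
    ultimately show ?thesis using up by (simp add: abs_le_iff add_increasing add_increasing2)
  qed
  show ?thesis by (rule that[OF u(1) 1 2 3])
qed

section \<open>Strict lower bound for competitors\<close>

lemma set_integral_abs_le_measure:
  fixes f :: "'a \<Rightarrow> real"
  assumes A: "A \<in> fmeasurable M" and f: "f \<in> borel_measurable M" "\<And>x. \<bar>f x\<bar> \<le> 1"
  shows "set_integrable M A f" "\<bar>LINT x:A|M. f x\<bar> \<le> measure M A"
proof -
  have 1: "integrable M (indicat_real A)"
    using A by (simp add: fmeasurable_def)
  have [measurable]: "A \<in> sets M" using A by auto
  show i: "set_integrable M A f"
    unfolding set_integrable_def
    by (rule Bochner_Integration.integrable_bound[OF 1]) (use f in \<open>auto split: split_indicator\<close>)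
  have "\<bar>LINT x:A|M. f x\<bar> \<le> (\<integral>x. \<bar>indicator A x * f x\<bar> \<partial>M)"
    unfolding set_lebesgue_integral_def by (simp add: integral_abs_bound)
  also have "\<dots> \<le> (\<integral>x. indicator A x \<partial>M)"
    by (rule integral_mono) (use i 1 f in \<open>auto simp: set_integrable_def split: split_indicator\<close>)
  also have "\<dots> = measure M A" by simp
  finally show "\<bar>LINT x:A|M. f x\<bar> \<le> measure M A" .
qed

text \<open>Dynkin's pi-lambda argument, with half-lines as the pi-system. For a disjoint union the
  uniform bound 1 dominates each term by the measure of its piece, and Tannery's theorem
  interchanges limit and sum. It turns uniform convergence of potentials into convergence of the
  fluxes through an arbitrary Borel part of the arc.\<close>

lemma weak_limit_of_initial_integrals:
  fixes f :: "nat \<Rightarrow> real \<Rightarrow> real" and g :: "real \<Rightarrow> real"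
  assumes f: "\<And>n. f n \<in> borel_measurable borel" "\<And>n t. \<bar>f n t\<bar> \<le> 1"
    and g: "g \<in> borel_measurable borel" "\<And>t. \<bar>g t\<bar> \<le> 1"
    and lim: "\<And>x. x \<le> a \<Longrightarrow> (\<lambda>n. LINT t:{0..x}|lborel. f n t) \<longlonglongrightarrow> (LINT t:{0..x}|lborel. g t)"
    and E: "E \<in> sets borel"
  shows "(\<lambda>n. LINT t:({0..a} \<inter> E)|lborel. f n t) \<longlonglongrightarrow> (LINT t:({0..a} \<inter> E)|lborel. g t)"
proof -
  let ?G = "range (\<lambda>x::real. {..x})"
  let ?P = "\<lambda>E. (\<lambda>n. LINT t:({0..a} \<inter> E)|lborel. f n t) \<longlonglongrightarrow> (LINT t:({0..a} \<inter> E)|lborel. g t)"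
  have fm: "{0..a} \<inter> A \<in> fmeasurable lborel" if "A \<in> sets borel" for A
    using fmeasurable_Int_fmeasurable[OF fmeasurable_compact[OF compact_Icc, of 0 a]] that by simp
  have bf: "set_integrable lborel ({0..a} \<inter> A) (f n)" "\<bar>LINT t:({0..a} \<inter> A)|lborel. f n t\<bar> \<le> measure lborel ({0..a} \<inter> A)"
    if "A \<in> sets borel" for A n
    using set_integral_abs_le_measure[OF fm[OF that], of "f n"] f by simp_all
  have bg: "set_integrable lborel ({0..a} \<inter> A) g" if "A \<in> sets borel" for A
    using set_integral_abs_le_measure(1)[OF fm[OF that], of g] g by simp
  have eq: "sets borel = sigma_sets UNIV ?G"
    by (subst borel_eq_atMost) simp
  have E': "E \<in> sigma_sets UNIV ?G" using E eq by simp
  show ?thesis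
  proof (rule sigma_sets_induct_disjoint[of ?G UNIV E ?P])
    show "Int_stable ?G"
      unfolding Int_stable_def
    proof safe
      fix x y :: real
      have "{..x} \<inter> {..y} = {..min x y}" by auto
      then show "{..x} \<inter> {..y} \<in> ?G" by blast
    qed
    show basic: "?P A" if "A \<in> ?G" for A
    proof -
      obtain x where x: "A = {..x}" using \<open>A \<in> ?G\<close> by blast
      have "{0..a} \<inter> A = {0..min a x}" unfolding x by auto
      then show ?thesis using lim[of "min a x"] by simp
    qed
    show "?P {}" by (simp add: set_lebesgue_integral_def)
    show "?P (UNIV - A)" if A: "A \<in> sigma_sets UNIV ?G" "?P A" for A
    proof -
      have Ab1: "A \<in> sets borel" using A(1) by (simp only: eq)
      have Ab: "A \<in> sets borel" "UNIV - A \<in> sets borel"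
        using Ab1 sets.compl_sets[OF Ab1] by (simp_all only: space_borel)
      have sp: "(LINT t:{0..a}|lborel. h t) = (LINT t:({0..a} \<inter> A)|lborel. h t) + (LINT t:({0..a} \<inter> (UNIV - A))|lborel. h t)"
        if "set_integrable lborel ({0..a} \<inter> A) h" "set_integrable lborel ({0..a} \<inter> (UNIV - A)) h" for h :: "real \<Rightarrow> real"
      proof -
        have "(LINT t:({0..a} \<inter> A \<union> {0..a} \<inter> (UNIV - A))|lborel. h t) = (LINT t:({0..a} \<inter> A)|lborel. h t) + (LINT t:({0..a} \<inter> (UNIV - A))|lborel. h t)"
          by (rule set_integral_Un[OF _ that]) auto
        moreover have "{0..a} \<inter> A \<union> {0..a} \<inter> (UNIV - A) = {0..a}" by auto
        ultimately show ?thesis by (simp only:)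
      qed
      have "(\<lambda>n. (LINT t:{0..a}|lborel. f n t) - (LINT t:({0..a} \<inter> A)|lborel. f n t))
        \<longlonglongrightarrow> (LINT t:{0..a}|lborel. g t) - (LINT t:({0..a} \<inter> A)|lborel. g t)"
        by (intro tendsto_diff A lim) simp
      then show ?thesis
        unfolding sp[OF bf(1)[OF Ab(1)] bf(1)[OF Ab(2)]] sp[OF bg[OF Ab(1)] bg[OF Ab(2)]] by simp
    qed
    show "?P (\<Union> (range A))" if A: "disjoint_family A" "range A \<subseteq> sigma_sets UNIV ?G" "\<And>i. ?P (A i)"
      for A :: "nat \<Rightarrow> real set"
    proof -
      have Ab: "A i \<in> sets borel" for i using A(2) unfolding eq by blast
      have Ub: "(\<Union>i. A i) \<in> sets borel" by (rule sets.countable_UN) (use Ab in blast)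
      have U: "{0..a} \<inter> \<Union> (range A) = (\<Union>i. {0..a} \<inter> A i)" by auto
      have dj: "({0..a} \<inter> A i) \<inter> ({0..a} \<inter> A j) = {}" if "i \<noteq> j" for i j
        using disjoint_family_onD[OF A(1) _ _ that] by auto
      have dj': "disjoint_family (\<lambda>i. {0..a} \<inter> A i)" using dj by (auto simp: disjoint_family_on_def)
      have cs: "(LINT t:(\<Union>i. {0..a} \<inter> A i)|lborel. h t) = (\<Sum>i. LINT t:({0..a} \<inter> A i)|lborel. h t)"
        if "set_integrable lborel ({0..a} \<inter> \<Union> (range A)) h" for h :: "real \<Rightarrow> real"
      proof (rule lebesgue_integral_countable_add[OF _ dj])
        show "{0..a} \<inter> A i \<in> sets lborel" for i using Ab[of i] by simp
        show "set_integrable lborel (\<Union>i. {0..a} \<inter> A i) h" using that unfolding U .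
      qed
      have fin: "emeasure lborel (\<Union>i. {0..a} \<inter> A i) \<noteq> \<infinity>"
        using fmeasurableD2[OF fm[OF Ub]] unfolding U by simp
      have "range (\<lambda>i. {0..a} \<inter> A i) \<subseteq> sets lborel" using Ab by auto
      then have "summable (\<lambda>i. measure lborel ({0..a} \<inter> A i))"
        using sums_summable[OF measure_UNION[OF _ dj' fin]] by blast
      then have "(\<lambda>n. \<Sum>i. LINT t:({0..a} \<inter> A i)|lborel. f n t) \<longlonglongrightarrow> (\<Sum>i. LINT t:({0..a} \<inter> A i)|lborel. g t)"
        by (intro tannerys_theorem[THEN conjunct2, THEN conjunct2, OF A(3) always_eventually])
          (use bf(2)[OF Ab] in auto)
      then show ?thesis
        unfolding U cs[OF bf(1)[OF Ub]] cs[OF bg[OF Ub]] .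
    qed
  qed (use E' in auto)
qed

lemma circ_inj:
  assumes "circ s = circ t" "s \<in> {0..<2 * pi}" "t \<in> {0..<2 * pi}"
  shows "s = t"
proof -
  have "sin ((s - t) / 2) = 0" using norm_circ_diff[of s t] assms(1) by simp
  then have "(s - t) / 2 = 0" by (rule sin_eq_0_pi[rotated 2]) (use assms(2,3) in auto)
  then show ?thesis by simp
qed

lemma circ_mem_image_iff:
  assumes "K \<subseteq> {0..1/256}" "t \<in> {0..<2 * pi}"
  shows "circ t \<in> circ ` K \<longleftrightarrow> t \<in> K"
proof
  assume "circ t \<in> circ ` K"
  then obtain s where s: "s \<in> K" "circ t = circ s" by auto
  have "s \<in> {0..<2 * pi}" using s(1) assms(1) pi_gt3 by force
  then have "t = s" using circ_inj[OF s(2)] assms by blast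
  then show "t \<in> K" using s by simp
qed auto

lemma compact_circ_image: "compact K \<Longrightarrow> compact (circ ` K)"
  by (rule compact_continuous_image) (auto intro!: continuous_intros)

lemma BV_has_distr_gradient:
  assumes "BV w"
  shows "has_distr_gradient w (distr_gradient w)"
proof -
  have "\<exists>\<nu>. has_distr_gradient w \<nu>" using assms by (simp add: BV_def)
  then show ?thesis unfolding distr_gradient_def by (rule someI_ex)
qed

text \<open>The levels of \<open>k\<close> cut the disk into countably many rings, the ring
  \<open>k x = n\<close> having norm at most \<open>1 - 1 / (n + 1)\<close>, so that each lies in a
  disk of radius less than 1.\<close>

lemma vector_measure_eq_zeroI:
  assumes vm: "vector_measure \<nu>"
    and z: "\<And>\<rho> E. \<rho> < 1 \<Longrightarrow> E \<in> sets disk_borel \<Longrightarrow> E \<subseteq> cball 0 \<rho> \<Longrightarrow> \<nu> E = 0"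
    and E: "E \<in> sets disk_borel"
  shows "\<nu> E = 0"
proof -
  define k where "k x = nat \<lfloor>1 / (1 - norm x)\<rfloor>" for x :: "real^2"
  have ED: "E \<subseteq> disk" using sets.sets_into_space[OF E] by (simp add: space_restrict_space)
  have "k \<in> measurable disk_borel (count_space UNIV)"
    unfolding k_def by (intro measurable_restrict_space1) measurable
  then have "k -` {n} \<inter> space disk_borel \<in> sets disk_borel" for n by (rule measurable_sets) simp
  then have "E \<inter> (k -` {n} \<inter> space disk_borel) \<in> sets disk_borel" for n using E by blast
  moreover have "E \<inter> (k -` {n} \<inter> space disk_borel) = {x\<in>E. k x = n}" for n
    using ED by (auto simp: space_restrict_space)
  ultimately have mA: "{x\<in>E. k x = n} \<in> sets disk_borel" for n by simp
  have zA: "\<nu> {x\<in>E. k x = n} = 0" for n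
  proof (rule z[OF _ mA])
    show "1 - 1 / (real n + 1) < 1" by simp
    show "{x\<in>E. k x = n} \<subseteq> cball 0 (1 - 1 / (real n + 1))"
    proof safe
      fix x assume x: "x \<in> E" "n = k x"
      have p: "1 - norm x > 0" using x ED by auto
      have "1 / (1 - norm x) < real (k x) + 1" unfolding k_def using p by linarith
      then have "1 / (real (k x) + 1) < 1 - norm x" using p by (simp add: field_simps)
      then show "x \<in> cball 0 (1 - 1 / (real (k x) + 1))" by simp
    qed
  qed
  have "(\<lambda>n. \<nu> {x\<in>E. k x = n}) sums \<nu> (\<Union>n. {x\<in>E. k x = n})"
    using vm unfolding vector_measure_def
    by (rule allE[of _ "\<lambda>n. {x\<in>E. k x = n}"]) (use mA in \<open>auto simp: disjoint_family_on_def\<close>)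
  moreover have "(\<Union>n. {x\<in>E. k x = n}) = E" by auto
  ultimately have "(\<lambda>n. 0) sums \<nu> E" by (simp only: zA)
  then show ?thesis using sums_unique2 sums_zero by blast
qed

text \<open>The argument by contradiction avoids quantifying the gap. If the variation were at most
  \<open>?\<kappa>\<close>, fluxes tending to \<open>?\<kappa>\<close> would leave no room for the
  surplus \<open>\<delta> * norm (\<nu> E)\<close> in \<open>vector_integral_le_variation\<close>;
  then \<open>\<nu>\<close> vanishes on every smaller disk and hence altogether.\<close>

lemma calibrated_lower_bound:
  assumes K: "compact K" "K \<subseteq> {0..1/256}" "measure lborel K > 0"
    and fat: "\<And>s t. 0 \<le> s \<Longrightarrow> s \<le> t \<Longrightarrow> t \<le> 1/256 \<Longrightarrow> measure lborel (K \<inter> {s..t}) \<le> (t - s) - 2 * (t - s)\<^sup>2"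
    and w: "BV w" "has_trace w (indicator (circ ` K))"
  shows "ennreal (measure lborel K) < total_variation w"
proof (rule ccontr)
  let ?\<kappa> = "measure lborel K"
  define \<nu> where "\<nu> = distr_gradient w"
  assume "\<not> ?thesis"
  then have V: "variation \<nu> disk \<le> ennreal ?\<kappa>" by (simp add: total_variation_def \<nu>_def)
  have vm: "vector_measure \<nu>"
    using BV_has_distr_gradient[OF w(1)] by (simp add: has_distr_gradient_def \<nu>_def)
  have Kb[measurable]: "K \<in> sets borel" using K(1) by (simp add: borel_compact)
  have Kf: "K \<inter> A \<in> fmeasurable lborel" if "A \<in> sets borel" for A
    using fmeasurable_Int_fmeasurable[OF fmeasurable_compact[OF K(1)]] that by simp
  define g where "g t = measure lborel (K \<inter> {0..t})" for t
  have gd: "g s \<le> g t" "g t - g s \<le> measure lborel (K \<inter> {s..t})" if "0 \<le> s" "s \<le> t" for s t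
  proof -
    show "g s \<le> g t"
      unfolding g_def using that by (intro measure_mono_fmeasurable Kf) auto
    have "K \<inter> {0..t} = K \<inter> {0..s} \<union> K \<inter> {s..t}" using that by auto
    then have "g t \<le> g s + measure lborel (K \<inter> {s..t})"
      unfolding g_def using measure_Un_le[of "K \<inter> {0..s}" lborel "K \<inter> {s..t}"] by simp
    then show "g t - g s \<le> measure lborel (K \<inter> {s..t})" by simp
  qed
  have lip: "g t - g s \<le> bend (norm (circ t - circ s))" if st: "0 \<le> s" "s \<le> t" "t \<le> 1/256" for s t
    using gd(2)[OF st(1,2)] fat[OF st] bend_norm_circ_diff[of t s] st by linarith
  define Q where "Q n u H \<longleftrightarrow> C2_grad u H \<and> (\<forall>x. norm (H x) \<le> 1)
      \<and> (\<forall>x. norm x \<le> 1 \<longrightarrow> norm (H x) \<le> 1 / (2 - norm x)\<^sup>2)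
      \<and> (\<forall>t. 0 \<le> t \<and> t \<le> 1/256 \<longrightarrow> \<bar>u (circ t) - g t\<bar> \<le> 2 / real (Suc n) + ln (real (Suc (Suc n))) / real (Suc n))"
    for n u H
  have "\<exists>u H. Q n u H" for n
  proof (rule smooth_extension_from_arc[of "1/256" g "Suc n", OF gd(1) lip])
    fix u H
    assume "C2_grad u H" "\<And>x. norm (H x) \<le> 1" "\<And>x. norm x \<le> 1 \<Longrightarrow> norm (H x) \<le> 1 / (2 - norm x)\<^sup>2"
      "\<And>t. 0 \<le> t \<Longrightarrow> t \<le> 1/256 \<Longrightarrow> \<bar>u (circ t) - g t\<bar> \<le> 2 / real (Suc n) + ln (real (Suc (Suc n))) / real (Suc n)"
    then have "Q n u H" unfolding Q_def by blast
    then show "\<exists>u H. Q n u H" by blast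
  qed simp_all
  then obtain u H where "\<And>n. Q n (u n) (H n)" by metis
  then have u: "\<And>n. C2_grad (u n) (H n)" "\<And>n x. norm (H n x) \<le> 1"
    "\<And>n x. norm x \<le> 1 \<Longrightarrow> norm (H n x) \<le> 1 / (2 - norm x)\<^sup>2"
    "\<And>n t. 0 \<le> t \<Longrightarrow> t \<le> 1/256 \<Longrightarrow> \<bar>u n (circ t) - g t\<bar> \<le> 2 / real (Suc n) + ln (real (Suc (Suc n))) / real (Suc n)"
    unfolding Q_def by blast+
  define \<phi> where "\<phi> n x = (vector [H n x $ 2, - H n x $ 1] :: real^2)" for n x
  note rot = C2_grad_rotated[OF u(1), folded \<phi>_def]
  have \<phi>c: "continuous_on S (\<phi> n)" for n S by (rule C1_continuous_vec[OF rot(1)])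
  define U' where "U' n t = \<phi> n (circ t) \<bullet> circ t" for n t
  have U'c: "continuous_on UNIV (U' n)" for n
    unfolding U'_def by (intro continuous_intros continuous_on_compose2[OF \<phi>c[of UNIV]]) auto
  have U'm[measurable]: "U' n \<in> borel_measurable borel" for n
    by (rule borel_measurable_continuous_onI[OF U'c])
  have U'1: "\<bar>U' n t\<bar> \<le> 1" for n t
    using Cauchy_Schwarz_ineq2[of "\<phi> n (circ t)" "circ t"] u(2)[of n "circ t"]
    by (simp add: U'_def circ_in_sphere rot(3))
  \<comment> \<open>As the field is divergence free, Gauss-Green equates the action of
    \<open>\<nu>\<close> on it with its flux through the datum, an integral over \<open>K\<close> of
    the tangential derivative \<open>U' n\<close>.\<close>
  have flux: "vector_integral \<nu> (\<phi> n) = (LINT t:({0..1/256} \<inter> K)|lborel. U' n t)" for n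
  proof -
    have [measurable]: "circ ` K \<in> sets borel" using compact_circ_image[OF K(1)] by (simp add: borel_compact)
    have [measurable]: "\<phi> n \<in> borel_measurable borel" by (rule borel_measurable_continuous_onI[OF \<phi>c])
    have "(LINT x|lebesgue_on disk. w x * divergence (\<phi> n) x)
        = - vector_integral \<nu> (\<phi> n) + (LINT x|circle_measure. (\<phi> n x \<bullet> x) * indicator (circ ` K) x)"
      using w(2) rot(1)[of n] unfolding has_trace_def \<nu>_def by blast
    then have "vector_integral \<nu> (\<phi> n) = (LINT x|circle_measure. (\<phi> n x \<bullet> x) * indicator (circ ` K) x)" by (simp add: rot(2))
    also have "\<dots> = (LINT t:{0..<2 * pi}|lborel. U' n t * indicator (circ ` K) (circ t))"
      unfolding U'_def by (rule integral_circle_measure(1)) measurable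
    also have "\<dots> = (LINT t:({0..1/256} \<inter> K)|lborel. U' n t)"
      unfolding set_lebesgue_integral_def
    proof (rule Bochner_Integration.integral_cong[OF refl])
      fix t :: real
      show "indicator {0..<2 * pi} t *\<^sub>R (U' n t * indicator (circ ` K) (circ t)) = indicator ({0..1/256} \<inter> K) t *\<^sub>R U' n t"
      proof (cases "t \<in> {0..<2 * pi}")
        case True
        then show ?thesis using circ_mem_image_iff[OF K(2) True] K(2) by (auto split: split_indicator)
      next
        case False
        then have "t \<notin> {0..1/256} \<inter> K" using pi_gt3 by auto
        then show ?thesis using False by simp
      qed
    qed
    finally show ?thesis .
  qed
  have lim: "(\<lambda>n. vector_integral \<nu> (\<phi> n)) \<longlonglongrightarrow> ?\<kappa>"
  proof -
    have err: "(\<lambda>n. 2 / real (Suc n) + ln (real (Suc (Suc n))) / real (Suc n)) \<longlonglongrightarrow> 0"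
    proof -
      have 1: "(\<lambda>n. 2 / real (Suc n)) \<longlonglongrightarrow> 0"
        using tendsto_mult_left[OF LIMSEQ_inverse_real_of_nat, of 2] by (simp add: divide_inverse)
      have le: "ln (real (n + 2)) / real (Suc n) \<le> 2 * (ln (real (n + 2)) / real (n + 2))" for n
      proof -
        have "ln (real (n + 2)) * real (n + 2) \<le> ln (real (n + 2)) * (2 * real (Suc n))"
          by (intro mult_left_mono) auto
        then show ?thesis by (simp add: field_simps)
      qed
      have "(\<lambda>n. 2 * (ln (real (n + 2)) / real (n + 2))) \<longlonglongrightarrow> 2 * 0"
        by (intro tendsto_mult_left LIMSEQ_ignore_initial_segment[OF lim_ln_over_n])
      then have "(\<lambda>n. ln (real (n + 2)) / real (Suc n)) \<longlonglongrightarrow> 0"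
        by (intro tendsto_sandwich[OF _ always_eventually[OF allI[OF le]] tendsto_const]) auto
      then show ?thesis using tendsto_add[OF 1] by simp
    qed
    have ug: "(\<lambda>n. u n (circ t)) \<longlonglongrightarrow> g t" if "0 \<le> t" "t \<le> 1/256" for t
    proof -
      have "(\<lambda>n. u n (circ t) - g t) \<longlonglongrightarrow> 0"
        by (rule tendsto_rabs_zero_cancel, rule tendsto_sandwich[OF _ _ tendsto_const err])
          (use u(4)[OF that] in auto)
      then show ?thesis by (rule LIM_zero_cancel)
    qed
    \<comment> \<open>Over an initial interval the integral of the tangential derivative is an
      increment of the potential, for which pointwise convergence to \<open>g\<close> is
      known.\<close>
    have init: "(\<lambda>n. LINT t:{0..x}|lborel. U' n t) \<longlonglongrightarrow> (LINT t:{0..x}|lborel. indicator K t)"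
      if x: "x \<le> 1/256" for x
    proof (cases "0 \<le> x")
      case True
      have e1: "(LINT t:{0..x}|lborel. U' n t) = u n (circ x) - u n (circ 0)" for n
        unfolding set_lebesgue_integral_def
        by (rule integral_FTC_Icc[OF True])
          (use rot(4) U'c continuous_on_subset[OF U'c] in \<open>auto simp: U'_def has_real_derivative_iff_has_vector_derivative[symmetric] intro: DERIV_subset\<close>)
      have e2: "(LINT t:{0..x}|lborel. indicator K t) = g x - g 0"
      proof -
        have "g 0 \<le> measure lborel {0::real}"
          unfolding g_def by (intro measure_mono_fmeasurable fmeasurable_compact) auto
        then have "g 0 \<le> 0" by simp
        then have "g 0 = 0" by (rule antisym) (simp only: g_def measure_nonneg)
        moreover have "(LINT t:{0..x}|lborel. indicator K t) = g x"
          by (simp add: set_lebesgue_integral_def g_def indicator_inter_arith[symmetric] Int_commute)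
        ultimately show ?thesis by simp
      qed
      show ?thesis unfolding e1 e2 by (intro tendsto_diff ug) (use x True in simp_all)
    next
      case False
      then show ?thesis by (simp add: set_lebesgue_integral_def)
    qed
    have "(\<lambda>n. LINT t:({0..1/256} \<inter> K)|lborel. U' n t) \<longlonglongrightarrow> (LINT t:({0..1/256} \<inter> K)|lborel. indicator K t)"
      by (rule weak_limit_of_initial_integrals[OF U'm U'1 _ _ init Kb]) (auto split: split_indicator)
    moreover have "{0..1/256} \<inter> K = K" using K(2) by auto
    moreover have "(LINT t:K|lborel. indicator K t) = ?\<kappa>"
      by (simp add: set_lebesgue_integral_def indicator_inter_arith[symmetric])
    ultimately show ?thesis by (simp only: flux)
  qed
  have zero: "\<nu> E = 0" if \<rho>: "\<rho> < 1" and E: "E \<in> sets disk_borel" "E \<subseteq> cball 0 \<rho>" for \<rho> E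
  proof -
    \<comment> \<open>This gap depends on \<open>\<rho>\<close> alone and not on \<open>n\<close>;
      otherwise it could disappear in the limit.\<close>
    define \<delta> where "\<delta> = 1 - 1 / (2 - \<rho>)\<^sup>2"
    have "1 < (2 - \<rho>)\<^sup>2" using \<rho> by (intro one_less_power) auto
    then have \<delta>: "\<delta> > 0" by (simp add: \<delta>_def divide_less_eq_1)
    have "ennreal (vector_integral \<nu> (\<phi> n) + \<delta> * norm (\<nu> E)) \<le> ennreal ?\<kappa>" for n
    proof (rule order_trans[OF vector_integral_le_variation[OF vm \<phi>c E(1) less_imp_le[OF \<delta>]] V])
      show "norm (\<phi> n x) \<le> 1" for x using u(2) by (simp add: rot(3))
      fix x assume "x \<in> E"
      then have x: "norm x \<le> \<rho>" using E(2) by auto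
      have "norm (\<phi> n x) \<le> 1 / (2 - norm x)\<^sup>2" using u(3)[of x n] x \<rho> by (simp add: rot(3))
      also have "\<dots> \<le> 1 / (2 - \<rho>)\<^sup>2" using x \<rho> by (intro frac_le power_mono) auto
      finally show "norm (\<phi> n x) \<le> 1 - \<delta>" by (simp add: \<delta>_def)
    qed
    then have "vector_integral \<nu> (\<phi> n) + \<delta> * norm (\<nu> E) \<le> ?\<kappa>" for n
      using ennreal_le_iff[of ?\<kappa>] by simp
    then have "?\<kappa> + \<delta> * norm (\<nu> E) \<le> ?\<kappa>"
      by (intro LIMSEQ_le_const2[OF tendsto_add[OF lim tendsto_const]]) auto
    then show ?thesis using \<delta> by (simp add: mult_le_0_iff)
  qed
  have "\<nu> E = 0" if "E \<in> sets disk_borel" for E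
    by (rule vector_measure_eq_zeroI[OF vm zero that])
  then have "variation \<nu> disk = variation (\<lambda>_. 0) disk" by (rule variation_cong)
  also have "\<dots> \<le> 0" unfolding variation_def by (rule SUP_least) simp
  finally have V0: "variation \<nu> disk \<le> 0" .
  \<comment> \<open>Once the variation is zero, the choice of the empty set and of gap 0 shows that
    all fluxes are nonpositive, although they tend to a positive number.\<close>
  have "ennreal (vector_integral \<nu> (\<phi> n) + 0 * norm (\<nu> {})) \<le> 0" for n
    by (rule order_trans[OF vector_integral_le_variation[OF vm \<phi>c] V0]) (use u(2) in \<open>auto simp: rot(3)\<close>)
  then have "vector_integral \<nu> (\<phi> n) \<le> 0" for n by (simp add: ennreal_eq_0_iff)
  then have "?\<kappa> \<le> 0" by (intro LIMSEQ_le_const2[OF lim]) auto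
  then show False using K(3) by simp
qed

section \<open>Uniqueness of the distributional gradient\<close>

lemma has_derivative_pos_part_square:
  "((\<lambda>s::real. (max 0 s)\<^sup>2) has_real_derivative 2 * max 0 s) (at s)"
proof (cases "s = 0")
  case True
  have "((\<lambda>y::real. ((max 0 y)\<^sup>2 - (max 0 0)\<^sup>2) / (y - 0)) \<longlongrightarrow> max 0 0) (at 0)"
  proof (rule Lim_transform_eventually)
    show "((\<lambda>y::real. max 0 y) \<longlongrightarrow> max 0 0) (at 0)" by (intro tendsto_intros)
    show "\<forall>\<^sub>F y::real in at 0. max 0 y = ((max 0 y)\<^sup>2 - (max 0 0)\<^sup>2) / (y - 0)"
      by (auto simp: eventually_at_filter max_def power2_eq_square)
  qed
  then show ?thesis using True by (simp add: has_field_derivative_iff)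
next
  case False
  show ?thesis
  proof (cases "s > 0")
    case True
    have "((\<lambda>s::real. s\<^sup>2) has_real_derivative 2 * max 0 s) (at s)"
      using True by (auto intro!: derivative_eq_intros)
    then show ?thesis
      by (rule has_field_derivative_transform_within_open[where S = "{0<..}"]) (use True in \<open>auto simp: max_def\<close>)
  next
    case neg: False
    have "((\<lambda>s::real. 0) has_real_derivative 2 * max 0 s) (at s)"
      using neg False by simp
    then show ?thesis
      by (rule has_field_derivative_transform_within_open[where S = "{..<0}"]) (use neg False in \<open>auto simp: max_def\<close>)
  qed
qed

lemma C1c_has_grad:
  assumes "C1c U (q :: real^2 \<Rightarrow> real)"
  obtains G where "has_grad q G"
proof -
  have "C1 q" using assms by (simp add: C1c_def)
  then obtain G where "has_grad q G" by (rule C1_has_grad)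
  then show ?thesis by (rule that)
qed

lemma C1c_continuous: "C1c U (q :: real^2 \<Rightarrow> real) \<Longrightarrow> continuous_on S q"
  using C1c_has_grad[of U q] has_grad_continuous by metis

text \<open>The bump is the square of the positive part of \<open>r^2 - (norm (x - a))^2\<close>;
  squaring makes it continuously differentiable across the sphere.\<close>

lemma C1c_ball:
  assumes "r > 0" "cball a r \<subseteq> U"
  obtains q :: "real^2 \<Rightarrow> real" where "C1c U q" "{x. q x \<noteq> 0} = ball a r"
proof -
  let ?d = "\<lambda>x::real^2. (x - a) \<bullet> (x - a)"
  define q where "q x = (max 0 (r\<^sup>2 - ?d x))\<^sup>2" for x
  have "((\<lambda>x. ?d x) has_derivative (\<lambda>h. (2 *\<^sub>R (x - a)) \<bullet> h)) (at x)" for x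
    by (auto intro!: derivative_eq_intros simp: inner_commute)
  then have d: "has_grad ?d (\<lambda>x. 2 *\<^sub>R (x - a))"
    by (auto simp: has_grad_def intro!: continuous_intros)
  have "has_grad (\<lambda>x. r\<^sup>2 - ?d x) (\<lambda>x. 0 - 2 *\<^sub>R (x - a))"
    by (rule has_grad_diff[OF has_grad_const d])
  then have "has_grad q (\<lambda>x. (2 * max 0 (r\<^sup>2 - ?d x)) *\<^sub>R (0 - 2 *\<^sub>R (x - a)))"
    unfolding q_def
    by (rule has_grad_compose[where h = "\<lambda>s. (max 0 s)\<^sup>2" and h' = "\<lambda>s. 2 * max 0 s"])
      (auto intro!: has_derivative_pos_part_square continuous_intros)
  then have "C1 q" by (rule has_grad_C1)
  have pos: "r\<^sup>2 - ?d x > 0 \<longleftrightarrow> x \<in> ball a r" for x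
  proof -
    have "?d x = (norm (a - x))\<^sup>2" by (simp only: dot_square_norm norm_minus_commute)
    moreover have "(norm (a - x))\<^sup>2 < r\<^sup>2 \<longleftrightarrow> norm (a - x) < r"
      using assms(1) by (metis linorder_not_less norm_ge_zero power2_le_imp_le power_mono less_imp_le)
    ultimately show ?thesis by (simp add: dist_norm)
  qed
  have supp: "{x. q x \<noteq> 0} = ball a r"
  proof (rule set_eqI)
    fix x
    have "q x \<noteq> 0 \<longleftrightarrow> r\<^sup>2 - ?d x > 0" by (auto simp: q_def max_def)
    then show "x \<in> {x. q x \<noteq> 0} \<longleftrightarrow> x \<in> ball a r" by (simp only: pos mem_Collect_eq)
  qed
  have "C1c U q"
    unfolding C1c_def
  proof (intro conjI exI[of _ "cball a r"] allI impI)
    fix x assume "x \<notin> cball a r"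
    then show "q x = 0" using supp ball_subset_cball[of a r] by blast
  qed (use \<open>C1 q\<close> assms(2) in auto)
  then show ?thesis using that supp by blast
qed

section \<open>Supports of test functions as a generating pi-system\<close>

lemma C1c_mult:
  fixes p q :: "real^2 \<Rightarrow> real"
  assumes "C1c U p" "C1c U q"
  shows "C1c U (\<lambda>x. p x * q x)"
proof -
  obtain P Q where "has_grad p P" "has_grad q Q" using assms C1c_has_grad by metis
  then have "C1 (\<lambda>x. p x * q x)" using has_grad_mult has_grad_C1 by blast
  moreover obtain K where "compact K" "K \<subseteq> U" "\<And>x. x \<notin> K \<Longrightarrow> p x = 0"
    using assms(1) unfolding C1c_def by blast
  ultimately show ?thesis unfolding C1c_def by (intro conjI exI[of _ K]) auto
qed

text \<open>A pi-system fitted to test functions: intersections correspond to products, indicators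
  of its members are bounded limits of test functions, and it contains all balls whose closure lies
  in the disk.\<close>

definition support_sets :: "(real^2) set set" where
  "support_sets = {{x. q x \<noteq> 0} | q :: real^2 \<Rightarrow> real. C1c disk q}"

lemma support_sets_Int_stable: "Int_stable support_sets"
  unfolding Int_stable_def
proof (intro ballI)
  fix A B assume "A \<in> support_sets" "B \<in> support_sets"
  then obtain p q :: "real^2 \<Rightarrow> real" where pq: "A = {x. p x \<noteq> 0}" "B = {x. q x \<noteq> 0}" "C1c disk p" "C1c disk q"
    unfolding support_sets_def by blast
  have "A \<inter> B = {x. p x * q x \<noteq> 0}" using pq by auto
  then show "A \<inter> B \<in> support_sets"
    unfolding support_sets_def
    by (intro CollectI exI[of _ "\<lambda>x. p x * q x"] conjI C1c_mult pq)
qed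

lemma support_setsE:
  assumes "A \<in> support_sets"
  obtains q :: "real^2 \<Rightarrow> real" where "A = {x. q x \<noteq> 0}" "C1c disk q"
  using assms unfolding support_sets_def by blast

lemma support_sets_subset:
  assumes "A \<in> support_sets"
  shows "A \<subseteq> disk"
proof -
  obtain q :: "real^2 \<Rightarrow> real" where q: "A = {x. q x \<noteq> 0}" "C1c disk q"
    using assms by (rule support_setsE)
  obtain K where "K \<subseteq> disk" "\<And>x. x \<notin> K \<Longrightarrow> q x = 0" using q(2) unfolding C1c_def by blast
  then show ?thesis unfolding q(1) by blast
qed

lemma support_sets_open:
  assumes "A \<in> support_sets"
  shows "open A" "A \<in> sets disk_borel"
proof -
  obtain q :: "real^2 \<Rightarrow> real" where q: "A = {x. q x \<noteq> 0}" "C1c disk q"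
    using assms by (rule support_setsE)
  show "open A" unfolding q(1) by (intro open_Collect_neq C1c_continuous[OF q(2)] continuous_on_const)
  moreover have "A = disk \<inter> A" using support_sets_subset[OF assms] by blast
  ultimately show "A \<in> sets disk_borel" unfolding sets_restrict_space by (intro image_eqI[of _ _ A]) auto
qed

lemma ball_in_support_sets:
  assumes "r > 0" "cball a r \<subseteq> disk"
  shows "ball a r \<in> support_sets"
proof -
  obtain q :: "real^2 \<Rightarrow> real" where "C1c disk q" "{x. q x \<noteq> 0} = ball a r" by (rule C1c_ball[OF assms])
  then show ?thesis unfolding support_sets_def by (intro CollectI exI[of _ q] conjI) simp_all
qed

text \<open>An open set is the union of all balls whose closure it contains, and the Lindelof
  property leaves a countable union.\<close>

lemma open_in_sigma_support_sets:
  assumes "open V" "V \<subseteq> disk"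
  shows "V \<in> sigma_sets disk support_sets"
proof -
  define F where "F = {ball a r | a r. r > 0 \<and> cball a r \<subseteq> V}"
  have "\<And>S. S \<in> F \<Longrightarrow> open S" unfolding F_def by auto
  then obtain F' where F': "F' \<subseteq> F" "countable F'" "\<Union>F' = \<Union>F" by (rule Lindelof) auto
  have "\<Union>F = V"
  proof
    show "\<Union>F \<subseteq> V" unfolding F_def using ball_subset_cball by blast
    show "V \<subseteq> \<Union>F"
    proof
      fix x assume "x \<in> V"
      then obtain r where "r > 0" "cball x r \<subseteq> V" using assms(1) open_contains_cball by blast
      then show "x \<in> \<Union>F" unfolding F_def by (intro UnionI[of "ball x r"]) auto
    qed
  qed
  moreover have "\<Union>F' \<in> sigma_sets disk support_sets"
  proof (rule sigma_sets_UNION[OF F'(2)])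
    fix B assume "B \<in> F'"
    then obtain a r where "B = ball a r" "r > 0" "cball a r \<subseteq> V" using F'(1) unfolding F_def by blast
    then have "B \<in> support_sets" using ball_in_support_sets assms(2) by blast
    then show "B \<in> sigma_sets disk support_sets" by (rule sigma_sets.Basic)
  qed
  ultimately show ?thesis using F'(3) by simp
qed

lemma sets_disk_borel_support_sets: "sets disk_borel \<subseteq> sigma_sets disk support_sets"
proof -
  interpret S: sigma_algebra disk "sigma_sets disk support_sets"
    by (rule sigma_algebra_sigma_sets) (use support_sets_subset in blast)
  have "disk \<inter> A \<in> sigma_sets disk support_sets" if "A \<in> sigma_sets UNIV {S. open S}" for A :: "(real^2) set"
    using that
  proof induction
    case (Basic A)
    then show ?case by (intro open_in_sigma_support_sets) auto
  next
    case Empty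
    then show ?case by (simp only: Int_empty_right S.empty_sets)
  next
    case (Compl A)
    have "disk \<inter> (UNIV - A) = disk - (disk \<inter> A)" by blast
    then show ?case using S.compl_sets[OF Compl.IH] by (simp only:)
  next
    case (Union A)
    have "disk \<inter> (\<Union>i. A i) = (\<Union>i. disk \<inter> A i)" by blast
    then show ?case using S.countable_UN[of "\<lambda>i. disk \<inter> A i"] Union.IH by (simp only:) blast
  qed
  then show ?thesis by (auto simp: sets_restrict_space borel_def)
qed

text \<open>The functions \<open>1 - 1 / (1 + k * q^2)\<close> vanish exactly where \<open>q\<close>
  does if \<open>k > 0\<close>, and tend to 1 elsewhere. They inherit the compact support of
  \<open>q\<close> and need no cutoff.\<close>

lemma support_set_approximation:
  assumes A: "A \<in> support_sets"
  obtains \<phi> :: "nat \<Rightarrow> real^2 \<Rightarrow> real" where "\<And>k. C1c disk (\<phi> k)" "\<And>k x. \<bar>\<phi> k x\<bar> \<le> 1"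
    "\<And>x. (\<lambda>k. \<phi> k x) \<longlonglongrightarrow> indicator A x"
proof -
  obtain q :: "real^2 \<Rightarrow> real" where q: "A = {x. q x \<noteq> 0}" "C1c disk q"
    using A by (rule support_setsE)
  obtain Q where Q: "has_grad q Q" by (rule C1c_has_grad[OF q(2)])
  obtain K where K: "compact K" "K \<subseteq> disk" "\<And>x. x \<notin> K \<Longrightarrow> q x = 0"
    using q(2) unfolding C1c_def by blast
  define \<phi> where "\<phi> k x = 1 - inverse (1 + real k * (q x)\<^sup>2)" for k x
  have p: "1 + real k * t\<^sup>2 \<noteq> 0" "1 + real k * t\<^sup>2 \<ge> 1" for k t
  proof -
    show "1 + real k * t\<^sup>2 \<ge> 1" by simp
    then show "1 + real k * t\<^sup>2 \<noteq> 0" by linarith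
  qed
  have C1c: "C1c disk (\<phi> k)" for k
  proof -
    let ?h' = "\<lambda>t. 0 - - (inverse (1 + real k * t\<^sup>2) * (real k * (2 * t)) * inverse (1 + real k * t\<^sup>2))"
    have "has_grad (\<lambda>x. (\<lambda>t. 1 - inverse (1 + real k * t\<^sup>2)) (q x)) (\<lambda>x. ?h' (q x) *\<^sub>R Q x)"
    proof (rule has_grad_compose[OF Q])
      show "((\<lambda>t. 1 - inverse (1 + real k * t\<^sup>2)) has_real_derivative ?h' (q x)) (at (q x))" for x
        by (intro DERIV_diff DERIV_const DERIV_inverse') (use p[of k] in \<open>auto intro!: derivative_eq_intros\<close>)
      show "continuous_on (range q) ?h'" by (intro continuous_intros) (use p[of k] in auto)
    qed
    then have "C1 (\<phi> k)" unfolding \<phi>_def by (rule has_grad_C1)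
    then show ?thesis
      unfolding C1c_def using K by (intro conjI exI[of _ K]) (auto simp: \<phi>_def)
  qed
  have b: "\<bar>\<phi> k x\<bar> \<le> 1" for k x
  proof -
    have "inverse (1 + real k * (q x)\<^sup>2) \<le> 1" "0 \<le> inverse (1 + real k * (q x)\<^sup>2)"
      using p(2)[of k "q x"] by (auto intro: le_imp_inverse_le[of 1, simplified])
    then show ?thesis unfolding \<phi>_def by linarith
  qed
  have l: "(\<lambda>k. \<phi> k x) \<longlonglongrightarrow> indicator A x" for x
  proof (cases "q x = 0")
    case True
    then show ?thesis by (simp add: \<phi>_def q(1))
  next
    case False
    then have "(q x)\<^sup>2 > 0" by simp
    moreover have "(\<lambda>k. 1 - inverse (1 + real k * c)) \<longlonglongrightarrow> 1 - 0" if "c > 0" for c :: real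
      by (intro tendsto_diff tendsto_const tendsto_inverse_0_at_top filterlim_tendsto_add_at_top[OF tendsto_const]
          filterlim_at_top_mult_tendsto_pos[OF tendsto_const that filterlim_real_sequentially])
    ultimately show ?thesis using False by (simp add: \<phi>_def q(1))
  qed
  show ?thesis by (rule that[OF C1c b l])
qed

lemma signed_integral_tendsto:
  assumes \<mu>: "sigma_additive disk_borel \<mu>" and A: "A \<in> sets disk_borel"
    and c: "\<And>k. continuous_on UNIV (\<phi> k)" and b: "\<And>k x. \<bar>\<phi> k x\<bar> \<le> (1::real)"
    and l: "\<And>x. (\<lambda>k. \<phi> k x) \<longlonglongrightarrow> indicator A x"
  shows "(\<lambda>k. signed_integral \<mu> (\<phi> k)) \<longlonglongrightarrow> \<mu> A"
proof -
  obtain P N where P: "finite_measure P" "finite_measure N" "sets P = sets disk_borel" "sets N = sets disk_borel"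
    "\<And>E. E \<in> sets disk_borel \<Longrightarrow> \<mu> E = measure P E - measure N E"
    using jordan_decomposition[OF \<mu>] by blast
  have lim: "(\<lambda>k. integral\<^sup>L M (\<phi> k)) \<longlonglongrightarrow> measure M A"
    if M: "finite_measure M" "sets M = sets disk_borel" for M
  proof -
    interpret finite_measure M by fact
    have As: "A \<in> sets M" using A M(2) by simp
    have "(\<lambda>k. integral\<^sup>L M (\<phi> k)) \<longlonglongrightarrow> integral\<^sup>L M (indicator A)"
      by (rule integral_dominated_convergence[where w = "\<lambda>_. 1"])
        (use As l b continuous_on_disk_borel[OF M(2) c] in auto)
    then show ?thesis using As by simp
  qed
  have "signed_integral \<mu> (\<phi> k) = integral\<^sup>L P (\<phi> k) - integral\<^sup>L N (\<phi> k)" for k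
    by (intro signed_integral_eq has_signed_integral_continuous P c)
  then show ?thesis
    unfolding P(5)[OF A] by (simp only:) (intro tendsto_diff lim P(1-4))
qed

text \<open>The pi-lambda argument for the difference \<open>d\<close> of the two measures. On a
  support set \<open>d\<close> vanishes because dominated convergence reaches its indicator through
  test functions.\<close>

lemma sigma_additive_eqI_C1c:
  assumes \<mu>: "sigma_additive disk_borel \<mu>" and \<mu>': "sigma_additive disk_borel \<mu>'"
    and eq: "\<And>\<phi>. C1c disk \<phi> \<Longrightarrow> signed_integral \<mu> \<phi> = signed_integral \<mu>' \<phi>"
    and E: "E \<in> sets disk_borel"
  shows "\<mu> E = \<mu>' E"
proof -
  define d where "d E = \<mu> E - \<mu>' E" for E
  have d: "sigma_additive disk_borel d"
    unfolding sigma_additive_def d_def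
    by (intro allI impI sums_diff sigma_additive_sums[OF \<mu>] sigma_additive_sums[OF \<mu>']) auto
  have sub: "sigma_sets disk support_sets \<subseteq> sets disk_borel"
  proof -
    have "support_sets \<subseteq> sets disk_borel"
      using support_sets_open(2) by blast
    then show ?thesis
      using sets.sigma_sets_subset[of support_sets disk_borel] by (simp add: space_restrict_space)
  qed
  have basic: "d A = 0" if A: "A \<in> support_sets" for A
  proof -
    have As: "A \<in> sets disk_borel" using A sub by blast
    obtain \<phi> :: "nat \<Rightarrow> real^2 \<Rightarrow> real" where \<phi>: "\<And>k. C1c disk (\<phi> k)" "\<And>k x. \<bar>\<phi> k x\<bar> \<le> 1"
      "\<And>x. (\<lambda>k. \<phi> k x) \<longlonglongrightarrow> indicator A x"
      using support_set_approximation[OF A] by blast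
    note lim = signed_integral_tendsto[OF _ As C1c_continuous[OF \<phi>(1)] \<phi>(2,3)]
    show ?thesis
      using LIMSEQ_unique[OF lim[OF \<mu>, unfolded eq[OF \<phi>(1)]] lim[OF \<mu>']] by (simp add: d_def)
  qed
  have disk0: "d disk = 0"
  proof -
    \<comment> \<open>The disk, which the complement step refers to, is not itself a support set, so
      its measure is obtained as a limit along an exhaustion by balls. The shift by 2 keeps the
      radius positive at \<open>n = 0\<close>.\<close>
    define B where "B n = ball (0::real^2) (1 - 1 / real (n + 2))" for n
    have C: "cball 0 (1 - 1 / real (n + 2)) \<subseteq> disk" for n
    proof -
      have "0 < 1 / real (n + 2)" by simp
      then have "norm x < 1" if "norm x \<le> 1 - 1 / real (n + 2)" for x :: "real^2"
        using that by linarith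
      then show ?thesis by auto
    qed
    have B: "B n \<in> sets disk_borel" "d (B n) = 0" for n
    proof -
      have "B n \<in> support_sets" unfolding B_def by (rule ball_in_support_sets[OF _ C]) simp
      then show "B n \<in> sets disk_borel" "d (B n) = 0" using sub basic by blast+
    qed
    have inc: "incseq B"
      unfolding B_def by (intro incseq_SucI subset_ball) (simp add: field_simps)
    have U: "(\<Union>n. B n) = disk"
    proof
      show "(\<Union>n. B n) \<subseteq> disk" using C ball_subset_cball unfolding B_def by blast
      show "disk \<subseteq> (\<Union>n. B n)"
      proof
        fix x :: "real^2" assume "x \<in> disk"
        then have "0 < 1 - norm x" by simp
        then obtain n where n: "inverse (real (Suc n)) < 1 - norm x" using reals_Archimedean by blast
        have "1 / real (n + 2) \<le> inverse (real (Suc n))" by (simp add: field_simps)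
        then have "x \<in> B n" using n by (simp add: B_def)
        then show "x \<in> (\<Union>n. B n)" by blast
      qed
    qed
    have lim: "(\<lambda>n. measure M (B n)) \<longlonglongrightarrow> measure M disk"
      if "finite_measure M" "sets M = sets disk_borel" for M
      using finite_measure.finite_Lim_measure_incseq[OF that(1) _ inc] B(1) that(2) U by auto
    obtain P N where P: "finite_measure P" "finite_measure N" "sets P = sets disk_borel" "sets N = sets disk_borel"
      "\<And>E. E \<in> sets disk_borel \<Longrightarrow> d E = measure P E - measure N E"
      using jordan_decomposition[OF d] by blast
    have "(\<lambda>n. measure P (B n) - measure N (B n)) \<longlonglongrightarrow> measure P disk - measure N disk"
      by (intro tendsto_diff lim P(1-4))
    moreover have "measure P (B n) - measure N (B n) = 0" for n using B P(5)[OF B(1)] by simp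
    moreover have "disk \<in> sets disk_borel" using sets.top[of disk_borel] by (simp add: space_restrict_space)
    ultimately show ?thesis using P(5)[of disk] by (simp add: LIMSEQ_const_iff)
  qed
  have "E \<in> sigma_sets disk support_sets" using E sets_disk_borel_support_sets by blast
  then have "d E = 0"
  proof (rule sigma_sets_induct_disjoint[OF support_sets_Int_stable _ _ basic, rotated])
    show "support_sets \<subseteq> Pow disk" using support_sets_subset by blast
    show "d {} = 0" by (rule sigma_additive_empty[OF d])
  next
    fix A assume A: "A \<in> sigma_sets disk support_sets" "d A = 0"
    have "A \<subseteq> disk" "A \<in> sets disk_borel"
      using A(1) sub sets.sets_into_space[of A disk_borel] by (auto simp: space_restrict_space)
    moreover have "disk \<in> sets disk_borel" using sets.top[of disk_borel] by (simp add: space_restrict_space)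
    ultimately show "d (disk - A) = 0" using sigma_additive_Diff[OF d] A(2) disk0 by simp
  next
    fix A :: "nat \<Rightarrow> _" assume A: "disjoint_family A" "range A \<subseteq> sigma_sets disk support_sets" "\<And>i. d (A i) = 0"
    have "(\<lambda>n. d (A n)) sums d (\<Union>n. A n)"
      by (rule sigma_additive_sums[OF d _ A(1)]) (use A(2) sub in blast)
    then show "d (\<Union>(range A)) = 0" using A(3) sums_unique2[OF _ sums_zero] by (simp add: sums_iff)
  qed
  then show ?thesis by (simp add: d_def)
qed

text \<open>Lets any explicitly known gradient measure replace the arbitrary choice
  \<open>distr_gradient\<close> inside \<open>total_variation\<close> and
  \<open>has_trace\<close>.\<close>

lemma has_distr_gradient_unique:
  assumes "has_distr_gradient w \<nu>" "has_distr_gradient w \<nu>'" "E \<in> sets disk_borel"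
  shows "\<nu> E = \<nu>' E"
proof -
  have "\<nu> E $ i = \<nu>' E $ i" for i
  proof (rule sigma_additive_eqI_C1c[of "\<lambda>E. \<nu> E $ i" "\<lambda>E. \<nu>' E $ i", OF _ _ _ assms(3)])
    show "sigma_additive disk_borel (\<lambda>E. \<nu> E $ i)" "sigma_additive disk_borel (\<lambda>E. \<nu>' E $ i)"
      using assms unfolding has_distr_gradient_def by (blast intro: vector_measure_component)+
    fix \<phi> :: "real^2 \<Rightarrow> real" assume \<phi>: "C1c disk \<phi>"
    have "(LINT x|lebesgue_on disk. w x * partial_deriv i \<phi> x) = - signed_integral (\<lambda>E. \<nu> E $ i) \<phi>"
      using assms(1) \<phi> unfolding has_distr_gradient_def by blast
    moreover have "(LINT x|lebesgue_on disk. w x * partial_deriv i \<phi> x) = - signed_integral (\<lambda>E. \<nu>' E $ i) \<phi>"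
      using assms(2) \<phi> unfolding has_distr_gradient_def by blast
    ultimately show "signed_integral (\<lambda>E. \<nu> E $ i) \<phi> = signed_integral (\<lambda>E. \<nu>' E $ i) \<phi>" by simp
  qed
  then show ?thesis by (simp add: vec_eq_iff)
qed

section \<open>Functions with prescribed trace\<close>

text \<open>The definitions integrate over \<open>lebesgue_on disk\<close>, whose sets are Lebesgue
  measurable. This variant has the Borel sets of \<open>disk_borel\<close> as its sigma-algebra, so
  densities with respect to it are Borel measures; integrals of Borel functions agree.\<close>

abbreviation disk_leb :: "(real^2) measure" where
  "disk_leb \<equiv> restrict_space lborel disk"

lemma disk_lborel_sets: "disk \<inter> space lborel \<in> sets lborel"
  by (simp add: borel_open)

lemma sets_disk_leb: "sets disk_leb = sets disk_borel"
  by (simp add: sets_restrict_space)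

lemma space_disk_leb: "space disk_leb = disk"
  by (simp add: space_restrict_space)

lemma integral_disk_leb:
  fixes f :: "real^2 \<Rightarrow> 'b::euclidean_space"
  shows "(LINT x|disk_leb. f x) = (LINT x:disk|lborel. f x)"
    "integrable disk_leb f \<longleftrightarrow> set_integrable lborel disk f"
  by (simp_all add: integral_restrict_space[OF disk_lborel_sets] integrable_restrict_space[OF disk_lborel_sets]
      set_lebesgue_integral_def set_integrable_def)

lemma integral_lebesgue_disk_leb:
  fixes f :: "real^2 \<Rightarrow> real"
  assumes "f \<in> borel_measurable borel"
  shows "(LINT x|lebesgue_on disk. f x) = (LINT x|disk_leb. f x)"
    "integrable (lebesgue_on disk) f \<longleftrightarrow> integrable disk_leb f"
  by (simp_all only: integral_disk_leb integral_lebesgue_on_disk[OF assms])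

lemma measurable_disk_leb: "f \<in> borel_measurable borel \<Longrightarrow> f \<in> borel_measurable disk_leb"
  by (rule measurable_restrict_space1) simp

lemma finite_measure_disk_leb: "finite_measure disk_leb"
proof (rule finite_measureI)
  have "emeasure lborel (ball (0::real^2) 1) < \<infinity>" by (rule emeasure_lborel_ball_finite)
  then show "emeasure disk_leb (space disk_leb) \<noteq> \<infinity>"
    unfolding space_disk_leb by (subst emeasure_restrict_space[OF disk_lborel_sets]) simp_all
qed

section \<open>Series of integrable functions\<close>

lemma AE_summable_norm:
  fixes h :: "nat \<Rightarrow> 'a \<Rightarrow> 'b::{banach, second_countable_topology}"
  assumes h: "\<And>k. integrable M (h k)" and s: "summable (\<lambda>k. \<integral>x. norm (h k x) \<partial>M)"
  shows "AE x in M. summable (\<lambda>k. norm (h k x))"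
proof -
  have [measurable]: "h k \<in> borel_measurable M" for k using h by simp
  have "(\<integral>\<^sup>+x. (\<Sum>k. ennreal (norm (h k x))) \<partial>M) = (\<Sum>k. \<integral>\<^sup>+x. ennreal (norm (h k x)) \<partial>M)"
    by (rule nn_integral_suminf) measurable
  also have "\<dots> = (\<Sum>k. ennreal (\<integral>x. norm (h k x) \<partial>M))"
    by (intro suminf_cong nn_integral_eq_integral integrable_norm h) auto
  also have "\<dots> = ennreal (\<Sum>k. \<integral>x. norm (h k x) \<partial>M)"
    by (intro suminf_ennreal2 s) auto
  finally have "(\<integral>\<^sup>+x. (\<Sum>k. ennreal (norm (h k x))) \<partial>M) \<noteq> \<infinity>" by simp
  then have "AE x in M. (\<Sum>k. ennreal (norm (h k x))) \<noteq> \<infinity>"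
    by (intro nn_integral_noteq_infinite) measurable
  then show ?thesis
    by (rule AE_mp) (intro AE_I2 impI summable_suminf_not_top, auto)
qed

lemma integrable_mult_bounded:
  fixes g \<phi> :: "'a \<Rightarrow> real"
  assumes g: "integrable M g" and \<phi>: "\<phi> \<in> borel_measurable M" "\<And>x. x \<in> space M \<Longrightarrow> \<bar>\<phi> x\<bar> \<le> B"
  shows "integrable M (\<lambda>x. g x * \<phi> x)"
proof (rule Bochner_Integration.integrable_bound)
  show "integrable M (\<lambda>x. \<bar>g x\<bar> * B)" using g by simp
  show "(\<lambda>x. g x * \<phi> x) \<in> borel_measurable M" using g \<phi>(1) by simp
  show "AE x in M. norm (g x * \<phi> x) \<le> norm (\<bar>g x\<bar> * B)"
  proof (rule AE_I2)
    fix x assume "x \<in> space M"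
    then have "norm (g x * \<phi> x) \<le> \<bar>g x\<bar> * B" using \<phi>(2) by (simp add: abs_mult mult_left_mono)
    also have "\<dots> \<le> norm (\<bar>g x\<bar> * B)" by (simp only: real_norm_def abs_ge_self)
    finally show "norm (g x * \<phi> x) \<le> norm (\<bar>g x\<bar> * B)" .
  qed
qed

text \<open>Termwise integration against a bounded weight, which is what passing to the limit in
  Green's formula amounts to. Where the series diverges, on a null set, \<open>suminf\<close> has an
  unspecified value, so identities between integrands hold only almost everywhere.\<close>

lemma L1_series:
  fixes h :: "nat \<Rightarrow> 'a \<Rightarrow> real"
  assumes h: "\<And>k. integrable M (h k)" and s: "summable (\<lambda>k. \<integral>x. \<bar>h k x\<bar> \<partial>M)"
    and \<psi>: "\<psi> \<in> borel_measurable M" "\<And>x. x \<in> space M \<Longrightarrow> \<bar>\<psi> x\<bar> \<le> B"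
  shows "integrable M (\<lambda>x. (\<Sum>k. h k x) * \<psi> x)"
    "(\<lambda>k. \<integral>x. h k x * \<psi> x \<partial>M) sums (\<integral>x. (\<Sum>k. h k x) * \<psi> x \<partial>M)"
proof -
  have AE1: "AE x in M. summable (\<lambda>k. \<bar>h k x\<bar>)"
    using AE_summable_norm[OF h] s by simp
  have bd: "\<bar>h k x * \<psi> x\<bar> \<le> \<bar>h k x\<bar> * B" if "x \<in> space M" for k x
    using \<psi>(2)[OF that] by (simp add: abs_mult mult_left_mono)
  have i: "integrable M (\<lambda>x. h k x * \<psi> x)" for k
    by (rule integrable_mult_bounded[OF h \<psi>])
  have AE2: "AE x in M. summable (\<lambda>k. norm (h k x * \<psi> x))"
    using AE1
  proof (rule AE_mp, intro AE_I2 impI)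
    fix x assume x: "x \<in> space M" "summable (\<lambda>k. \<bar>h k x\<bar>)"
    show "summable (\<lambda>k. norm (h k x * \<psi> x))"
      by (rule summable_comparison_test'[OF summable_mult2[OF x(2), of B]]) (use bd[OF x(1)] in auto)
  qed
  have s2: "summable (\<lambda>k. \<integral>x. norm (h k x * \<psi> x) \<partial>M)"
  proof (rule summable_comparison_test'[OF summable_mult2[OF s, of B]])
    fix k :: nat
    have "(\<integral>x. norm (h k x * \<psi> x) \<partial>M) \<le> (\<integral>x. \<bar>h k x\<bar> * B \<partial>M)"
      using bd i h by (intro integral_mono) auto
    then show "norm (\<integral>x. norm (h k x * \<psi> x) \<partial>M) \<le> (\<integral>x. \<bar>h k x\<bar> \<partial>M) * B" by simp
  qed
  have eq: "AE x in M. (\<Sum>k. h k x * \<psi> x) = (\<Sum>k. h k x) * \<psi> x"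
    using AE1
  proof (rule AE_mp, intro AE_I2 impI)
    fix x assume "summable (\<lambda>k. \<bar>h k x\<bar>)"
    then have "summable (\<lambda>k. h k x)" by (rule summable_rabs_cancel)
    then show "(\<Sum>k. h k x * \<psi> x) = (\<Sum>k. h k x) * \<psi> x" by (rule suminf_mult2[symmetric])
  qed
  have m: "(\<lambda>x. \<Sum>k. h k x * \<psi> x) \<in> borel_measurable M" "(\<lambda>x. (\<Sum>k. h k x) * \<psi> x) \<in> borel_measurable M"
    using h \<psi>(1) by (auto intro!: borel_measurable_suminf borel_measurable_times)
  show "integrable M (\<lambda>x. (\<Sum>k. h k x) * \<psi> x)"
    using integrable_suminf[OF i AE2 s2] integrable_cong_AE[OF m eq] by blast
  have "(\<lambda>k. \<integral>x. h k x * \<psi> x \<partial>M) sums (\<integral>x. (\<Sum>k. h k x * \<psi> x) \<partial>M)"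
    by (rule sums_integral[OF i AE2 s2])
  then show "(\<lambda>k. \<integral>x. h k x * \<psi> x \<partial>M) sums (\<integral>x. (\<Sum>k. h k x) * \<psi> x \<partial>M)"
    using integral_cong_AE[OF m eq] by simp
qed

section \<open>Vector measures with an integrable density\<close>

definition density_measure :: "(real^2 \<Rightarrow> real^2) \<Rightarrow> (real^2) set \<Rightarrow> real^2" where
  "density_measure G E = (\<chi> i. LINT x|disk_leb. indicator E x * G x $ i)"

lemma integrable_vec_nth:
  fixes G :: "'a \<Rightarrow> real^2"
  shows "integrable M G \<Longrightarrow> integrable M (\<lambda>x. G x $ i)"
  by (rule integrable_bounded_linear[OF bounded_linear_vec_nth])

lemma finite_measure_density:
  fixes g :: "'a \<Rightarrow> real"
  assumes "integrable M g"
  shows "finite_measure (density M (\<lambda>x. ennreal (max 0 (g x))))"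
proof (rule finite_measureI)
  have i: "integrable M (\<lambda>x. max 0 (g x))" using assms by simp
  have "emeasure (density M (\<lambda>x. ennreal (max 0 (g x)))) (space M) = (\<integral>\<^sup>+x. ennreal (max 0 (g x)) * indicator (space M) x \<partial>M)"
    using assms by (subst emeasure_density) auto
  also have "\<dots> = (\<integral>\<^sup>+x. ennreal (max 0 (g x)) \<partial>M)" by (rule nn_integral_cong) simp
  also have "\<dots> = ennreal (\<integral>x. max 0 (g x) \<partial>M)" using i by (intro nn_integral_eq_integral) auto
  finally show "emeasure (density M (\<lambda>x. ennreal (max 0 (g x)))) (space (density M (\<lambda>x. ennreal (max 0 (g x))))) \<noteq> \<infinity>"
    by simp
qed

text \<open>The densities of the positive and the negative part of \<open>g\<close> serve as the
  pair of finite measures that \<open>has_signed_integral\<close> asks for.\<close>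

lemma integral_density_diff:
  fixes g \<phi> :: "'a \<Rightarrow> real"
  assumes g: "integrable M g" and \<phi>: "\<phi> \<in> borel_measurable M" "\<And>x. x \<in> space M \<Longrightarrow> \<bar>\<phi> x\<bar> \<le> B"
  shows "integral\<^sup>L (density M (\<lambda>x. ennreal (max 0 (g x)))) \<phi> - integral\<^sup>L (density M (\<lambda>x. ennreal (max 0 (- g x)))) \<phi>
    = (\<integral>x. \<phi> x * g x \<partial>M)"
proof -
  have 1: "integral\<^sup>L (density M (\<lambda>x. ennreal (max 0 (f x)))) \<phi> = (\<integral>x. max 0 (f x) * \<phi> x \<partial>M)"
    "integrable M (\<lambda>x. max 0 (f x) * \<phi> x)" if "integrable M f" for f
    using that \<phi> by (auto intro!: integral_real_density integrable_mult_bounded[of _ _ _ B])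
  have "(\<integral>x. max 0 (g x) * \<phi> x \<partial>M) - (\<integral>x. max 0 (- g x) * \<phi> x \<partial>M) = (\<integral>x. max 0 (g x) * \<phi> x - max 0 (- g x) * \<phi> x \<partial>M)"
    using 1(2)[OF g] 1(2)[of "\<lambda>x. - g x"] g by simp
  also have "\<dots> = (\<integral>x. \<phi> x * g x \<partial>M)"
    by (rule Bochner_Integration.integral_cong) (auto simp: max_def)
  finally show ?thesis using 1(1)[OF g] 1(1)[of "\<lambda>x. - g x"] g by simp
qed

lemma density_measure_nth:
  assumes G: "integrable disk_leb G" and E: "E \<in> sets disk_borel"
  shows "density_measure G E $ i = measure (density disk_leb (\<lambda>x. ennreal (max 0 (G x $ i)))) E
    - measure (density disk_leb (\<lambda>x. ennreal (max 0 (- G x $ i)))) E"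
proof -
  have Es: "E \<in> sets disk_leb" using E sets_disk_leb by simp
  have "E \<inter> disk = E" using sets.sets_into_space[OF E] by (auto simp: space_restrict_space)
  then show ?thesis
    using integral_density_diff[OF integrable_vec_nth[OF G, of i], of "indicator E" 1] Es
    by (simp add: density_measure_def space_disk_leb indicator_def of_bool_def)
qed

lemma has_signed_integral_density_measure:
  assumes G: "integrable disk_leb G" and \<phi>: "continuous_on UNIV \<phi>"
  shows "has_signed_integral (\<lambda>E. density_measure G E $ i) \<phi> (LINT x|disk_leb. \<phi> x * G x $ i)"
proof -
  have g: "integrable disk_leb (\<lambda>x. G x $ i)" by (rule integrable_vec_nth[OF G])
  obtain B where B: "\<And>x. x \<in> disk \<Longrightarrow> \<bar>\<phi> x\<bar> \<le> B" using bounded_on_disk[OF \<phi>] by blast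
  let ?P = "density disk_leb (\<lambda>x. ennreal (max 0 (G x $ i)))" and ?N = "density disk_leb (\<lambda>x. ennreal (max 0 (- G x $ i)))"
  have "has_signed_integral (\<lambda>E. density_measure G E $ i) \<phi> (integral\<^sup>L ?P \<phi> - integral\<^sup>L ?N \<phi>)"
  proof (rule has_signed_integral_continuous[OF _ _ _ _ _ \<phi>])
    show "finite_measure ?P" by (rule finite_measure_density[OF g])
    show "finite_measure ?N" using finite_measure_density[of disk_leb "\<lambda>x. - G x $ i"] g by simp
    show "sets ?P = sets disk_borel" "sets ?N = sets disk_borel" by (simp_all add: sets_disk_leb)
  qed (rule density_measure_nth[OF G])
  also have "integral\<^sup>L ?P \<phi> - integral\<^sup>L ?N \<phi> = (LINT x|disk_leb. \<phi> x * G x $ i)"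
    by (rule integral_density_diff[OF g, of _ B])
      (use B \<phi> in \<open>auto simp: space_disk_leb intro!: measurable_disk_leb borel_measurable_continuous_onI\<close>)
  finally show ?thesis .
qed

lemma vector_measure_density_measure:
  assumes G: "integrable disk_leb G"
  shows "vector_measure (density_measure G)"
  unfolding vector_measure_def
proof (intro allI impI)
  fix A :: "nat \<Rightarrow> (real^2) set" assume A: "range A \<subseteq> sets disk_borel" "disjoint_family A"
  have As: "A n \<in> sets disk_borel" for n using A(1) by blast
  have "(\<lambda>n. density_measure G (A n) $ i) sums (density_measure G (\<Union>n. A n) $ i)" for i
  proof -
    have g: "integrable disk_leb (\<lambda>x. G x $ i)" by (rule integrable_vec_nth[OF G])
    let ?P = "density disk_leb (\<lambda>x. ennreal (max 0 (G x $ i)))" and ?N = "density disk_leb (\<lambda>x. ennreal (max 0 (- G x $ i)))"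
    have f: "finite_measure ?P" "finite_measure ?N"
      using finite_measure_density[OF g] finite_measure_density[of disk_leb "\<lambda>x. - G x $ i"] g by simp_all
    have r: "range A \<subseteq> sets ?P" "range A \<subseteq> sets ?N" using A(1) sets_disk_leb by simp_all
    have U: "(\<Union>n. A n) \<in> sets disk_borel" by (rule sets.countable_UN[OF A(1)])
    show ?thesis
      unfolding density_measure_nth[OF G As] density_measure_nth[OF G U]
      by (intro sums_diff finite_measure.finite_measure_UNION f r A(2))
  qed
  then show "(\<lambda>n. density_measure G (A n)) sums density_measure G (\<Union>n. A n)"
    unfolding sums_def by (intro vec_tendstoI) (simp add: sum_component)
qed

lemma norm_density_measure_le:
  assumes G: "integrable disk_leb G" and E: "E \<in> sets disk_borel"
  shows "norm (density_measure G E) \<le> (LINT x|disk_leb. indicator E x * norm (G x))"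
proof -
  have i: "integrable disk_leb (\<lambda>x. indicator E x *\<^sub>R G x)"
    using integrable_mult_indicator[of E disk_leb G] G E sets_disk_leb by simp
  have "density_measure G E = (LINT x|disk_leb. indicator E x *\<^sub>R G x)"
    using integral_bounded_linear[OF bounded_linear_vec_nth i] by (simp add: vec_eq_iff density_measure_def)
  also have "norm \<dots> \<le> (LINT x|disk_leb. norm (indicator E x *\<^sub>R G x))" by (rule integral_norm_bound)
  finally show ?thesis by simp
qed

lemma variation_density_measure_le:
  assumes G: "integrable disk_leb G"
  shows "variation (density_measure G) disk \<le> ennreal (LINT x|disk_leb. norm (G x))"
  unfolding variation_def
proof (rule SUP_least, clarify)
  fix A :: "nat \<Rightarrow> (real^2) set"
  assume A: "range A \<subseteq> sets disk_borel" "disjoint_family A" "(\<Union>n. A n) = disk"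
  have As: "A n \<in> sets disk_leb" "A n \<in> sets disk_borel" for n using A(1) sets_disk_leb by blast+
  have n: "integrable disk_leb (\<lambda>x. norm (G x))" using G by simp
  have [measurable]: "G \<in> borel_measurable disk_leb" using G by simp
  have "(\<Sum>n. ennreal (norm (density_measure G (A n)))) \<le> (\<Sum>n. \<integral>\<^sup>+x. ennreal (norm (G x)) * indicator (A n) x \<partial>disk_leb)"
  proof (intro suminf_le summableI)
    fix k
    have i: "integrable disk_leb (\<lambda>x. indicator (A k) x * norm (G x))"
      using integrable_mult_indicator[OF As(1) n] by simp
    have "ennreal (norm (density_measure G (A k))) \<le> ennreal (LINT x|disk_leb. indicator (A k) x * norm (G x))"
      by (intro ennreal_leI norm_density_measure_le[OF G As(2)])
    also have "\<dots> = (\<integral>\<^sup>+x. ennreal (indicator (A k) x * norm (G x)) \<partial>disk_leb)"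
      by (rule nn_integral_eq_integral[symmetric, OF i]) simp
    also have "\<dots> = (\<integral>\<^sup>+x. ennreal (norm (G x)) * indicator (A k) x \<partial>disk_leb)"
      by (rule nn_integral_cong) (auto split: split_indicator)
    finally show "ennreal (norm (density_measure G (A k))) \<le> (\<integral>\<^sup>+x. ennreal (norm (G x)) * indicator (A k) x \<partial>disk_leb)" .
  qed
  also have "\<dots> = (\<integral>\<^sup>+x\<in>(\<Union>n. A n). ennreal (norm (G x)) \<partial>disk_leb)"
    by (rule nn_integral_disjoint_family[symmetric]) (use As A in auto)
  also have "\<dots> = (\<integral>\<^sup>+x. ennreal (norm (G x)) \<partial>disk_leb)"
    unfolding A(3) by (rule nn_integral_cong) (simp add: space_disk_leb del: mem_ball mem_ball_0)
  also have "\<dots> = ennreal (LINT x|disk_leb. norm (G x))"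
    using n by (intro nn_integral_eq_integral) auto
  finally show "(\<Sum>n. ennreal (norm (density_measure G (A n)))) \<le> ennreal (LINT x|disk_leb. norm (G x))" .
qed

section \<open>Integration on the circle and integration by parts\<close>

lemma sets_circle_measure: "sets circle_measure = sets (restrict_space borel (sphere 0 1))"
  by (simp add: circle_measure_def)

lemma space_circle_measure: "space circle_measure = sphere 0 1"
  by (simp add: circle_measure_def space_restrict_space)

lemma measurable_circle_measure:
  "f \<in> borel_measurable borel \<Longrightarrow> f \<in> borel_measurable circle_measure"
  unfolding measurable_cong_sets[OF sets_circle_measure refl] by (rule measurable_restrict_space1)

lemma integrable_circle_measure_continuous:
  fixes f :: "real^2 \<Rightarrow> real"
  assumes "continuous_on UNIV f"
  shows "integrable circle_measure f"
proof -
  have "continuous_on {0..2 * pi} (\<lambda>t. f (circ t))"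
    by (rule continuous_on_compose2[OF assms]) (auto intro!: continuous_intros)
  then have "set_integrable lborel {0..2 * pi} (\<lambda>t. f (circ t))"
    by (rule borel_integrable_atLeastAtMost')
  then have "set_integrable lborel {0..<2 * pi} (\<lambda>t. f (circ t))"
    by (rule set_integrable_subset) auto
  then show ?thesis
    using integral_circle_measure(2) borel_measurable_continuous_onI[OF assms] by blast
qed

lemma integrable_disk_leb_continuous:
  fixes f :: "real^2 \<Rightarrow> 'b::euclidean_space"
  assumes "continuous_on UNIV f"
  shows "integrable disk_leb f"
  by (simp add: integral_disk_leb set_integrable_disk_continuous[OF assms])

lemma green_product:
  assumes v: "has_grad v g" and \<phi>: "has_grad \<phi> \<Phi>"
  shows "(LINT x|disk_leb. v x * \<Phi> x $ i) =
    - (LINT x|disk_leb. g x $ i * \<phi> x) + (LINT x|circle_measure. v x * (x $ i * \<phi> x))"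
proof -
  note c = has_grad_continuous[OF v] has_grad_continuous[OF \<phi>] has_grad_continuous_grad[OF v] has_grad_continuous_grad[OF \<phi>]
  have i: "integrable disk_leb (\<lambda>x. v x * \<Phi> x $ i)" "integrable disk_leb (\<lambda>x. g x $ i * \<phi> x)"
    by (auto intro!: integrable_disk_leb_continuous continuous_intros c)
  have "(LINT x|disk_leb. v x * \<Phi> x $ i) + (LINT x|disk_leb. g x $ i * \<phi> x)
      = (LINT x|disk_leb. (v x *\<^sub>R \<Phi> x + \<phi> x *\<^sub>R g x) $ i)"
    by (subst Bochner_Integration.integral_add[OF i, symmetric]) (simp add: mult.commute)
  also have "\<dots> = (LINT x|circle_measure. x $ i * (v x * \<phi> x))"
    unfolding integral_disk_leb by (rule green_disk[OF has_grad_mult[OF v \<phi>]])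
  finally show ?thesis by (simp add: mult_ac)
qed

lemma bounded_on_sphere:
  fixes g :: "real^2 \<Rightarrow> real"
  assumes "continuous_on UNIV g"
  obtains B where "\<And>x. x \<in> sphere 0 1 \<Longrightarrow> \<bar>g x\<bar> \<le> B"
proof -
  have "compact (g ` sphere 0 1)"
    by (intro compact_continuous_image compact_sphere continuous_on_subset[OF assms]) auto
  then obtain B where "\<forall>y\<in>g ` sphere 0 1. norm y \<le> B"
    using compact_imp_bounded bounded_iff by metis
  then show ?thesis by (intro that[of B]) auto
qed

lemma signed_integral_distr_gradient:
  assumes "has_distr_gradient w (density_measure G)" "integrable disk_leb G" "continuous_on UNIV \<phi>"
  shows "signed_integral (\<lambda>E. distr_gradient w E $ i) \<phi> = (LINT x|disk_leb. \<phi> x * G x $ i)"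
proof -
  have "has_distr_gradient w (distr_gradient w)"
    unfolding distr_gradient_def by (rule someI[of "has_distr_gradient w", OF assms(1)])
  then have "distr_gradient w E = density_measure G E" if "E \<in> sets disk_borel" for E
    using has_distr_gradient_unique assms(1) that by blast
  then have "signed_integral (\<lambda>E. distr_gradient w E $ i) \<phi> = signed_integral (\<lambda>E. density_measure G E $ i) \<phi>"
    by (intro signed_integral_cong) simp
  also have "\<dots> = (LINT x|disk_leb. \<phi> x * G x $ i)"
    by (intro signed_integral_eq has_signed_integral_density_measure assms)
  finally show ?thesis .
qed

text \<open>Green's formula holds for every smooth term, and the three summability conditions carry
  it to the sum. The gradient of the sum is then the measure whose density is the sum of the
  gradients, and the trace is the sum of the boundary values.\<close>

lemma BV_of_series:
  assumes v: "\<And>k. has_grad (v k) (g k)"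
    and sv: "summable (\<lambda>k. LINT x|disk_leb. \<bar>v k x\<bar>)"
    and sg: "summable (\<lambda>k. LINT x|disk_leb. norm (g k x))"
    and sc: "summable (\<lambda>k. LINT x|circle_measure. \<bar>v k x\<bar>)"
    and f: "\<And>x. norm x = 1 \<Longrightarrow> (\<lambda>k. v k x) sums f x"
  obtains w where "BV w" "has_trace w f"
    "total_variation w \<le> ennreal (\<Sum>k. LINT x|disk_leb. norm (g k x))"
proof -
  define w where "w x = (\<Sum>k. v k x)" for x
  define G where "G x = (\<chi> i. \<Sum>k. g k x $ i)" for x
  have cv: "continuous_on S (v k)" for k S by (rule has_grad_continuous[OF v])
  have cg: "continuous_on S (g k)" for k S by (rule has_grad_continuous_grad[OF v])
  have iv: "integrable disk_leb (v k)" for k by (rule integrable_disk_leb_continuous[OF cv])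
  have ig: "integrable disk_leb (g k)" for k by (rule integrable_disk_leb_continuous[OF cg])
  have igi: "integrable disk_leb (\<lambda>x. g k x $ i)" for k i by (rule integrable_vec_nth[OF ig])
  have ic: "integrable circle_measure (v k)" for k by (rule integrable_circle_measure_continuous[OF cv])
  have sgi: "summable (\<lambda>k. LINT x|disk_leb. \<bar>g k x $ i\<bar>)" for i
  proof (rule summable_comparison_test'[OF sg])
    fix k :: nat
    have "(LINT x|disk_leb. \<bar>g k x $ i\<bar>) \<le> (LINT x|disk_leb. norm (g k x))"
      using igi ig by (intro integral_mono) (auto simp: component_le_norm_cart)
    then show "norm (LINT x|disk_leb. \<bar>g k x $ i\<bar>) \<le> (LINT x|disk_leb. norm (g k x))" by simp
  qed
  have wb: "w \<in> borel_measurable borel"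
    unfolding w_def using borel_measurable_continuous_onI[OF cv] by (intro borel_measurable_suminf) auto
  have wi: "integrable disk_leb w"
    using L1_series(1)[OF iv sv, of "\<lambda>_. 1" 1] by (simp add: w_def[abs_def])
  have wi': "integrable (lebesgue_on disk) w"
    using wi by (simp add: integral_lebesgue_disk_leb[OF wb])
  have Gii: "integrable disk_leb (\<lambda>x. G x $ i)" for i
    using L1_series(1)[OF igi sgi, of "\<lambda>_. 1" 1] by (simp add: G_def)
  have "G = (\<lambda>x. \<Sum>i\<in>UNIV. G x $ i *\<^sub>R axis i 1)"
    by (simp add: fun_eq_iff vec_eq_iff sum_component axis_def if_distrib cong: if_cong)
  moreover have "integrable disk_leb (\<lambda>x. \<Sum>i\<in>UNIV. G x $ i *\<^sub>R axis i (1::real))"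
    by (intro Bochner_Integration.integrable_sum integrable_scaleR_left Gii)
  ultimately have Gi: "integrable disk_leb G" by metis
  have fi: "integrable circle_measure f"
  proof -
    have "integrable circle_measure (\<lambda>x. \<Sum>k. v k x)"
      using L1_series(1)[OF ic sc, of "\<lambda>_. 1" 1] by simp
    moreover have "integrable circle_measure (\<lambda>x. \<Sum>k. v k x) \<longleftrightarrow> integrable circle_measure f"
    proof (rule Bochner_Integration.integrable_cong[OF refl])
      fix x assume "x \<in> space circle_measure"
      then show "(\<Sum>k. v k x) = f x" using f[of x] by (simp add: space_circle_measure sums_iff)
    qed
    ultimately show ?thesis by blast
  qed
  \<comment> \<open>One formula serves twice. For \<open>\<phi>\<close> with compact support in the
    disk the circle integral drops out and the formula identifies the gradient; for general
    \<open>\<phi>\<close> it is one component of the trace condition.\<close>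
  have ibp: "(LINT x|disk_leb. w x * \<Phi> x $ i) =
      - (LINT x|disk_leb. \<phi> x * G x $ i) + (LINT x|circle_measure. f x * (x $ i * \<phi> x))"
    if \<phi>: "has_grad \<phi> \<Phi>" for \<phi> \<Phi> i
  proof -
    have c\<phi>: "continuous_on S \<phi>" for S by (rule has_grad_continuous[OF \<phi>])
    have c\<Phi>: "continuous_on S (\<lambda>x. \<Phi> x $ i)" for S
      by (intro continuous_intros has_grad_continuous_grad[OF \<phi>])
    have cs: "continuous_on S (\<lambda>x. x $ i * \<phi> x)" for S by (intro continuous_intros c\<phi>)
    obtain B1 where B1: "\<And>x. x \<in> disk \<Longrightarrow> \<bar>\<Phi> x $ i\<bar> \<le> B1" using bounded_on_disk[OF c\<Phi>] by blast
    obtain B2 where B2: "\<And>x. x \<in> disk \<Longrightarrow> \<bar>\<phi> x\<bar> \<le> B2" using bounded_on_disk[OF c\<phi>] by blast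
    obtain B3 where B3: "\<And>x. x \<in> sphere 0 1 \<Longrightarrow> \<bar>x $ i * \<phi> x\<bar> \<le> B3" using bounded_on_sphere[OF cs] by blast
    have 1: "(\<lambda>k. LINT x|disk_leb. v k x * \<Phi> x $ i) sums (LINT x|disk_leb. w x * \<Phi> x $ i)"
      unfolding w_def
      by (rule L1_series(2)[OF iv sv, of _ B1])
        (use B1 in \<open>auto simp only: space_disk_leb intro!: measurable_disk_leb borel_measurable_continuous_onI c\<Phi>\<close>)
    have "(\<lambda>k. LINT x|disk_leb. g k x $ i * \<phi> x) sums (LINT x|disk_leb. (\<Sum>k. g k x $ i) * \<phi> x)"
      by (rule L1_series(2)[OF igi sgi, of _ B2])
        (use B2 in \<open>auto simp only: space_disk_leb intro!: measurable_disk_leb borel_measurable_continuous_onI c\<phi>\<close>)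
    then have 2: "(\<lambda>k. LINT x|disk_leb. g k x $ i * \<phi> x) sums (LINT x|disk_leb. \<phi> x * G x $ i)"
      by (simp add: G_def mult.commute)
    have "(\<lambda>k. LINT x|circle_measure. v k x * (x $ i * \<phi> x)) sums (LINT x|circle_measure. (\<Sum>k. v k x) * (x $ i * \<phi> x))"
      by (rule L1_series(2)[OF ic sc, of _ B3])
        (use B3 in \<open>auto simp only: space_circle_measure intro!: measurable_circle_measure borel_measurable_continuous_onI cs\<close>)
    also have "(LINT x|circle_measure. (\<Sum>k. v k x) * (x $ i * \<phi> x)) = (LINT x|circle_measure. f x * (x $ i * \<phi> x))"
    proof (rule Bochner_Integration.integral_cong[OF refl])
      fix x assume "x \<in> space circle_measure"
      then have "(\<Sum>k. v k x) = f x" using f[of x] by (simp add: space_circle_measure sums_iff)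
      then show "(\<Sum>k. v k x) * (x $ i * \<phi> x) = f x * (x $ i * \<phi> x)" by simp
    qed
    finally have 3: "(\<lambda>k. LINT x|circle_measure. v k x * (x $ i * \<phi> x)) sums (LINT x|circle_measure. f x * (x $ i * \<phi> x))" .
    from sums_add[OF sums_minus[OF 2] 3]
    have "(\<lambda>k. LINT x|disk_leb. v k x * \<Phi> x $ i) sums
        (- (LINT x|disk_leb. \<phi> x * G x $ i) + (LINT x|circle_measure. f x * (x $ i * \<phi> x)))"
      unfolding green_product[OF v \<phi>] .
    then show ?thesis by (rule sums_unique2[OF 1])
  qed
  have pd: "(LINT x|lebesgue_on disk. w x * \<Phi> x) = (LINT x|disk_leb. w x * \<Phi> x)"
    if "continuous_on UNIV \<Phi>" for \<Phi> :: "real^2 \<Rightarrow> real"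
    using wb borel_measurable_continuous_onI[OF that] by (intro integral_lebesgue_disk_leb(1)) simp
  have grad: "has_distr_gradient w (density_measure G)"
    unfolding has_distr_gradient_def
  proof (intro conjI allI impI vector_measure_density_measure[OF Gi])
    fix \<phi> :: "real^2 \<Rightarrow> real" and i assume \<phi>: "C1c disk \<phi>"
    obtain \<Phi> where \<Phi>: "has_grad \<phi> \<Phi>" by (rule C1c_has_grad[OF \<phi>])
    obtain K where K: "K \<subseteq> disk" "\<And>x. x \<notin> K \<Longrightarrow> \<phi> x = 0" using \<phi> unfolding C1c_def by blast
    have z: "(LINT x|circle_measure. f x * (x $ i * \<phi> x)) = (LINT x|circle_measure. 0)"
    proof (rule Bochner_Integration.integral_cong[OF refl])
      fix x assume "x \<in> space circle_measure"
      then have "x \<notin> K" using K(1) by (auto simp: space_circle_measure)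
      then show "f x * (x $ i * \<phi> x) = 0" using K(2) by simp
    qed
    have "(LINT x|lebesgue_on disk. w x * partial_deriv i \<phi> x) = (LINT x|disk_leb. w x * \<Phi> x $ i)"
      unfolding has_grad_partial_deriv[OF \<Phi>]
      by (intro pd continuous_intros has_grad_continuous_grad[OF \<Phi>])
    also have "\<dots> = - (LINT x|disk_leb. \<phi> x * G x $ i)"
      using ibp[OF \<Phi>, of i] z by simp
    also have "(LINT x|disk_leb. \<phi> x * G x $ i) = signed_integral (\<lambda>E. density_measure G E $ i) \<phi>"
      by (intro signed_integral_eq[symmetric] has_signed_integral_density_measure Gi has_grad_continuous[OF \<Phi>])
    finally show "(LINT x|lebesgue_on disk. w x * partial_deriv i \<phi> x) = - signed_integral (\<lambda>E. density_measure G E $ i) \<phi>" .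
  qed
  have BV: "BV w" unfolding BV_def using wi' grad by blast
  have trace: "has_trace w f"
    unfolding has_trace_def
  proof (intro conjI allI impI fi)
    fix \<phi> :: "real^2 \<Rightarrow> real^2" assume \<phi>: "C1 \<phi>"
    have "\<exists>\<Phi>. \<forall>i. has_grad (\<lambda>x. \<phi> x $ i) (\<Phi> i)" using C1_component[OF \<phi>] by (intro choice) metis
    then obtain \<Phi> where \<Phi>: "\<And>i. has_grad (\<lambda>x. \<phi> x $ i) (\<Phi> i)" by blast
    have c: "continuous_on S (\<lambda>x. \<phi> x $ i)" for S i by (rule has_grad_continuous[OF \<Phi>])
    have c': "continuous_on S (\<lambda>x. \<Phi> i x $ i)" for S i by (intro continuous_intros has_grad_continuous_grad[OF \<Phi>])
    have int1: "integrable disk_leb (\<lambda>x. w x * \<Phi> i x $ i)" for i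
    proof -
      obtain B where "\<And>x. x \<in> disk \<Longrightarrow> \<bar>\<Phi> i x $ i\<bar> \<le> B" using bounded_on_disk[OF c'] by blast
      then show ?thesis
        by (intro integrable_mult_bounded[OF wi, of _ B] measurable_disk_leb borel_measurable_continuous_onI[OF c'])
          (simp add: space_disk_leb del: mem_ball mem_ball_0)
    qed
    have int3: "integrable circle_measure (\<lambda>x. f x * (x $ i * \<phi> x $ i))" for i
    proof -
      have cs: "continuous_on S (\<lambda>x. x $ i * \<phi> x $ i)" for S by (intro continuous_intros c)
      obtain B where "\<And>x. x \<in> sphere 0 1 \<Longrightarrow> \<bar>x $ i * \<phi> x $ i\<bar> \<le> B" using bounded_on_sphere[OF cs] by blast
      then show ?thesis
        by (intro integrable_mult_bounded[OF fi, of _ B] measurable_circle_measure borel_measurable_continuous_onI[OF cs])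
          (simp add: space_circle_measure)
    qed
    have "(LINT x|lebesgue_on disk. w x * divergence \<phi> x) = (LINT x|disk_leb. w x * (\<Sum>i\<in>UNIV. \<Phi> i x $ i))"
      unfolding divergence_eq[OF \<Phi>] by (intro pd continuous_intros has_grad_continuous_grad[OF \<Phi>])
    also have "\<dots> = (\<Sum>i\<in>UNIV. LINT x|disk_leb. w x * \<Phi> i x $ i)"
      unfolding sum_distrib_left by (rule Bochner_Integration.integral_sum) (rule int1)
    also have "\<dots> = (\<Sum>i\<in>UNIV. - (LINT x|disk_leb. \<phi> x $ i * G x $ i) + (LINT x|circle_measure. f x * (x $ i * \<phi> x $ i)))"
      by (intro sum.cong refl ibp[OF \<Phi>])
    also have "\<dots> = - (\<Sum>i\<in>UNIV. LINT x|disk_leb. \<phi> x $ i * G x $ i) + (\<Sum>i\<in>UNIV. LINT x|circle_measure. f x * (x $ i * \<phi> x $ i))"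
      by (simp only: sum.distrib sum_negf)
    also have "(\<Sum>i\<in>UNIV. LINT x|disk_leb. \<phi> x $ i * G x $ i) = vector_integral (distr_gradient w) \<phi>"
      unfolding vector_integral_def
      by (intro sum.cong refl signed_integral_distr_gradient[symmetric] grad Gi c)
    also have "(\<Sum>i\<in>UNIV. LINT x|circle_measure. f x * (x $ i * \<phi> x $ i)) = (LINT x|circle_measure. (\<Sum>i\<in>UNIV. f x * (x $ i * \<phi> x $ i)))"
      by (rule Bochner_Integration.integral_sum[symmetric]) (rule int3)
    also have "\<dots> = (LINT x|circle_measure. (\<phi> x \<bullet> x) * f x)"
    proof (rule Bochner_Integration.integral_cong[OF refl])
      fix x
      have "(\<phi> x \<bullet> x) * f x = (\<Sum>i\<in>UNIV. \<phi> x $ i * x $ i) * f x" by (simp add: inner_vec_def)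
      also have "\<dots> = (\<Sum>i\<in>UNIV. f x * (x $ i * \<phi> x $ i))"
        unfolding sum_distrib_right by (intro sum.cong refl) simp
      finally show "(\<Sum>i\<in>UNIV. f x * (x $ i * \<phi> x $ i)) = (\<phi> x \<bullet> x) * f x" ..
    qed
    finally show "(LINT x|lebesgue_on disk. w x * divergence \<phi> x)
          = - vector_integral (distr_gradient w) \<phi> + (LINT x|circle_measure. (\<phi> x \<bullet> x) * f x)" .
  qed
  have "total_variation w \<le> ennreal (\<Sum>k. LINT x|disk_leb. norm (g k x))"
  proof -
    have "total_variation w = variation (density_measure G) disk"
      unfolding total_variation_def
      by (rule variation_cong) (rule has_distr_gradient_unique[OF BV_has_distr_gradient[OF BV] grad])
    also have "\<dots> \<le> ennreal (LINT x|disk_leb. norm (G x))" by (rule variation_density_measure_le[OF Gi])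
    also have "\<dots> \<le> ennreal (LINT x|disk_leb. (\<Sum>k. norm (g k x)))"
    proof (intro ennreal_leI integral_mono_AE)
      have "integrable disk_leb (\<lambda>x. (\<Sum>k. norm (g k x)) * 1)"
        by (rule L1_series(1)[of _ "\<lambda>k x. norm (g k x)" _ 1]) (use ig sg in auto)
      then show "integrable disk_leb (\<lambda>x. \<Sum>k. norm (g k x))" by simp
      show "AE x in disk_leb. norm (G x) \<le> (\<Sum>k. norm (g k x))"
        using AE_summable_norm[OF ig sg]
      proof (rule AE_mp, intro AE_I2 impI)
        fix x assume s: "summable (\<lambda>k. norm (g k x))"
        have "(\<Sum>k. g k x) = G x"
          using bounded_linear.suminf[OF bounded_linear_vec_nth summable_norm_cancel[OF s]]
          by (simp add: vec_eq_iff G_def)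
        then show "norm (G x) \<le> (\<Sum>k. norm (g k x))" using summable_norm[OF s] by simp
      qed
    qed (use Gi in simp)
    also have "(LINT x|disk_leb. (\<Sum>k. norm (g k x))) = (\<Sum>k. LINT x|disk_leb. norm (g k x))"
    proof -
      have "(\<lambda>k. LINT x|disk_leb. norm (g k x) * 1) sums (LINT x|disk_leb. (\<Sum>k. norm (g k x)) * 1)"
        by (rule L1_series(2)[of _ "\<lambda>k x. norm (g k x)" _ 1]) (use ig sg in auto)
      then show ?thesis by (simp add: sums_iff)
    qed
    finally show ?thesis .
  qed
  then show ?thesis using that BV trace by blast
qed

text \<open>Damping by the radial factor \<open>(x \<bullet> x)\<^sup>n\<close> concentrates \<open>F\<close> near the circle, and Green's
  formula for the field \<open>H x (x \<bullet> x)\<^sup>n\<close> turns the radial part of the gradient into a boundary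
  integral.\<close>

lemma boundary_layer:
  assumes F: "has_grad F F'" and H: "has_grad H H'"
    and le: "\<And>x. x \<in> disk \<Longrightarrow> \<bar>F x\<bar> \<le> H x" and e: "e > 0"
  obtains u U where "has_grad u U" "\<And>x. norm x = 1 \<Longrightarrow> u x = F x"
    "(LINT x|disk_leb. \<bar>u x\<bar>) \<le> e"
    "(LINT x|disk_leb. norm (U x)) \<le> (LINT x|circle_measure. H x) + e"
proof -
  note c = has_grad_continuous[OF F] has_grad_continuous[OF H] has_grad_continuous_grad[OF F] has_grad_continuous_grad[OF H]
  have "continuous_on UNIV (\<lambda>x. norm (F' x) + norm (H' x) + \<bar>F x\<bar>)" by (intro continuous_intros c)
  then obtain M where M: "\<And>x. x \<in> disk \<Longrightarrow> \<bar>norm (F' x) + norm (H' x) + \<bar>F x\<bar>\<bar> \<le> M" by (rule bounded_on_disk) blast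
  have M': "norm (F' x) \<le> M" "norm (H' x) \<le> M" "\<bar>F x\<bar> \<le> M" if "x \<in> disk" for x
    using M[OF that] norm_ge_zero[of "F' x"] norm_ge_zero[of "H' x"] by linarith+
  have M0: "0 \<le> M" using M'(3)[of 0] by simp
  interpret D: finite_measure disk_leb by (rule finite_measure_disk_leb)
  have sq: "0 \<le> x \<bullet> x" "x \<bullet> x < 1" if "x \<in> disk" for x :: "real^2"
  proof -
    have "(norm x)\<^sup>2 < 1" using that by (simp add: abs_square_less_1)
    then show "x \<bullet> x < 1" by (simp add: dot_square_norm)
  qed simp
  have cp: "continuous_on S (\<lambda>x::real^2. (x \<bullet> x) ^ n)" for n S by (intro continuous_intros)
  have ip: "integrable disk_leb (\<lambda>x. (x \<bullet> x) ^ n)" for n by (rule integrable_disk_leb_continuous[OF cp])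
  have "(\<lambda>n. LINT x|disk_leb. (x \<bullet> x) ^ Suc n) \<longlonglongrightarrow> (LINT x|disk_leb. 0)"
  proof (rule integral_dominated_convergence[where w = "\<lambda>_. 1"])
    show "(\<lambda>x. (x \<bullet> x) ^ Suc n) \<in> borel_measurable disk_leb" for n using ip[of "Suc n"] by (rule borel_measurable_integrable)
    show "AE x in disk_leb. norm ((x \<bullet> x) ^ Suc n) \<le> 1" for n
    proof (rule AE_I2)
      fix x :: "real^2" assume "x \<in> space disk_leb"
      then have x: "x \<in> disk" by (simp only: space_disk_leb)
      show "norm ((x \<bullet> x) ^ Suc n) \<le> 1"
        using power_le_one[OF sq(1)[OF x] less_imp_le[OF sq(2)[OF x]], of "Suc n"] zero_le_power[OF sq(1)[OF x], of "Suc n"]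
        by (simp only: real_norm_def abs_of_nonneg)
    qed
    show "AE x in disk_leb. (\<lambda>n. (x \<bullet> x) ^ Suc n) \<longlonglongrightarrow> 0"
    proof (rule AE_I2)
      fix x :: "real^2" assume "x \<in> space disk_leb"
      then have x: "x \<in> disk" by (simp only: space_disk_leb)
      have "norm (x \<bullet> x) < 1" using sq[OF x] by (simp only: real_norm_def abs_of_nonneg)
      then show "(\<lambda>n. (x \<bullet> x) ^ Suc n) \<longlonglongrightarrow> 0" by (intro LIMSEQ_Suc[OF LIMSEQ_power_zero])
    qed
  qed auto
  then have "(\<lambda>n. (2 * M) * (LINT x|disk_leb. (x \<bullet> x) ^ Suc n)) \<longlonglongrightarrow> (2 * M) * 0"
    by (intro tendsto_mult_left) simp
  then have "\<forall>\<^sub>F n in sequentially. (2 * M) * (LINT x|disk_leb. (x \<bullet> x) ^ Suc n) < e"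
    using e by (intro order_tendstoD(2)) auto
  then obtain m where m: "(2 * M) * (LINT x|disk_leb. (x \<bullet> x) ^ Suc m) < e"
    by (meson eventually_happens' sequentially_bot)
  \<comment> \<open>Being a successor, \<open>n\<close> has the predecessor \<open>m\<close>, which
    is the exponent in the gradient of \<open>(x \<bullet> x) ^ n\<close>.\<close>
  define n where "n = Suc m"
  define a where "a = (LINT x|disk_leb. (x \<bullet> x) ^ n)"
  have a: "2 * M * a < e" "0 \<le> a" using m by (auto simp: a_def n_def intro!: Bochner_Integration.integral_nonneg)
  \<comment> \<open>The exponent is one larger than that of the field
    \<open>(x \<bullet> x) ^ n *\<^sub>R x\<close> used below. In dimension 2 this field has
    divergence \<open>2 * (n + 1) * (x \<bullet> x) ^ n\<close>, the same factor that appears in the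
    gradient of \<open>(x \<bullet> x) ^ Suc n\<close>.\<close>
  define u where "u x = F x * (x \<bullet> x) ^ Suc n" for x
  define U where "U x = F x *\<^sub>R ((2 * real (Suc n) * (x \<bullet> x) ^ n) *\<^sub>R x) + (x \<bullet> x) ^ Suc n *\<^sub>R F' x" for x
  have u: "has_grad u U"
    unfolding u_def U_def using has_grad_mult[OF F has_grad_inner_power[of "Suc n"]] by simp
  have u1: "u x = F x" if "norm x = 1" for x
    using that by (simp add: u_def dot_square_norm)
  have pw: "(x \<bullet> x) ^ Suc n \<le> (x \<bullet> x) ^ n" "0 \<le> (x \<bullet> x) ^ n" if "x \<in> disk" for x :: "real^2"
    using sq[OF that] by (auto intro!: power_decreasing mult_left_le_one_le)
  have ua: "(LINT x|disk_leb. \<bar>u x\<bar>) \<le> e"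
  proof -
    have "(LINT x|disk_leb. \<bar>u x\<bar>) \<le> (LINT x|disk_leb. M * (x \<bullet> x) ^ n)"
    proof (rule integral_mono)
      show "integrable disk_leb (\<lambda>x. \<bar>u x\<bar>)"
        by (intro integrable_disk_leb_continuous continuous_intros has_grad_continuous[OF u])
      show "integrable disk_leb (\<lambda>x. M * (x \<bullet> x) ^ n)" using ip by simp
      fix x assume "x \<in> space disk_leb"
      then have x: "x \<in> disk" by (simp only: space_disk_leb)
      have "\<bar>u x\<bar> = \<bar>F x\<bar> * (x \<bullet> x) ^ Suc n" by (simp add: u_def abs_mult)
      also have "\<dots> \<le> M * (x \<bullet> x) ^ n"
        using M'(3)[OF x] pw[OF x] M0 by (intro mult_mono) auto
      finally show "\<bar>u x\<bar> \<le> M * (x \<bullet> x) ^ n" .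
    qed
    also have "\<dots> = M * a" by (simp add: a_def)
    also have "\<dots> \<le> e" using a M0 mult_nonneg_nonneg[OF M0 a(2)] by linarith
    finally show ?thesis .
  qed
  \<comment> \<open>The component of the radial field by which \<open>H\<close> is multiplied. The
    smooth majorant \<open>H\<close> is used because \<open>\<bar>F x\<bar>\<close> need not be
    differentiable.\<close>
  define W where "W i x = x $ i * (x \<bullet> x) ^ n" for i and x :: "real^2"
  define W' where "W' i x = x $ i *\<^sub>R ((2 * real n * (x \<bullet> x) ^ m) *\<^sub>R x) + (x \<bullet> x) ^ n *\<^sub>R axis i 1" for i and x :: "real^2"
  have W: "has_grad (W i) (W' i)" for i
    unfolding W_def W'_def using has_grad_mult[OF has_grad_component has_grad_inner_power[of n], of i] by (simp add: n_def)
  have HW: "has_grad (\<lambda>x. H x * W i x) (\<lambda>x. H x *\<^sub>R W' i x + W i x *\<^sub>R H' x)" for i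
    by (rule has_grad_mult[OF H W])
  define S where "S x = H x * (2 * real (Suc n) * (x \<bullet> x) ^ n) + (x \<bullet> x) ^ n * (x \<bullet> H' x)" for x
  have Sc: "continuous_on X S" for X unfolding S_def by (intro continuous_intros c)
  have div: "(\<Sum>i\<in>UNIV. (H x *\<^sub>R W' i x + W i x *\<^sub>R H' x) $ i) = S x" for x
  proof -
    have "(\<Sum>i\<in>UNIV. W' i x $ i) = 2 * real n * (x \<bullet> x) ^ m * (x \<bullet> x) + 2 * (x \<bullet> x) ^ n"
      by (simp add: W'_def sum.distrib UNIV_2 inner_vec_def algebra_simps)
    also have "\<dots> = 2 * real (Suc n) * (x \<bullet> x) ^ n" by (simp add: n_def algebra_simps)
    finally have 1: "(\<Sum>i\<in>UNIV. W' i x $ i) = 2 * real (Suc n) * (x \<bullet> x) ^ n" .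
    have 2: "(\<Sum>i\<in>UNIV. W i x * H' x $ i) = (x \<bullet> x) ^ n * (x \<bullet> H' x)"
      by (simp add: W_def inner_vec_def[of x "H' x"] sum_distrib_left mult_ac)
    have "(\<Sum>i\<in>UNIV. (H x *\<^sub>R W' i x + W i x *\<^sub>R H' x) $ i) = H x * (\<Sum>i\<in>UNIV. W' i x $ i) + (\<Sum>i\<in>UNIV. W i x * H' x $ i)"
      by (simp add: sum.distrib sum_distrib_left)
    then show ?thesis unfolding 1 2 S_def .
  qed
  have flux: "(LINT x|disk_leb. S x) = (LINT x|circle_measure. H x)"
  proof -
    have "(LINT x|disk_leb. S x)
        = (\<Sum>i\<in>UNIV. LINT x|disk_leb. (H x *\<^sub>R W' i x + W i x *\<^sub>R H' x) $ i)"
      unfolding div[symmetric]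
      by (rule Bochner_Integration.integral_sum)
        (intro integrable_vec_nth integrable_disk_leb_continuous has_grad_continuous_grad[OF HW])
    also have "\<dots> = (\<Sum>i\<in>UNIV. LINT x|circle_measure. x $ i * (H x * W i x))"
      unfolding integral_disk_leb by (intro sum.cong refl green_disk HW)
    also have "\<dots> = (LINT x|circle_measure. (\<Sum>i\<in>UNIV. x $ i * (H x * W i x)))"
      by (rule Bochner_Integration.integral_sum[symmetric])
        (intro integrable_circle_measure_continuous continuous_intros has_grad_continuous[OF HW])
    also have "\<dots> = (LINT x|circle_measure. H x)"
    proof (rule Bochner_Integration.integral_cong[OF refl])
      fix x assume "x \<in> space circle_measure"
      then have x: "x \<bullet> x = 1" by (simp add: space_circle_measure dot_square_norm)
      have "(\<Sum>i\<in>UNIV. x $ i * (H x * W i x)) = H x * (x \<bullet> x) ^ n * (\<Sum>i\<in>UNIV. x $ i * x $ i)"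
        by (simp add: W_def sum_distrib_left mult_ac)
      also have "(\<Sum>i\<in>UNIV. x $ i * x $ i) = x \<bullet> x" by (simp add: inner_vec_def)
      finally show "(\<Sum>i\<in>UNIV. x $ i * (H x * W i x)) = H x" by (simp add: x)
    qed
    finally show ?thesis .
  qed
  \<comment> \<open>The term of \<open>U\<close> that differentiates the damping factor is dominated
    by the first term of \<open>S\<close>. The terms with \<open>F'\<close> and \<open>H'\<close>
    contribute at most \<open>M * (x \<bullet> x) ^ n\<close> each, whence the correction with
    factor \<open>2 * M\<close>.\<close>
  have "(LINT x|disk_leb. norm (U x)) \<le> (LINT x|disk_leb. S x + 2 * M * (x \<bullet> x) ^ n)"
  proof (rule integral_mono)
    show "integrable disk_leb (\<lambda>x. norm (U x))"
      by (intro integrable_disk_leb_continuous continuous_intros has_grad_continuous_grad[OF u])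
    show "integrable disk_leb (\<lambda>x. S x + 2 * M * (x \<bullet> x) ^ n)"
      by (intro integrable_disk_leb_continuous continuous_intros Sc)
    fix x assume "x \<in> space disk_leb"
    then have x: "x \<in> disk" by (simp only: space_disk_leb)
    have nx: "norm x \<le> 1" using x by simp
    have "norm (U x) \<le> norm (F x *\<^sub>R ((2 * real (Suc n) * (x \<bullet> x) ^ n) *\<^sub>R x)) + norm ((x \<bullet> x) ^ Suc n *\<^sub>R F' x)"
      unfolding U_def by (rule norm_triangle_ineq)
    also have "norm (F x *\<^sub>R ((2 * real (Suc n) * (x \<bullet> x) ^ n) *\<^sub>R x)) = (\<bar>F x\<bar> * (2 * real (Suc n) * (x \<bullet> x) ^ n)) * norm x"
      using pw(2)[OF x] by (simp add: abs_mult)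
    also have "\<dots> \<le> (H x * (2 * real (Suc n) * (x \<bullet> x) ^ n)) * 1"
      using le[OF x] pw(2)[OF x] nx by (intro mult_mono mult_nonneg_nonneg) auto
    also have "norm ((x \<bullet> x) ^ Suc n *\<^sub>R F' x) = (x \<bullet> x) ^ Suc n * norm (F' x)" by simp
    also have "\<dots> \<le> (x \<bullet> x) ^ n * M"
      using pw[OF x] M'(1)[OF x] by (intro mult_mono) auto
    finally have 1: "norm (U x) \<le> H x * (2 * real (Suc n) * (x \<bullet> x) ^ n) + (x \<bullet> x) ^ n * M"
      by (simp only: mult_1_right)
    have "\<bar>x \<bullet> H' x\<bar> \<le> norm x * norm (H' x)" by (rule Cauchy_Schwarz_ineq2)
    also have "\<dots> \<le> 1 * M" using nx M'(2)[OF x] by (intro mult_mono) auto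
    finally have "- M \<le> x \<bullet> H' x" by linarith
    then have "(x \<bullet> x) ^ n * (- M) \<le> (x \<bullet> x) ^ n * (x \<bullet> H' x)" by (rule mult_left_mono[OF _ pw(2)[OF x]])
    then have "- ((x \<bullet> x) ^ n * M) \<le> (x \<bullet> x) ^ n * (x \<bullet> H' x)" by (simp only: mult_minus_right)
    moreover have "2 * M * (x \<bullet> x) ^ n = (x \<bullet> x) ^ n * M + (x \<bullet> x) ^ n * M" by simp
    ultimately show "norm (U x) \<le> S x + 2 * M * (x \<bullet> x) ^ n"
      using 1 unfolding S_def by linarith
  qed
  also have "\<dots> = (LINT x|circle_measure. H x) + 2 * M * a"
    unfolding flux[symmetric] a_def
    by (subst Bochner_Integration.integral_add)
      (auto intro!: integrable_disk_leb_continuous continuous_intros Sc)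
  finally have Ua: "(LINT x|disk_leb. norm (U x)) \<le> (LINT x|circle_measure. H x) + e" using a by linarith
  show ?thesis by (rule that[OF u u1 ua Ua])
qed

text \<open>Monotonicity is the point: successive differences have a constant sign on the closed
  disk, so their absolute values coincide there with smooth functions and their \<open>L^1\<close>
  norms telescope.\<close>

lemma decreasing_C1_approximation:
  assumes C: "compact C" "C \<noteq> {}"
  obtains p P where "\<And>k. has_grad (p k) (P k)" "\<And>k x. x \<in> cball 0 1 \<Longrightarrow> p (Suc k) x \<le> p k x"
    "\<And>k x. x \<in> cball 0 1 \<Longrightarrow> 0 \<le> p k x \<and> p k x \<le> 3"
    "\<And>x. x \<in> cball 0 1 \<Longrightarrow> (\<lambda>k. p k x) \<longlonglongrightarrow> indicator C x"
proof -
  \<comment> \<open>The summand \<open>(1/2) ^ k\<close> creates a strict decrease of at least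
    \<open>(1/2) ^ k / 2\<close> from \<open>q k\<close> to \<open>q (Suc k)\<close>. Polynomials
    within \<open>(1/2) ^ k / 8\<close> of \<open>q k\<close> therefore still decrease, and they
    stay nonnegative.\<close>
  define q where "q k x = max 0 (1 - real k * infdist x C) + (1/2) ^ k" for k and x :: "real^2"
  have "\<exists>p P. has_grad p P \<and> (\<forall>x\<in>cball 0 1. \<bar>q k x - p x\<bar> < (1/2) ^ k / 8)" for k
  proof -
    have "continuous_on (cball 0 1) (q k)" unfolding q_def by (intro continuous_intros)
    then obtain p where p: "real_polynomial_function p" "\<And>x. x \<in> cball 0 1 \<Longrightarrow> \<bar>q k x - p x\<bar> < (1/2) ^ k / 8"
      by (rule Stone_Weierstrass_real_polynomial_function[OF compact_cball, of _ _ _ "(1/2) ^ k / 8"]) auto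
    obtain P where "has_grad p P" by (rule real_polynomial_function_has_grad[OF p(1)])
    then show ?thesis using p(2) by blast
  qed
  then obtain p P where p: "\<And>k. has_grad (p k) (P k)" "\<And>k x. x \<in> cball 0 1 \<Longrightarrow> \<bar>q k x - p k x\<bar> < (1/2) ^ k / 8"
    by metis
  have half: "(1/2 :: real) ^ k > 0" "(1/2 :: real) ^ k \<le> 1" for k by (auto intro: power_le_one)
  have qle: "q (Suc k) x + (1/2) ^ k / 2 \<le> q k x" for k x
  proof -
    have "real k * infdist x C \<le> real (Suc k) * infdist x C" by (intro mult_right_mono infdist_nonneg) simp
    then show ?thesis by (simp add: q_def)
  qed
  have dec: "p (Suc k) x \<le> p k x" if "x \<in> cball 0 1" for k x
    using p(2)[OF that, of k] p(2)[OF that, of "Suc k"] qle[of k x] half(1)[of k] by (simp only: power_Suc)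
  have bd: "0 \<le> p k x \<and> p k x \<le> 3" if "x \<in> cball 0 1" for k x
  proof -
    have "0 \<le> real k * infdist x C" by (simp add: infdist_nonneg)
    then have "(1/2) ^ k \<le> q k x" "q k x \<le> 1 + (1/2) ^ k" by (auto simp: q_def)
    then show ?thesis using p(2)[OF that, of k] half[of k] by linarith
  qed
  have lim: "(\<lambda>k. p k x) \<longlonglongrightarrow> indicator C x" if x: "x \<in> cball 0 1" for x
  proof -
    have h0: "(\<lambda>k. (1/2 :: real) ^ k) \<longlonglongrightarrow> 0" by (rule LIMSEQ_power_zero) simp
    have "(\<lambda>k. max 0 (1 - real k * infdist x C)) \<longlonglongrightarrow> indicator C x"
    proof (cases "x \<in> C")
      case True
      then show ?thesis by simp
    next
      case False
      then have d: "infdist x C > 0"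
        using in_closed_iff_infdist_zero[OF compact_imp_closed[OF C(1)] C(2), of x] infdist_nonneg[of x C] by linarith
      obtain N where N: "1 < real N * infdist x C" using reals_Archimedean3[OF d] by blast
      have "\<forall>\<^sub>F k in sequentially. 0 = max 0 (1 - real k * infdist x C)"
      proof (rule eventually_sequentiallyI)
        fix k assume "N \<le> k"
        then have "real N * infdist x C \<le> real k * infdist x C" using d by (intro mult_right_mono) auto
        then show "0 = max 0 (1 - real k * infdist x C)" using N by simp
      qed
      then have "(\<lambda>k. max 0 (1 - real k * infdist x C)) \<longlonglongrightarrow> 0" by (rule Lim_transform_eventually[OF tendsto_const])
      then show ?thesis using False by simp
    qed
    then have "(\<lambda>k. q k x) \<longlonglongrightarrow> indicator C x + 0" unfolding q_def using h0 by (rule tendsto_add)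
    moreover have "(\<lambda>k. q k x - p k x) \<longlonglongrightarrow> 0"
    proof (rule tendsto_rabs_zero_cancel, rule tendsto_sandwich[OF _ _ tendsto_const h0])
      have "\<bar>q k x - p k x\<bar> \<le> (1/2) ^ k" for k
        using p(2)[OF x, of k] half(1)[of k] by linarith
      then show "\<forall>\<^sub>F k in sequentially. \<bar>q k x - p k x\<bar> \<le> (1/2) ^ k" by simp
    qed simp
    ultimately have "(\<lambda>k. q k x - (q k x - p k x)) \<longlonglongrightarrow> indicator C x + 0 - 0" by (intro tendsto_diff)
    then show ?thesis by simp
  qed
  show ?thesis by (rule that[OF p(1) dec bd lim])
qed

text \<open>The indicator is \<open>p N\<close> plus the later increments. For large
  \<open>N\<close> the term \<open>p N\<close> costs little more than the length, and the
  increments, all nonpositive, cost together \<open>I N - \<kappa>\<close>, which is small.\<close>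

lemma BV_extension_of_indicator:
  assumes C: "compact C" "C \<noteq> {}" and e: "e > 0"
  obtains w where "BV w" "has_trace w (indicator C)"
    "total_variation w \<le> ennreal ((LINT x|circle_measure. indicator C x) + e)"
proof -
  obtain p P where p: "\<And>k. has_grad (p k) (P k)" "\<And>k x. x \<in> cball 0 1 \<Longrightarrow> p (Suc k) x \<le> p k x"
    "\<And>k x. x \<in> cball 0 1 \<Longrightarrow> 0 \<le> p k x \<and> p k x \<le> 3"
    "\<And>x. x \<in> cball 0 1 \<Longrightarrow> (\<lambda>k. p k x) \<longlonglongrightarrow> indicator C x"
    by (rule decreasing_C1_approximation[OF C]) blast
  define \<kappa> :: real where "\<kappa> = (LINT x|circle_measure. indicator C x)"
  define I where "I k = (LINT x|circle_measure. p k x)" for k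
  have ic: "integrable circle_measure (p k)" for k
    by (rule integrable_circle_measure_continuous[OF has_grad_continuous[OF p(1)]])
  have sp: "x \<in> cball 0 1" if "x \<in> space circle_measure" for x
    using that by (simp add: space_circle_measure)
  have I: "I \<longlonglongrightarrow> \<kappa>"
    unfolding I_def \<kappa>_def
  proof (rule integral_dominated_convergence[where w = "\<lambda>_. 3"])
    show "indicator C \<in> borel_measurable circle_measure"
      using C(1) by (intro measurable_circle_measure borel_measurable_indicator borel_compact)
    show "p k \<in> borel_measurable circle_measure" for k using ic by (rule borel_measurable_integrable)
    show "integrable circle_measure (\<lambda>_. 3::real)" by (rule integrable_circle_measure_continuous) simp
    show "AE x in circle_measure. (\<lambda>k. p k x) \<longlonglongrightarrow> indicator C x" using p(4) sp by (intro AE_I2) blast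
    show "AE x in circle_measure. norm (p k x) \<le> 3" for k
      using p(3) sp by (intro AE_I2) (metis abs_of_nonneg real_norm_def)
  qed
  then have "\<forall>\<^sub>F k in sequentially. I k < \<kappa> + e / 3"
    using e by (intro order_tendstoD(2)) auto
  \<comment> \<open>The total cost \<open>I N + (I N - \<kappa>) + e / 3\<close> is then below
    \<open>\<kappa> + e\<close>: one third for each occurrence of \<open>I N\<close> and one for the
    boundary layers.\<close>
  then obtain N where N: "I N < \<kappa> + e / 3" by (meson eventually_happens' sequentially_bot)
  define F where "F j x = (case j of 0 \<Rightarrow> p N x | Suc i \<Rightarrow> p (N + Suc i) x - p (N + i) x)" for j x
  define F' where "F' j x = (case j of 0 \<Rightarrow> P N x | Suc i \<Rightarrow> P (N + Suc i) x - P (N + i) x)" for j x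
  \<comment> \<open>The absolute value of \<open>F j\<close> on the closed unit disk, obtained by a
    choice of sign; unlike the absolute value it is smooth on the whole plane, as the boundary layer
    construction requires.\<close>
  define H where "H j x = (case j of 0 \<Rightarrow> p N x | Suc i \<Rightarrow> p (N + i) x - p (N + Suc i) x)" for j x
  define H' where "H' j x = (case j of 0 \<Rightarrow> P N x | Suc i \<Rightarrow> P (N + i) x - P (N + Suc i) x)" for j x
  have F: "has_grad (F j) (F' j)" for j
    unfolding F_def F'_def by (cases j) (auto intro!: has_grad_diff p(1))
  have H: "has_grad (H j) (H' j)" for j
    unfolding H_def H'_def by (cases j) (auto intro!: has_grad_diff p(1))
  have FH: "\<bar>F j x\<bar> = H j x" if "x \<in> cball 0 1" for j x
    using p(2,3)[OF that] by (cases j) (auto simp: F_def H_def)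
  have FHd: "\<bar>F j x\<bar> \<le> H j x" if "x \<in> disk" for j x
  proof -
    have "x \<in> cball 0 1" using that by simp
    then show ?thesis using FH by simp
  qed
  \<comment> \<open>The tolerances of the boundary layers sum to \<open>e / 3\<close>. They also
    bound the \<open>L^1\<close> norms on the disk and make those summable.\<close>
  define \<epsilon> where "\<epsilon> j = (e / 3) * (1/2) ^ Suc j" for j
  have \<epsilon>: "\<epsilon> j > 0" for j using e by (simp add: \<epsilon>_def)
  have se: "\<epsilon> sums (e / 3)"
    unfolding \<epsilon>_def using sums_mult[OF power_half_series, of "e / 3"] by simp
  define Q where "Q j u U \<longleftrightarrow> has_grad u U \<and> (\<forall>x. norm x = 1 \<longrightarrow> u x = F j x) \<and> (LINT x|disk_leb. \<bar>u x\<bar>) \<le> \<epsilon> j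
      \<and> (LINT x|disk_leb. norm (U x)) \<le> (LINT x|circle_measure. H j x) + \<epsilon> j" for j u U
  have "\<exists>u U. Q j u U" for j
  proof (rule boundary_layer[OF F[of j] H[of j] FHd \<epsilon>[of j]])
    fix u U
    assume "has_grad u U" "\<And>x. norm x = 1 \<Longrightarrow> u x = F j x" "(LINT x|disk_leb. \<bar>u x\<bar>) \<le> \<epsilon> j"
      "(LINT x|disk_leb. norm (U x)) \<le> (LINT x|circle_measure. H j x) + \<epsilon> j"
    then have "Q j u U" unfolding Q_def by simp
    then show "\<exists>u U. Q j u U" by blast
  qed
  then obtain v g where "\<And>j. Q j (v j) (g j)" by metis
  then have v: "\<And>j. has_grad (v j) (g j)" "\<And>j x. norm x = 1 \<Longrightarrow> v j x = F j x"
    "\<And>j. (LINT x|disk_leb. \<bar>v j x\<bar>) \<le> \<epsilon> j"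
    "\<And>j. (LINT x|disk_leb. norm (g j x)) \<le> (LINT x|circle_measure. H j x) + \<epsilon> j"
    unfolding Q_def by simp_all
  have tele: "(\<lambda>i. a (N + Suc i) - a (N + i)) sums (l - a N)" if "a \<longlonglongrightarrow> l" for a :: "nat \<Rightarrow> real" and l
    using telescope_sums[of "\<lambda>i. a (N + i)" l] that LIMSEQ_ignore_initial_segment[of a l N]
    by (simp add: add.commute)
  have IH: "(\<lambda>j. LINT x|circle_measure. H j x) sums (I N + (I N - \<kappa>))"
  proof -
    have "(\<lambda>i. - (I (N + Suc i) - I (N + i))) sums - (\<kappa> - I N)" by (intro sums_minus tele I)
    moreover have "(LINT x|circle_measure. H (Suc i) x) = - (I (N + Suc i) - I (N + i))" for i
      using ic by (simp add: H_def I_def)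
    ultimately have "(\<lambda>i. LINT x|circle_measure. H (Suc i) x) sums (I N - \<kappa>)" by simp
    moreover have "(LINT x|circle_measure. H 0 x) = I N" by (simp add: H_def I_def)
    ultimately show ?thesis using sums_Suc[of "\<lambda>j. LINT x|circle_measure. H j x"] by (metis add.commute)
  qed
  have sH: "(\<lambda>j. (LINT x|circle_measure. H j x) + \<epsilon> j) sums (I N + (I N - \<kappa>) + e / 3)"
    by (rule sums_add[OF IH se])
  have sg: "summable (\<lambda>j. LINT x|disk_leb. norm (g j x))"
    by (rule summable_comparison_test'[OF sums_summable[OF sH]]) (use v(4) in auto)
  have sv: "summable (\<lambda>j. LINT x|disk_leb. \<bar>v j x\<bar>)"
    by (rule summable_comparison_test'[OF sums_summable[OF se]]) (use v(3) in auto)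
  have "(LINT x|circle_measure. \<bar>v j x\<bar>) = (LINT x|circle_measure. H j x)" for j
  proof (rule Bochner_Integration.integral_cong[OF refl])
    fix x assume x: "x \<in> space circle_measure"
    then have "norm x = 1" by (simp add: space_circle_measure)
    then show "\<bar>v j x\<bar> = H j x" using v(2) FH[OF sp[OF x]] by simp
  qed
  then have sc: "summable (\<lambda>j. LINT x|circle_measure. \<bar>v j x\<bar>)" using IH by (simp add: sums_iff)
  have tr: "(\<lambda>j. v j x) sums indicator C x" if x: "norm x = 1" for x
  proof -
    have xc: "x \<in> cball 0 1" using x by simp
    have "(\<lambda>i. F (Suc i) x) sums (indicator C x - p N x)"
      using tele[OF p(4)[OF xc]] by (simp add: F_def)
    then have "(\<lambda>j. F j x) sums (indicator C x - p N x + F 0 x)" by (rule sums_Suc)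
    then show ?thesis by (simp add: v(2)[OF x] F_def)
  qed
  obtain w where w: "BV w" "has_trace w (indicator C)"
    "total_variation w \<le> ennreal (\<Sum>j. LINT x|disk_leb. norm (g j x))"
    by (rule BV_of_series[OF v(1) sv sg sc tr])
  have "(\<Sum>j. LINT x|disk_leb. norm (g j x)) \<le> I N + (I N - \<kappa>) + e / 3"
    using suminf_le[OF v(4) sg sums_summable[OF sH]] sums_unique[OF sH] by simp
  also have "\<dots> \<le> \<kappa> + e" using N by linarith
  finally have "total_variation w \<le> ennreal (\<kappa> + e)" using w(3) ennreal_leI order_trans by blast
  then show ?thesis using that w unfolding \<kappa>_def by blast
qed

section \<open>The length of the datum and the absence of a minimiser\<close>

lemma integral_circle_indicator_image:
  assumes "compact K" "K \<subseteq> {0..1/256}"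
  shows "(LINT x|circle_measure. indicator (circ ` K) x) = measure lborel K"
    "integrable circle_measure (indicat_real (circ ` K))"
proof -
  have [measurable]: "circ ` K \<in> sets borel" using compact_circ_image[OF assms(1)] by (simp add: borel_compact)
  have eq: "indicator {0..<2 * pi} t *\<^sub>R indicat_real (circ ` K) (circ t) = indicator K t" for t
  proof (cases "t \<in> {0..<2 * pi}")
    case True
    then show ?thesis using circ_mem_image_iff[OF assms(2) True] by (simp add: indicator_def)
  next
    case False
    then have "t \<notin> K" using assms(2) pi_gt3 by force
    then show ?thesis using False by simp
  qed
  have "(LINT x|circle_measure. indicator (circ ` K) x) = (LINT t:{0..<2 * pi}|lborel. indicat_real (circ ` K) (circ t))"
    by (rule integral_circle_measure(1)) measurable
  also have "\<dots> = (LINT t|lborel. indicator K t)"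
    unfolding set_lebesgue_integral_def eq ..
  finally show "(LINT x|circle_measure. indicator (circ ` K) x) = measure lborel K" by simp
  have "integrable lborel (indicat_real K)"
    using fmeasurable_compact[OF assms(1)] by (simp add: fmeasurable_def)
  then have "set_integrable lborel {0..<2 * pi} (\<lambda>t. indicat_real (circ ` K) (circ t))"
    unfolding set_integrable_def eq .
  then show "integrable circle_measure (indicat_real (circ ` K))"
    by (subst integral_circle_measure(2)) measurable
qed

unused_thms

theorem theorem1p1:
  "\<exists>f :: real^2 \<Rightarrow> real. integrable circle_measure f \<and>
     \<not> (\<exists>w. BV w \<and> has_trace w f \<and>
          (\<forall>v. BV v \<and> has_trace v f \<longrightarrow> total_variation w \<le> total_variation v))"
proof -
  obtain K :: "real set" where K: "compact K" "K \<subseteq> {0..1/256}" "measure lborel K > 0"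
    "\<And>s t. 0 \<le> s \<Longrightarrow> s \<le> t \<Longrightarrow> t \<le> 1/256 \<Longrightarrow> measure lborel (K \<inter> {s..t}) \<le> (t - s) - 2 * (t - s)\<^sup>2"
    by (rule fat_closed_set) blast
  let ?C = "circ ` K" and ?\<kappa> = "measure lborel K"
  have C: "compact ?C" "?C \<noteq> {}" using compact_circ_image[OF K(1)] K(3) by auto
  have "\<not> (\<exists>w. BV w \<and> has_trace w (indicator ?C) \<and>
          (\<forall>v. BV v \<and> has_trace v (indicator ?C) \<longrightarrow> total_variation w \<le> total_variation v))"
  proof (intro notI, elim exE conjE)
    fix w assume w: "BV w" "has_trace w (indicator ?C)"
      and min: "\<forall>v. BV v \<and> has_trace v (indicator ?C) \<longrightarrow> total_variation w \<le> total_variation v"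
    \<comment> \<open>A minimiser lies below every extension of the datum, hence below
      \<open>?\<kappa> + e\<close> for all positive \<open>e\<close>; in the limit this contradicts
      the strict lower bound.\<close>
    have approx: "total_variation w \<le> ennreal ?\<kappa> + ennreal e" if e: "e > 0" for e
    proof -
      obtain v where v: "BV v" "has_trace v (indicator ?C)"
        "total_variation v \<le> ennreal ((LINT x|circle_measure. indicator ?C x) + e)"
        by (rule BV_extension_of_indicator[OF C e])
      have "total_variation w \<le> total_variation v" using min v(1,2) by blast
      also have "\<dots> \<le> ennreal (?\<kappa> + e)" using v(3) integral_circle_indicator_image(1)[OF K(1,2)] by simp
      finally show ?thesis using e by simp
    qed
    have "total_variation w \<le> ennreal ?\<kappa>"
      by (rule ennreal_le_epsilon) (rule approx)
    then show False using calibrated_lower_bound[OF K w] by simp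
  qed
  then show ?thesis using integral_circle_indicator_image(2)[OF K(1,2)] by blast
qed

end
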